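(* Let $N\ge 1$, $1\le p,q\le\infty$, $\alpha>0$, and let $s$ be the smallest integer greater than $\alpha$. For $f\in H(\mathbb B_N)$, $$f\in\Lambda^{p,q}_\alpha(\mathbb B_N)\iff \nabla_s(f)\in L^{p,q}_{s-\alpha}(\mathbb B_N).$$
   Context: $\mathbb B_N$ is the unit ball of $\mathbb C^N$, $\mathbb S_N=\partial\mathbb B_N$, $\sigma$ is the normalized Lebesgue measure on $\mathbb S_N$, and $H(\mathbb B_N)$ is the space of holomorphic functions on $\mathbb B_N$. For a Borel function $g$ on $\mathbb B_N$ and $0<r<1$, $M_p(r,g)=\left(\int_{\mathbb S_N}|g(r\zeta)|^p\,d\sigma(\zeta)\right)^{1/p}$ for $1\le p<\infty$ and $M_\infty(r,g)=\operatorname{ess\,sup}_{\zeta\in\mathbb S_N}|g(r\zeta)|$. For $\beta\in\mathbb R$, $L^{p,q}_\beta(\mathbb B_N)$ is the class of functions $g$ on $\mathbb B_N$ with $\|g\|_{p,q,\beta}<\infty$, where $\|g\|_{p,q,\beta}=\left(2N\int_0^1M_p^q(r,g)(1-r^2)^{q\beta-1}r^{2N-1}\,dr\right)^{1/q}$ for $q<\infty$ and $\|g\|_{p,\infty,\beta}=\operatorname{ess\,sup}_{0\le r<1}(1-r^2)^\beta M_p(r,g)$. If $f\in H(\mathbb B_N)$ has homogeneous expansion $f=\sum_{k\ge0}f_k$ ($f_k$ a homogeneous polynomial of degree $k$), then $\mathcal R^sf=\sum_{k\ge1}k^sf_k$ for $s\in\mathbb C$. The Besov-Lipschitz space $\Lambda^{p,q}_\alpha(\mathbb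 B_N)$, $\alpha>0$, consists of those $f\in H(\mathbb B_N)$ with $\mathcal R^sf\in L^{p,q}_{s-\alpha}(\mathbb B_N)$, where $s$ is the smallest integer greater than $\alpha$. The $s$-th order gradient is $\nabla_s(f)(z)=\left(\sum_{j_1,\dots,j_s=1}^N|\partial_{j_1}\cdots\partial_{j_s}f(z)|^2\right)^{1/2}$, where $\partial_jf=\partial f/\partial z_j$. *)

theory Defs
  imports "HOL-Probability.Essential_Supremum"
begin

definition holomorphic_in :: "(complex ^ 'n::finite \<Rightarrow> complex) \<Rightarrow> (complex ^ 'n) set \<Rightarrow> bool" where
  "holomorphic_in f U \<longleftrightarrow>
     (\<forall>z\<in>U. \<exists>D. (f has_derivative D) (at z) \<and> (\<forall>c v. D (c *s v) = c * D v))"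

text \<open>The normalized surface measure as the cone measure: the mass of a Borel set \<open>A\<close> of the sphere
  is the proportion of the volume of the unit ball occupied by the points with direction in \<open>A\<close>.
  The origin, where \<open>sgn 0 = 0\<close> is off the sphere, is a null set.\<close>
definition sphere_measure :: "(complex ^ 'n::finite) measure" where
  "sphere_measure =
     restrict_space (distr (uniform_measure lborel (ball 0 1)) borel sgn) (sphere 0 1)"

text \<open>Powers of extended nonnegative reals; used for exponents \<open>a > 0\<close> only.\<close>
definition epowr :: "ennreal \<Rightarrow> real \<Rightarrow> ennreal" where
  "epowr x a = (if x = top then top else ennreal (enn2real x powr a))"

definition integral_mean ::
    "ennreal \<Rightarrow> real \<Rightarrow> (complex ^ 'n::finite \<Rightarrow> 'b::real_normed_vector) \<Rightarrow> ennreal" where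
  "integral_mean p r g =
     (if p = top then esssup sphere_measure (\<lambda>\<zeta>. ennreal (norm (g (r *\<^sub>R \<zeta>))))
      else epowr (\<integral>\<^sup>+ \<zeta>. ennreal (norm (g (r *\<^sub>R \<zeta>)) powr enn2real p) \<partial>sphere_measure)
             (1 / enn2real p))"

definition mixed_norm ::
    "ennreal \<Rightarrow> ennreal \<Rightarrow> real \<Rightarrow> (complex ^ 'n::finite \<Rightarrow> 'b::real_normed_vector) \<Rightarrow> ennreal" where
  "mixed_norm p q \<beta> g =
     (if q = top
      then esssup (restrict_space lborel {0..<1})
             (\<lambda>r. ennreal ((1 - r\<^sup>2) powr \<beta>) * integral_mean p r g)
      else epowr (of_nat (2 * CARD('n)) *
               (\<integral>\<^sup>+ r \<in> {0<..<1}. epowr (integral_mean p r g) (enn2real q)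
                   * ennreal ((1 - r\<^sup>2) powr (enn2real q * \<beta> - 1))
                   * ennreal (r ^ (2 * CARD('n) - 1)) \<partial>lborel))
             (1 / enn2real q))"

text \<open>Functions on the ball are total functions whose values off the ball are irrelevant.\<close>
definition mixed_norm_space ::
    "ennreal \<Rightarrow> ennreal \<Rightarrow> real \<Rightarrow> (complex ^ 'n::finite \<Rightarrow> 'b::real_normed_vector) set" where
  "mixed_norm_space p q \<beta> =
     {g \<in> borel_measurable (restrict_space borel (ball 0 1)). mixed_norm p q \<beta> g < top}"

definition homogeneous_poly :: "nat \<Rightarrow> (complex ^ 'n::finite \<Rightarrow> complex) \<Rightarrow> bool" where
  "homogeneous_poly k P \<longleftrightarrow>
     (\<exists>c :: ('n \<Rightarrow> nat) \<Rightarrow> complex.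
        \<forall>z. P z = (\<Sum>m | sum m UNIV = k. c m * (\<Prod>i\<in>UNIV. z $ i ^ m i)))"

text \<open>For \<open>f\<close> holomorphic in the unit ball the homogeneous expansion exists and is unique.\<close>
definition homogeneous_expansion ::
    "(complex ^ 'n::finite \<Rightarrow> complex) \<Rightarrow> nat \<Rightarrow> complex ^ 'n \<Rightarrow> complex" where
  "homogeneous_expansion f =
     (SOME F. (\<forall>k. homogeneous_poly k (F k)) \<and> (\<forall>z\<in>ball 0 1. (\<lambda>k. F k z) sums f z))"

definition radial_derivative ::
    "complex \<Rightarrow> (complex ^ 'n::finite \<Rightarrow> complex) \<Rightarrow> complex ^ 'n \<Rightarrow> complex" where
  "radial_derivative s f z =
     (\<Sum>k. of_nat (Suc k) powr s * homogeneous_expansion f (Suc k) z)"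

text \<open>For \<open>\<alpha> > 0\<close> the integers greater than \<open>\<alpha>\<close> are natural numbers.\<close>
definition least_int_above :: "real \<Rightarrow> nat" where
  "least_int_above \<alpha> = (LEAST s. \<alpha> < real s)"

definition besov_lipschitz ::
    "ennreal \<Rightarrow> ennreal \<Rightarrow> real \<Rightarrow> (complex ^ 'n::finite \<Rightarrow> complex) set" where
  "besov_lipschitz p q \<alpha> =
     {f. holomorphic_in f (ball 0 1) \<and>
         radial_derivative (of_nat (least_int_above \<alpha>)) f
           \<in> mixed_norm_space p q (real (least_int_above \<alpha>) - \<alpha>)}"

definition partial_deriv ::
    "'n::finite \<Rightarrow> (complex ^ 'n \<Rightarrow> complex) \<Rightarrow> complex ^ 'n \<Rightarrow> complex" where
  "partial_deriv j f z = deriv (\<lambda>w. f (z + axis j w)) 0"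

definition gradient_order :: "nat \<Rightarrow> (complex ^ 'n::finite \<Rightarrow> complex) \<Rightarrow> complex ^ 'n \<Rightarrow> real" where
  "gradient_order s f z =
     sqrt (\<Sum>js | length js = s. (cmod (foldr partial_deriv js f z))\<^sup>2)"

end

theory Submission
  imports Defs "HOL-Probability.Probability_Measure" "HOL-Complex_Analysis.Cauchy_Integral_Formula"
begin

text \<open>
  Both conditions are compared with a third one: that every partial derivative of \<open>f\<close> of order \<open>s\<close> lies in
  \<open>L\<^sup>p\<^sup>,\<^sup>q\<^sub>\<beta>\<close>, where \<open>\<beta> = s - \<alpha> > 0\<close>. Three facts about the means \<open>M\<^sub>p(r,u)\<close> of a holomorphic function \<open>u\<close>
  carry the proof.

  \<^item> \<open>M\<^sub>p(r,u)\<close> is increasing in \<open>r\<close> (\<open>lp_mean_mono\<close>), and \<open>M\<^sub>p(r,\<partial>\<^sub>j u) \<le> C/(R - r) M\<^sub>p(R,u)\<close> for \<open>r < R\<close>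
    (\<open>lp_mean_partial_deriv\<close>). For a unitary involution \<open>J\<close> and \<open>a = r/R\<close> the curve
    \<open>\<tau> \<mapsto> R m\<^sub>a(\<tau> J) \<zeta>\<close>, with \<open>m\<^sub>a\<close> a Moebius automorphism of the disc, leaves \<open>r \<zeta>\<close> in the direction \<open>J \<zeta>\<close> and maps the unit
    circle to the sphere of radius \<open>R\<close>, each of its points being a unitary image of \<open>R \<zeta>\<close>. The Cauchy
    formulas at \<open>\<tau> = 0\<close> therefore bound \<open>u(r \<zeta>)\<close> and the derivative of \<open>u\<close> in the direction \<open>J \<zeta>\<close> by averages
    of \<open>\<bar>u\<bar>\<close> over unitary images of \<open>R \<zeta>\<close> (\<open>spin_average_bounds\<close>), and averaging does not increase
    unitarily invariant means (\<open>mean_le_average\<close>). Coordinate reflections, and swaps of two coordinates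
    twisted by fourth roots of unity, supply enough involutions to recover all \<open>\<partial>\<^sub>j\<close>.

  \<^item> With \<open>\<R> = \<Sum>\<^sub>k z\<^sub>k \<partial>\<^sub>k\<close> the increment of \<open>u\<close> along a ray is controlled by \<open>(\<R> + c) u\<close> (\<open>lp_mean_along_ray\<close>).

  \<^item> \<open>\<partial>\<^sub>j (\<R> + c) = (\<R> + c + 1) \<partial>\<^sub>j\<close> (\<open>partial_deriv_euler\<close>).

  If all derivatives of order \<open>s\<close> are in \<open>L\<^sup>p\<^sup>,\<^sup>q\<^sub>\<beta>\<close>, then so are those of lower order, since means increase and
  constants have finite norm for \<open>\<beta> > 0\<close>; and \<open>\<R>\<^sup>s f\<close> is a combination of them with bounded coefficients.

  Conversely let \<open>h = (\<R> + c) u\<close> be in \<open>L\<^sup>p\<^sup>,\<^sup>q\<^sub>\<beta>\<close>. As \<open>(\<R> + c + 1) \<partial>\<^sub>j u = \<partial>\<^sub>j h\<close> has means at most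
  \<open>C/(1 - r) M\<^sub>p((1 + r)/2,h)\<close>, moving along rays from distance \<open>l (1 - r)\<close> to distance \<open>1 - r\<close> from the boundary gives
  \<open>M\<^sub>p(r,\<partial>\<^sub>j u) \<le> 4 M\<^sub>p(1 - l (1 - r),\<partial>\<^sub>j u) + C l M\<^sub>p((1 + r)/2,h)\<close>. For large \<open>l\<close> the weighted norm of the first
  term on the right is a small multiple of that of the left-hand side, as \<open>\<beta> > 0\<close>, and can be absorbed
  (\<open>weighted_finite_absorb\<close>). So \<open>\<partial>\<^sub>j u\<close> is in \<open>L\<^sup>p\<^sup>,\<^sup>q\<^sub>\<beta>\<close>, and by the commutation rule \<open>s\<close> such steps lead
  from \<open>\<R>\<^sup>s f\<close> to all derivatives of order \<open>s\<close>.
\<close>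

section \<open>Holomorphic functions of several variables\<close>

lemma vec_eq_sum_axis: "v = (\<Sum>j\<in>UNIV. v $ j *s axis j (1::complex))"
  by (simp add: vec_eq_iff axis_def sum.delta if_distrib cong: if_cong)

lemma norm_vector_smult [simp]: "norm (c *s (v :: complex ^ 'n::finite)) = cmod c * norm v"
  by (simp add: norm_vec_def L2_set_right_distrib norm_mult)

lemma axis_eq_smult: "axis j w = w *s axis j (1::complex)"
  by (simp add: vec_eq_iff axis_def)

lemma bounded_linear_smult_left: "bounded_linear (\<lambda>w::complex. w *s (v :: complex ^ 'n::finite))"
  by (rule bounded_linear_intro[where K="norm v"])
     (auto simp: vec_eq_iff algebra_simps)

lemma holomorphic_in_has_derivative:
  assumes "holomorphic_in f U" "z \<in> U"
  shows "(f has_derivative (\<lambda>v. \<Sum>j\<in>UNIV. v $ j * partial_deriv j f z)) (at z)"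
proof -
  obtain D where D: "(f has_derivative D) (at z)" and lin: "\<And>c v. D (c *s v) = c * D v"
    using assms by (auto simp: holomorphic_in_def)
  interpret D: bounded_linear D using D by (rule has_derivative_bounded_linear)
  have pd: "partial_deriv j f z = D (axis j 1)" for j
  proof -
    have "((\<lambda>w. z + w *s axis j 1) has_derivative (\<lambda>w. 0 + w *s axis j 1)) (at 0)"
      by (intro derivative_intros bounded_linear_imp_has_derivative bounded_linear_smult_left)
    then have "((\<lambda>w. f (z + w *s axis j 1)) has_derivative (\<lambda>w. D (0 + w *s axis j 1))) (at 0)"
      by (rule has_derivative_compose) (use D in auto)
    then have "((\<lambda>w. f (z + w *s axis j 1)) has_field_derivative D (axis j 1)) (at 0)"
      by (simp add: lin has_field_derivative_def mult_commute_abs)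
    moreover have "(\<lambda>w. f (z + axis j w)) = (\<lambda>w. f (z + w *s axis j 1))"
      by (subst axis_eq_smult) (rule refl)
    ultimately show ?thesis
      by (simp add: partial_deriv_def DERIV_imp_deriv)
  qed
  have "D v = (\<Sum>j\<in>UNIV. v $ j * partial_deriv j f z)" for v
  proof -
    have "D v = D (\<Sum>j\<in>UNIV. v $ j *s axis j 1)"
      by (subst vec_eq_sum_axis[of v]) simp
    then show ?thesis by (simp add: D.sum lin pd)
  qed
  then have "D = (\<lambda>v. \<Sum>j\<in>UNIV. v $ j * partial_deriv j f z)" by auto
  with D show ?thesis by simp
qed

lemma holomorphic_inI:
  assumes "\<And>z. z \<in> U \<Longrightarrow> (f has_derivative (\<lambda>v. \<Sum>j\<in>UNIV. v $ j * p j z)) (at z)"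
  shows "holomorphic_in f U"
  unfolding holomorphic_in_def
  using assms by (fastforce simp: sum_distrib_left mult.assoc)

lemma partial_deriv_unique:
  assumes "(f has_derivative (\<lambda>v. \<Sum>j\<in>UNIV. v $ j * p j)) (at z)"
  shows "partial_deriv k f z = p k"
proof -
  have h: "holomorphic_in f {z}"
    using assms by (intro holomorphic_inI[where p="\<lambda>j _. p j"]) auto
  have "(\<lambda>v. \<Sum>j\<in>UNIV. v $ j * partial_deriv j f z) = (\<lambda>v. \<Sum>j\<in>UNIV. v $ j * p j)"
    using has_derivative_unique[OF holomorphic_in_has_derivative[OF h] assms] by simp
  from fun_cong[OF this, of "axis k 1"] show ?thesis
    by (simp add: axis_def sum.delta if_distrib[of "\<lambda>x. x * _"] cong: if_cong)
qed

lemma holomorphic_in_continuous_on: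
  assumes "holomorphic_in f U"
  shows "continuous_on U f"
  using has_derivative_continuous[OF holomorphic_in_has_derivative[OF assms]]
  by (simp add: continuous_at_imp_continuous_on)

lemma partial_deriv_cong:
  assumes "open U" "z \<in> U" "\<And>z. z \<in> U \<Longrightarrow> f z = g z" "holomorphic_in f U"
  shows "partial_deriv j f z = partial_deriv j g z"
proof -
  have "(g has_derivative (\<lambda>v. \<Sum>j\<in>UNIV. v $ j * partial_deriv j f z)) (at z)"
    using holomorphic_in_has_derivative[OF assms(4,2)] assms(1-3)
    by (rule has_derivative_transform_within_open)
  from partial_deriv_unique[OF this, of j] show ?thesis by simp
qed

lemma holomorphic_in_cong:
  assumes "open U" "\<And>z. z \<in> U \<Longrightarrow> f z = g z" "holomorphic_in f U"
  shows "holomorphic_in g U"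
proof (rule holomorphic_inI)
  fix z assume "z \<in> U"
  then show "(g has_derivative (\<lambda>v. \<Sum>j\<in>UNIV. v $ j * partial_deriv j f z)) (at z)"
    using has_derivative_transform_within_open[OF holomorphic_in_has_derivative[OF assms(3)]] assms(1,2)
    by blast
qed

lemma holomorphic_in_curve:
  fixes \<gamma> :: "complex \<Rightarrow> complex ^ 'n::finite"
  assumes "holomorphic_in f U" "\<gamma> w \<in> U"
    and \<gamma>: "\<And>j. ((\<lambda>t. \<gamma> t $ j) has_field_derivative d $ j) (at w)"
  shows "((\<lambda>t. f (\<gamma> t)) has_field_derivative (\<Sum>j\<in>UNIV. d $ j * partial_deriv j f (\<gamma> w))) (at w)"
proof -
  have "((\<lambda>t. \<Sum>j\<in>UNIV. \<gamma> t $ j *s axis j 1) has_derivative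
      (\<lambda>h. \<Sum>j\<in>UNIV. (d $ j * h) *s axis j 1)) (at w)"
    by (intro has_derivative_sum bounded_linear.has_derivative[OF bounded_linear_smult_left])
       (use \<gamma> in \<open>simp add: has_field_derivative_def\<close>)
  then have "(\<gamma> has_derivative (\<lambda>h. \<Sum>j\<in>UNIV. (d $ j * h) *s axis j 1)) (at w)"
    by (simp flip: vec_eq_sum_axis)
  moreover have "(\<Sum>j\<in>UNIV. (d $ j * h) *s axis j 1) = h *s d" for h
    by (simp add: vec_eq_iff axis_def sum.delta if_distrib cong: if_cong)
  ultimately have "(\<gamma> has_derivative (\<lambda>h. h *s d)) (at w)" by simp
  then have "((\<lambda>t. f (\<gamma> t)) has_derivative (\<lambda>h. \<Sum>j\<in>UNIV. (h *s d) $ j * partial_deriv j f (\<gamma> w))) (at w)"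
    by (rule has_derivative_compose) (rule holomorphic_in_has_derivative[OF assms(1,2)])
  then show ?thesis
    by (simp add: has_field_derivative_def mult_commute_abs mult.assoc flip: sum_distrib_left)
qed

lemma holomorphic_in_line:
  fixes v :: "complex ^ 'n::finite"
  assumes "holomorphic_in f U" "z + w *s v \<in> U"
  shows "((\<lambda>t. f (z + t *s v)) has_field_derivative (\<Sum>j\<in>UNIV. v $ j * partial_deriv j f (z + w *s v))) (at w)"
  by (rule holomorphic_in_curve[where \<gamma>="\<lambda>t. z + t *s v" and U=U])
     (use assms in \<open>auto intro!: derivative_eq_intros\<close>)

lemma holomorphic_in_axis_line:
  fixes z :: "complex ^ 'n::finite"
  assumes "holomorphic_in f U" "z + w *s axis j 1 \<in> U"
  shows "((\<lambda>t. f (z + t *s axis j 1)) has_field_derivative partial_deriv j f (z + w *s axis j 1)) (at w)"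
proof -
  have "(\<Sum>k\<in>UNIV. axis j (1::complex) $ k * partial_deriv k f (z + w *s axis j 1))
       = partial_deriv j f (z + w *s axis j 1)"
    by (simp add: axis_def sum.delta if_distrib[of "\<lambda>x. x * _"] cong: if_cong)
  then show ?thesis
    using holomorphic_in_line[OF assms] by simp
qed

lemma partial_deriv_bound:
  fixes z :: "complex ^ 'n::finite"
  assumes hol: "holomorphic_in f (ball z r)" and "0 < r"
    and B: "\<And>x. x \<in> ball z r \<Longrightarrow> cmod (f x) \<le> B"
  shows "cmod (partial_deriv j f z) \<le> 2 * B / r"
proof -
  define \<phi> where "\<phi> = (\<lambda>w. f (z + w *s axis j 1))"
  have in_ball: "z + w *s axis j 1 \<in> ball z r" if "cmod w \<le> r/2" for w
    using that \<open>0 < r\<close> by (simp add: dist_norm)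
  have der: "(\<phi> has_field_derivative partial_deriv j f (z + w *s axis j 1)) (at w)" if "cmod w \<le> r/2" for w
    unfolding \<phi>_def by (rule holomorphic_in_axis_line[OF hol in_ball[OF that]])
  have "cmod ((deriv ^^ 1) \<phi> 0) \<le> fact 1 * B / (r/2) ^ 1"
  proof (rule Cauchy_inequality)
    show "\<phi> holomorphic_on ball 0 (r/2)"
    proof (rule holomorphic_onI)
      fix w :: complex assume "w \<in> ball 0 (r/2)"
      then show "\<phi> field_differentiable at w within ball 0 (r/2)"
        using der[of w] by (auto simp: field_differentiable_def dest: has_field_derivative_at_within)
    qed
    show "continuous_on (cball 0 (r/2)) \<phi>"
      using der by (intro continuous_at_imp_continuous_on ballI) (auto intro: DERIV_isCont)
    show "cmod (\<phi> x) \<le> B" if "cmod (0 - x) = r/2" for x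
      using B in_ball that by (simp add: \<phi>_def)
  qed (use \<open>0 < r\<close> in auto)
  moreover have "deriv \<phi> 0 = partial_deriv j f z"
    using DERIV_imp_deriv[OF der[of 0]] \<open>0 < r\<close> by simp
  ultimately show ?thesis by (simp add: mult.commute)
qed

lemma has_derivative_holomorphic_sum:
  assumes "\<And>k. k \<in> K \<Longrightarrow> holomorphic_in (f k) U" "z \<in> U"
  shows "((\<lambda>z. \<Sum>k\<in>K. f k z) has_derivative
      (\<lambda>v. \<Sum>j\<in>UNIV. v $ j * (\<Sum>k\<in>K. partial_deriv j (f k) z))) (at z)"
proof -
  have "((\<lambda>z. \<Sum>k\<in>K. f k z) has_derivative
      (\<lambda>v. \<Sum>k\<in>K. \<Sum>j\<in>UNIV. v $ j * partial_deriv j (f k) z)) (at z)"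
    by (intro has_derivative_sum holomorphic_in_has_derivative[OF assms(1) assms(2)])
  also have "(\<lambda>v. \<Sum>k\<in>K. \<Sum>j\<in>UNIV. v $ j * partial_deriv j (f k) z)
      = (\<lambda>v. \<Sum>j\<in>UNIV. v $ j * (\<Sum>k\<in>K. partial_deriv j (f k) z))"
    by (subst sum.swap) (simp add: sum_distrib_left)
  finally show ?thesis .
qed

lemma has_derivative_holomorphic_cmult:
  assumes "holomorphic_in f U" "z \<in> U"
  shows "((\<lambda>z. c * f z) has_derivative (\<lambda>v. \<Sum>j\<in>UNIV. v $ j * (c * partial_deriv j f z))) (at z)"
proof -
  have "((\<lambda>z. c * f z) has_derivative (\<lambda>v. c * (\<Sum>j\<in>UNIV. v $ j * partial_deriv j f z))) (at z)"
    by (intro has_derivative_mult_right holomorphic_in_has_derivative[OF assms])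
  then show ?thesis by (simp add: sum_distrib_left mult_ac)
qed

lemma has_derivative_holomorphic_coord_mult:
  fixes f :: "complex ^ 'n::finite \<Rightarrow> complex"
  assumes "holomorphic_in f U" "z \<in> U"
  shows "((\<lambda>z. z $ k * f z) has_derivative
     (\<lambda>v. \<Sum>j\<in>UNIV. v $ j * (z $ k * partial_deriv j f z + (if j = k then f z else 0)))) (at z)"
proof -
  have "((\<lambda>z. z $ k * f z) has_derivative
      (\<lambda>v. z $ k * (\<Sum>j\<in>UNIV. v $ j * partial_deriv j f z) + v $ k * f z)) (at z)"
    by (intro has_derivative_mult holomorphic_in_has_derivative[OF assms]
        bounded_linear.has_derivative[OF bounded_linear_vec_nth] has_derivative_ident)
  moreover have "(\<lambda>v. z $ k * (\<Sum>j\<in>UNIV. v $ j * partial_deriv j f z) + v $ k * f z)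
     = (\<lambda>v. \<Sum>j\<in>UNIV. v $ j * (z $ k * partial_deriv j f z + (if j = k then f z else 0)))"
    by (simp add: ring_distribs sum.distrib sum_distrib_left mult_ac if_distrib[of "\<lambda>x. _ * x"] cong: if_cong)
  ultimately show ?thesis by simp
qed

lemma has_derivative_holomorphic_diff:
  assumes "holomorphic_in f U" "holomorphic_in g U" "z \<in> U"
  shows "((\<lambda>z. f z - g z) has_derivative
     (\<lambda>v. \<Sum>j\<in>UNIV. v $ j * (partial_deriv j f z - partial_deriv j g z))) (at z)"
  using has_derivative_diff[OF holomorphic_in_has_derivative[OF assms(1,3)] holomorphic_in_has_derivative[OF assms(2,3)]]
  by (simp add: right_diff_distrib sum_subtractf)

text \<open>Weierstrass' theorem: holomorphy passes to uniform limits, because the Cauchy estimate turns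
  uniform convergence of the functions into uniform convergence of the partial derivatives on a
  smaller ball.\<close>

lemma holomorphic_in_uniform_limit:
  fixes u :: "nat \<Rightarrow> complex ^ 'n::finite \<Rightarrow> complex"
  assumes hol: "\<And>n. holomorphic_in (u n) (ball z0 (2*\<delta>))" and "0 < \<delta>"
    and lim: "uniform_limit (ball z0 (2*\<delta>)) u g sequentially"
  shows "holomorphic_in g (ball z0 \<delta>)"
    and "\<And>x k. x \<in> ball z0 \<delta> \<Longrightarrow> (\<lambda>n. partial_deriv k (u n) x) \<longlonglongrightarrow> partial_deriv k g x"
proof -
  have cau: "uniformly_Cauchy_on (ball z0 \<delta>) (\<lambda>n. partial_deriv k (u n))" for k
  proof (rule uniformly_Cauchy_onI)
    fix e :: real assume "e > 0"
    have "e * \<delta> / 8 > 0" using \<open>e > 0\<close> \<open>0 < \<delta>\<close> by simp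
    with lim have "\<forall>\<^sub>F n in sequentially. \<forall>x\<in>ball z0 (2*\<delta>). dist (u n x) (g x) < e * \<delta> / 8"
      unfolding uniform_limit_iff by blast
    then obtain M where M: "\<And>n x. n \<ge> M \<Longrightarrow> x \<in> ball z0 (2*\<delta>) \<Longrightarrow> dist (u n x) (g x) < e * \<delta> / 8"
      unfolding eventually_sequentially by blast
    have "dist (partial_deriv k (u m) x) (partial_deriv k (u n) x) < e"
      if x: "x \<in> ball z0 \<delta>" and mn: "m \<ge> M" "n \<ge> M" for x m n
    proof -
      have sub: "ball x \<delta> \<subseteq> ball z0 (2*\<delta>)"
      proof
        fix y assume "y \<in> ball x \<delta>"
        then show "y \<in> ball z0 (2*\<delta>)"
          using x dist_triangle[of z0 y x] by simp
      qed
      let ?v = "\<lambda>y. u m y - u n y"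
      have d: "(?v has_derivative (\<lambda>h. \<Sum>j\<in>UNIV. h $ j * (partial_deriv j (u m) y - partial_deriv j (u n) y))) (at y)"
        if "y \<in> ball x \<delta>" for y
        using that sub by (intro has_derivative_holomorphic_diff[OF hol hol]) auto
      have "cmod (partial_deriv k ?v x) \<le> 2 * (e * \<delta> / 4) / \<delta>"
      proof (rule partial_deriv_bound)
        show "holomorphic_in ?v (ball x \<delta>)"
          by (rule holomorphic_inI[OF d])
        show "cmod (?v y) \<le> e * \<delta> / 4" if "y \<in> ball x \<delta>" for y
        proof -
          have "dist (u m y) (u n y) \<le> dist (u m y) (g y) + dist (u n y) (g y)"
            by (rule dist_triangle2)
          also have "\<dots> \<le> e * \<delta> / 8 + e * \<delta> / 8"
            using M[OF mn(1)] M[OF mn(2)] that sub by (intro add_mono less_imp_le) blast+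
          also have "\<dots> = e * \<delta> / 4" by simp
          finally show ?thesis by (simp only: dist_norm)
        qed
      qed fact
      moreover have "partial_deriv k ?v x = partial_deriv k (u m) x - partial_deriv k (u n) x"
        using partial_deriv_unique[OF d, of x k] \<open>0 < \<delta>\<close> by simp
      ultimately show ?thesis using \<open>e > 0\<close> \<open>0 < \<delta>\<close> by (simp add: dist_norm)
    qed
    then show "\<exists>M. \<forall>x\<in>ball z0 \<delta>. \<forall>m\<ge>M. \<forall>n\<ge>M. dist (partial_deriv k (u m) x) (partial_deriv k (u n) x) < e"
      by (intro exI[of _ M] ballI allI impI)
  qed
  have "\<exists>p. uniform_limit (ball z0 \<delta>) (\<lambda>n. partial_deriv k (u n)) p sequentially" for k
    using Cauchy_uniformly_convergent[OF cau] by (simp add: uniformly_convergent_on_def)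
  then have "\<forall>k. \<exists>p. uniform_limit (ball z0 \<delta>) (\<lambda>n. partial_deriv k (u n)) p sequentially" by simp
  from choice[OF this]
  obtain p where p: "\<And>k. uniform_limit (ball z0 \<delta>) (\<lambda>n. partial_deriv k (u n)) (p k) sequentially"
    by blast
  let ?f' = "\<lambda>n x v. \<Sum>j\<in>UNIV. v $ j * partial_deriv j (u n) x"
  let ?g' = "\<lambda>x v. \<Sum>j\<in>UNIV. v $ j * p j x"
  have sub: "ball z0 \<delta> \<subseteq> ball z0 (2*\<delta>)" using \<open>0 < \<delta>\<close> by (intro subset_ball) simp
  have glim: "(\<lambda>n. u n x) \<longlonglongrightarrow> g x" if "x \<in> ball z0 (2*\<delta>)" for x
    using lim that by (rule tendsto_uniform_limitI)
  have "\<exists>g2. \<forall>x\<in>ball z0 \<delta>. (\<lambda>n. u n x) \<longlonglongrightarrow> g2 x \<and> (g2 has_derivative ?g' x) (at x within ball z0 \<delta>)"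
  proof (rule has_derivative_sequence)
    show "(u n has_derivative ?f' n x) (at x within ball z0 \<delta>)" if "x \<in> ball z0 \<delta>" for n x
    proof -
      have "x \<in> ball z0 (2*\<delta>)" using that sub by blast
      then show ?thesis
        by (rule has_derivative_at_withinI[OF holomorphic_in_has_derivative[OF hol]])
    qed
    show "(\<lambda>n. u n z0) \<longlonglongrightarrow> g z0" using glim \<open>0 < \<delta>\<close> by simp
    show "\<forall>\<^sub>F n in sequentially. \<forall>x\<in>ball z0 \<delta>. \<forall>h. norm (?f' n x h - ?g' x h) \<le> e * norm h" if "e > 0" for e
    proof -
      define e' where "e' = e / CARD('n)"
      have "e' > 0" using that by (simp add: e'_def)
      then have "\<forall>k. \<forall>\<^sub>F n in sequentially. \<forall>x\<in>ball z0 \<delta>. dist (partial_deriv k (u n) x) (p k x) < e'"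
        using p unfolding uniform_limit_iff by blast
      then have "\<forall>\<^sub>F n in sequentially. \<forall>k\<in>UNIV. \<forall>x\<in>ball z0 \<delta>. dist (partial_deriv k (u n) x) (p k x) < e'"
        by (intro eventually_ball_finite) simp_all
      then show ?thesis
      proof (rule eventually_mono, intro ballI allI)
        fix n x h
        assume *: "\<forall>k\<in>UNIV. \<forall>x\<in>ball z0 \<delta>. dist (partial_deriv k (u n) x) (p k x) < e'" and x: "x \<in> ball z0 \<delta>"
        have "norm (?f' n x h - ?g' x h) = norm (\<Sum>j\<in>UNIV. h $ j * (partial_deriv j (u n) x - p j x))"
          by (simp add: sum_subtractf ring_distribs)
        also have "\<dots> \<le> (\<Sum>j\<in>(UNIV::'n set). norm h * e')"
        proof (rule sum_norm_le)
          fix j :: 'n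
          have "dist (partial_deriv j (u n) x) (p j x) \<le> e'"
            using * x by (meson UNIV_I less_imp_le)
          then show "norm (h $ j * (partial_deriv j (u n) x - p j x)) \<le> norm h * e'"
            unfolding norm_mult dist_norm
            by (intro mult_mono Finite_Cartesian_Product.norm_nth_le) auto
        qed
        also have "\<dots> = e * norm h" by (simp add: e'_def)
        finally show "norm (?f' n x h - ?g' x h) \<le> e * norm h" .
      qed
    qed
  qed (use \<open>0 < \<delta>\<close> in auto)
  then obtain g2 where g2: "\<And>x. x \<in> ball z0 \<delta> \<Longrightarrow> (\<lambda>n. u n x) \<longlonglongrightarrow> g2 x"
    "\<And>x. x \<in> ball z0 \<delta> \<Longrightarrow> (g2 has_derivative ?g' x) (at x within ball z0 \<delta>)" by blast
  have eq: "g2 x = g x" if "x \<in> ball z0 \<delta>" for x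
    using LIMSEQ_unique[OF g2(1)[OF that] glim] that sub by blast
  have dg: "(g has_derivative ?g' x) (at x)" if "x \<in> ball z0 \<delta>" for x
  proof -
    have "(g2 has_derivative ?g' x) (at x)"
      using g2(2)[OF that] at_within_open[OF that] by simp
    then show ?thesis
      by (rule has_derivative_transform_within_open[of _ _ _ _ "ball z0 \<delta>"]) (use that eq in auto)
  qed
  show "holomorphic_in g (ball z0 \<delta>)" by (rule holomorphic_inI[OF dg])
  show "(\<lambda>n. partial_deriv k (u n) x) \<longlonglongrightarrow> partial_deriv k g x" if "x \<in> ball z0 \<delta>" for x k
    unfolding partial_deriv_unique[OF dg[OF that], of k]
    by (rule tendsto_uniform_limitI[OF p that])
qed

lemma has_derivative_holomorphic_shift:
  assumes "holomorphic_in f U" "x + c \<in> U"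
  shows "((\<lambda>x. f (x + c)) has_derivative (\<lambda>v. \<Sum>j\<in>UNIV. v $ j * partial_deriv j f (x + c))) (at x)"
proof -
  have "((\<lambda>x. x + c) has_derivative (\<lambda>v. v)) (at x)"
    by (auto intro!: derivative_eq_intros)
  then show ?thesis
    by (rule has_derivative_compose) (rule holomorphic_in_has_derivative[OF assms])
qed

text \<open>The constant depends on \<open>\<phi>\<close> only through a bound for \<open>\<bar>\<phi>\<bar>\<close>, which makes the estimate uniform over
  all complex lines in a coordinate direction.\<close>

lemma second_order_remainder:
  assumes hol: "\<phi> holomorphic_on ball 0 (2*\<delta>)" and "0 < \<delta>"
    and B: "\<And>w. w \<in> ball 0 (2*\<delta>) \<Longrightarrow> cmod (\<phi> w) \<le> B" and h: "cmod h < \<delta>"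
  shows "cmod (\<phi> h - \<phi> 0 - h * deriv \<phi> 0) \<le> 8 * B / \<delta>\<^sup>2 * (cmod h)\<^sup>2"
proof -
  let ?F = "\<lambda>i. (deriv ^^ i) \<phi>"
  have sub: "ball 0 \<delta> \<subseteq> ball 0 (2*\<delta>)" using \<open>0 < \<delta>\<close> by (intro subset_ball) simp
  have "cmod (?F 0 h - (\<Sum>i\<le>1. ?F i 0 * (h - 0) ^ i / fact i)) \<le> 8 * B / \<delta>\<^sup>2 * cmod (h - 0) ^ Suc 1 / fact 1"
  proof (rule complex_Taylor[where S="ball 0 \<delta>"])
    fix i x assume x: "x \<in> ball (0::complex) \<delta>"
    have "?F i holomorphic_on ball 0 (2*\<delta>)"
      by (rule holomorphic_higher_deriv[OF hol open_ball])
    then show "(?F i has_field_derivative ?F (Suc i) x) (at x within ball 0 \<delta>)"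
      using holomorphic_derivI[of "?F i" "ball 0 (2*\<delta>)" x "ball 0 \<delta>"] x \<open>0 < \<delta>\<close>
      by auto
  next
    fix x assume x: "x \<in> ball (0::complex) \<delta>"
    have c: "cball x (\<delta>/2) \<subseteq> ball 0 (2*\<delta>)"
    proof
      fix y assume "y \<in> cball x (\<delta>/2)"
      then show "y \<in> ball 0 (2*\<delta>)" using x dist_triangle[of 0 y x] \<open>0 < \<delta>\<close> by simp
    qed
    have "cmod ((deriv ^^ 2) \<phi> x) \<le> fact 2 * B / (\<delta>/2) ^ 2"
    proof (rule Cauchy_inequality)
      show "\<phi> holomorphic_on ball x (\<delta>/2)"
        by (rule holomorphic_on_subset[OF hol]) (use c ball_subset_cball in blast)
      show "continuous_on (cball x (\<delta>/2)) \<phi>"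
        by (rule continuous_on_subset[OF holomorphic_on_imp_continuous_on[OF hol] c])
      show "cmod (\<phi> y) \<le> B" if "cmod (x - y) = \<delta>/2" for y
        using that c by (intro B) (auto simp: subset_iff dist_norm)
    qed (use \<open>0 < \<delta>\<close> in auto)
    then show "cmod (?F (Suc 1) x) \<le> 8 * B / \<delta>\<^sup>2"
      by (simp add: power_divide numeral_2_eq_2)
  qed (use h \<open>0 < \<delta>\<close> in auto)
  then show ?thesis by (simp add: power2_eq_square mult_ac diff_diff_eq)
qed

text \<open>The difference quotients of \<open>f\<close> are holomorphic in several variables together with \<open>f\<close>,
  and they converge locally uniformly; this is what makes the partial derivatives holomorphic.\<close>

lemma difference_quotients_uniform_limit:
  fixes f :: "complex ^ 'n::finite \<Rightarrow> complex"
  assumes "open U" "holomorphic_in f U" "z0 \<in> U"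
  obtains \<delta> where "\<delta> > 0" "ball z0 (3*\<delta>) \<subseteq> U"
    "\<And>j. uniform_limit (ball z0 (2*\<delta>))
       (\<lambda>n x. (f (x + of_real (\<delta> / (real n + 2)) *s axis j 1) - f x) / of_real (\<delta> / (real n + 2))) (partial_deriv j f) sequentially"
proof -
  obtain \<epsilon> where \<epsilon>: "\<epsilon> > 0" "cball z0 \<epsilon> \<subseteq> U"
    using assms(1,3) open_contains_cball by blast
  define \<delta> where "\<delta> = \<epsilon> / 4"
  have \<delta>: "\<delta> > 0" "cball z0 (4*\<delta>) \<subseteq> U" using \<epsilon> by (auto simp: \<delta>_def)
  have "compact (f ` cball z0 (4*\<delta>))"
    using continuous_on_subset[OF holomorphic_in_continuous_on[OF assms(2)] \<delta>(2)]
    by (intro compact_continuous_image) auto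
  then obtain B where B: "\<And>x. x \<in> cball z0 (4*\<delta>) \<Longrightarrow> cmod (f x) \<le> B"
    by (meson bounded_iff compact_imp_bounded image_eqI)
  have "uniform_limit (ball z0 (2*\<delta>))
       (\<lambda>n x. (f (x + of_real (\<delta> / (real n + 2)) *s axis j 1) - f x) / of_real (\<delta> / (real n + 2))) (partial_deriv j f) sequentially" for j
    unfolding uniform_limit_iff
  proof (intro allI impI)
    fix e :: real assume "e > 0"
    have "(\<lambda>n. 8 * B / \<delta>\<^sup>2 * (\<delta> / (real n + 2))) \<longlonglongrightarrow> 0"
      by real_asymp
    then have "\<forall>\<^sub>F n in sequentially. 8 * B / \<delta>\<^sup>2 * (\<delta> / (real n + 2)) < e"
      using \<open>e > 0\<close> by (rule order_tendstoD)
    then show "\<forall>\<^sub>F n in sequentially. \<forall>x\<in>ball z0 (2*\<delta>).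
       dist ((f (x + of_real (\<delta> / (real n + 2)) *s axis j 1) - f x) / of_real (\<delta> / (real n + 2))) (partial_deriv j f x) < e"
    proof (rule eventually_mono, intro ballI)
      fix n :: nat and x assume n: "8 * B / \<delta>\<^sup>2 * (\<delta> / (real n + 2)) < e" and x: "x \<in> ball z0 (2*\<delta>)"
      define h where "h = \<delta> / (real n + 2)"
      have h: "0 < h" "h < \<delta>" using \<delta>(1) by (auto simp: h_def field_simps add_pos_nonneg)
      define \<phi> where "\<phi> = (\<lambda>w. f (x + w *s axis j 1))"
      have mem: "x + w *s axis j 1 \<in> cball z0 (4*\<delta>)" if "w \<in> ball 0 (2*\<delta>)" for w :: complex
        using norm_triangle_ineq[of "x - z0" "w *s axis j 1"] x that
        by (simp add: dist_norm norm_minus_commute algebra_simps)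
      have der: "(\<phi> has_field_derivative partial_deriv j f (x + w *s axis j 1)) (at w)" if "w \<in> ball 0 (2*\<delta>)" for w
        unfolding \<phi>_def using mem[OF that] \<delta>(2) by (intro holomorphic_in_axis_line[OF assms(2)]) blast
      have hol: "\<phi> holomorphic_on ball 0 (2*\<delta>)"
        unfolding holomorphic_on_open[OF open_ball] using der by blast
      have d0: "deriv \<phi> 0 = partial_deriv j f x"
        using DERIV_imp_deriv[OF der[of 0]] \<delta>(1) by simp
      have "cmod (\<phi> (of_real h) - \<phi> 0 - of_real h * deriv \<phi> 0) \<le> 8 * B / \<delta>\<^sup>2 * (cmod (of_real h))\<^sup>2"
        by (rule second_order_remainder[OF hol \<delta>(1)]) (use B mem h in \<open>auto simp: \<phi>_def\<close>)
      then have "cmod (\<phi> (of_real h) - \<phi> 0 - of_real h * deriv \<phi> 0) / h \<le> 8 * B / \<delta>\<^sup>2 * h"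
        using h by (simp add: divide_simps power2_eq_square)
      moreover have "cmod ((\<phi> (of_real h) - \<phi> 0) / of_real h - deriv \<phi> 0)
          = cmod (\<phi> (of_real h) - \<phi> 0 - of_real h * deriv \<phi> 0) / h"
      proof -
        have "(\<phi> (of_real h) - \<phi> 0) / of_real h - deriv \<phi> 0 = (\<phi> (of_real h) - \<phi> 0 - of_real h * deriv \<phi> 0) / of_real h"
          using h by (simp add: field_simps)
        then show ?thesis using h by (simp add: norm_divide)
      qed
      ultimately have "cmod ((\<phi> (of_real h) - \<phi> 0) / of_real h - deriv \<phi> 0) < e"
        using n by (simp add: h_def)
      from this[unfolded d0]
      show "dist ((f (x + of_real (\<delta> / (real n + 2)) *s axis j 1) - f x) / of_real (\<delta> / (real n + 2))) (partial_deriv j f x) < e"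
        by (simp add: dist_norm \<phi>_def h_def add.commute)
    qed
  qed
  moreover have "ball z0 (3*\<delta>) \<subseteq> U"
    using \<delta> by (intro order.trans[OF _ \<delta>(2)] subset_trans[OF ball_subset_cball]) (auto intro: subset_cball)
  ultimately show ?thesis using that \<delta>(1) by blast
qed

text \<open>Weierstrass' theorem applied to the difference quotients of \<open>f\<close> in the direction \<open>j\<close>; their \<open>k\<close>-th partial
  derivatives are the difference quotients of \<open>\<partial>\<^sub>k f\<close>, and this gives the symmetry of mixed derivatives.\<close>

lemma partial_deriv_approximation:
  fixes f :: "complex ^ 'n::finite \<Rightarrow> complex"
  assumes "open U" "holomorphic_in f U" "z0 \<in> U"
  shows "holomorphic_in (partial_deriv j f) {z0} \<and>
      (\<exists>h :: nat \<Rightarrow> complex. (\<forall>n. h n \<noteq> 0) \<and> h \<longlonglongrightarrow> 0 \<and>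
      (\<lambda>n. (partial_deriv k f (z0 + h n *s axis j 1) - partial_deriv k f z0) / h n)
          \<longlonglongrightarrow> partial_deriv k (partial_deriv j f) z0)"
  proof -
    obtain \<delta> where \<delta>: "\<delta> > 0" "ball z0 (3*\<delta>) \<subseteq> U"
      and lim: "\<And>j. uniform_limit (ball z0 (2*\<delta>))
       (\<lambda>n x. (f (x + of_real (\<delta> / (real n + 2)) *s axis j 1) - f x) / of_real (\<delta> / (real n + 2))) (partial_deriv j f) sequentially"
      using difference_quotients_uniform_limit[OF assms] by blast
    define h :: "nat \<Rightarrow> complex" where "h = (\<lambda>n. of_real (\<delta> / (real n + 2)))"
    have "\<delta> / (real n + 2) > 0" "\<delta> / (real n + 2) < \<delta>" for n :: nat
      using \<delta>(1) by (auto simp: field_simps add_pos_nonneg)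
    moreover have "cmod (h n) = \<bar>\<delta> / (real n + 2)\<bar>" for n
      by (simp only: h_def norm_of_real)
    ultimately have h': "0 < cmod (h n)" "cmod (h n) < \<delta>" for n
      using \<delta>(1) by simp_all
    then have h: "h n \<noteq> 0" "cmod (h n) < \<delta>" for n
      by auto
    define u where "u = (\<lambda>n x. (f (x + h n *s axis j 1) - f x) / h n)"
    have du: "(u n has_derivative (\<lambda>v. \<Sum>l\<in>UNIV. v $ l *
         ((partial_deriv l f (x + h n *s axis j 1) - partial_deriv l f x) / h n))) (at x)"
      if x: "x \<in> ball z0 (2*\<delta>)" for n x
    proof -
      have "x + h n *s axis j 1 \<in> ball z0 (3*\<delta>)"
        using norm_triangle_ineq[of "x - z0" "h n *s axis j 1"] x h(2)[of n]
        by (simp add: dist_norm norm_minus_commute algebra_simps)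
      moreover have "x \<in> ball z0 (3*\<delta>)"
        using x \<delta>(1) by simp
      ultimately have "((\<lambda>x. f (x + h n *s axis j 1) - f x) has_derivative
           (\<lambda>v. (\<Sum>l\<in>UNIV. v $ l * partial_deriv l f (x + h n *s axis j 1)) - (\<Sum>l\<in>UNIV. v $ l * partial_deriv l f x))) (at x)"
        using \<delta>(2) by (intro has_derivative_diff has_derivative_holomorphic_shift[OF assms(2)] holomorphic_in_has_derivative[OF assms(2)]) blast+
      then have "(u n has_derivative
           (\<lambda>v. ((\<Sum>l\<in>UNIV. v $ l * partial_deriv l f (x + h n *s axis j 1)) - (\<Sum>l\<in>UNIV. v $ l * partial_deriv l f x)) / h n)) (at x)"
        unfolding u_def by (rule bounded_linear.has_derivative[OF bounded_linear_divide])
      then show ?thesis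
        by (simp add: sum_subtractf[symmetric] sum_divide_distrib right_diff_distrib[symmetric])
    qed
    have hol: "holomorphic_in (u n) (ball z0 (2*\<delta>))" for n
      by (rule holomorphic_inI[OF du])
    have lim': "uniform_limit (ball z0 (2*\<delta>)) u (partial_deriv j f) sequentially"
      unfolding u_def h_def by (rule lim)
    have z0: "z0 \<in> ball z0 \<delta>" "z0 \<in> ball z0 (2*\<delta>)" using \<delta>(1) by auto
    have "(\<lambda>n. partial_deriv k (u n) z0) \<longlonglongrightarrow> partial_deriv k (partial_deriv j f) z0"
      by (rule holomorphic_in_uniform_limit(2)[OF hol \<delta>(1) lim' z0(1)])
    moreover have "partial_deriv k (u n) z0 = (partial_deriv k f (z0 + h n *s axis j 1) - partial_deriv k f z0) / h n" for n
      by (rule partial_deriv_unique[OF du[OF z0(2)]])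
    moreover have "h \<longlonglongrightarrow> 0"
    proof -
      have "(\<lambda>n. \<delta> / (real n + 2)) \<longlonglongrightarrow> 0" by real_asymp
      then have "(\<lambda>n. complex_of_real (\<delta> / (real n + 2))) \<longlonglongrightarrow> of_real 0" by (rule tendsto_of_real)
      then show ?thesis by (simp add: h_def add.commute)
    qed
    moreover have "holomorphic_in (partial_deriv j f) {z0}"
      using holomorphic_in_uniform_limit(1)[OF hol \<delta>(1) lim'] z0(1) by (auto simp: holomorphic_in_def)
    ultimately show ?thesis using h(1) by auto
  qed

lemma partial_deriv_holomorphic:
  fixes f :: "complex ^ 'n::finite \<Rightarrow> complex"
  assumes "open U" "holomorphic_in f U"
  shows "holomorphic_in (partial_deriv j f) U"
  using partial_deriv_approximation[OF assms] by (auto simp: holomorphic_in_def)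

lemma partial_deriv_commute:
  fixes f :: "complex ^ 'n::finite \<Rightarrow> complex"
  assumes "open U" "holomorphic_in f U" "z \<in> U"
  shows "partial_deriv k (partial_deriv j f) z = partial_deriv j (partial_deriv k f) z"
proof -
  obtain h :: "nat \<Rightarrow> complex" where h: "\<And>n. h n \<noteq> 0" "h \<longlonglongrightarrow> 0"
    and lim: "(\<lambda>n. (partial_deriv k f (z + h n *s axis j 1) - partial_deriv k f z) / h n)
          \<longlonglongrightarrow> partial_deriv k (partial_deriv j f) z"
    using partial_deriv_approximation[OF assms, of j k] by blast
  have "((\<lambda>t. partial_deriv k f (z + t *s axis j 1)) has_field_derivative partial_deriv j (partial_deriv k f) z) (at 0)"
    using holomorphic_in_axis_line[OF partial_deriv_holomorphic[OF assms(1,2)], of z 0 j k] assms(3) by simp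
  then have "((\<lambda>t. (partial_deriv k f (z + t *s axis j 1) - partial_deriv k f z) / t)
      \<longlongrightarrow> partial_deriv j (partial_deriv k f) z) (at 0)"
    by (simp add: DERIV_def)
  moreover have "filterlim h (at 0) sequentially"
    using h by (simp add: filterlim_at)
  ultimately have "(\<lambda>n. (partial_deriv k f (z + h n *s axis j 1) - partial_deriv k f z) / h n)
      \<longlonglongrightarrow> partial_deriv j (partial_deriv k f) z"
    by (rule filterlim_compose)
  with lim show ?thesis by (rule LIMSEQ_unique)
qed


section \<open>Euler operators and iterated derivatives\<close>

text \<open>With \<open>c = 0\<close> this is the radial derivative \<open>\<R>\<close>; the shifts \<open>\<R> + c\<close> are needed since each partial
  derivative lowers the degree of homogeneity by one.\<close>

definition euler :: "complex \<Rightarrow> (complex ^ 'n::finite \<Rightarrow> complex) \<Rightarrow> complex ^ 'n \<Rightarrow> complex" where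
  "euler c u z = (\<Sum>k\<in>UNIV. z $ k * partial_deriv k u z) + c * u z"

lemma euler_has_derivative:
  assumes "open U" "holomorphic_in u U" "z \<in> U"
  shows "(euler c u has_derivative
     (\<lambda>v. \<Sum>j\<in>UNIV. v $ j * euler (c + 1) (partial_deriv j u) z)) (at z)"
proof -
  note hol = partial_deriv_holomorphic[OF assms(1,2)]
  let ?p = "\<lambda>k j. z $ k * partial_deriv j (partial_deriv k u) z + (if j = k then partial_deriv k u z else 0)"
  have "((\<lambda>z. (\<Sum>k\<in>UNIV. z $ k * partial_deriv k u z) + c * u z) has_derivative
     (\<lambda>v. (\<Sum>k\<in>UNIV. \<Sum>j\<in>UNIV. v $ j * ?p k j) + (\<Sum>j\<in>UNIV. v $ j * (c * partial_deriv j u z)))) (at z)"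
    by (intro has_derivative_add has_derivative_sum has_derivative_holomorphic_coord_mult[OF hol assms(3)]
        has_derivative_holomorphic_cmult[OF assms(2,3)])
  moreover have "(\<Sum>k\<in>UNIV. \<Sum>j\<in>UNIV. v $ j * ?p k j) + (\<Sum>j\<in>UNIV. v $ j * (c * partial_deriv j u z))
      = (\<Sum>j\<in>UNIV. v $ j * euler (c + 1) (partial_deriv j u) z)" for v
  proof -
    have e: "(\<Sum>k\<in>UNIV. ?p k j) = (\<Sum>k\<in>UNIV. z $ k * partial_deriv k (partial_deriv j u) z) + partial_deriv j u z" for j
      by (simp add: sum.distrib partial_deriv_commute[OF assms, of j])
    have "(\<Sum>k\<in>UNIV. \<Sum>j\<in>UNIV. v $ j * ?p k j) = (\<Sum>j\<in>UNIV. v $ j * (\<Sum>k\<in>UNIV. ?p k j))"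
      by (subst sum.swap) (simp only: sum_distrib_left)
    then show ?thesis
      unfolding e by (simp add: euler_def ring_distribs sum.distrib)
  qed
  ultimately show ?thesis
    by (simp add: euler_def[abs_def])
qed

lemma euler_holomorphic:
  assumes "open U" "holomorphic_in u U"
  shows "holomorphic_in (euler c u) U"
  by (rule holomorphic_inI[OF euler_has_derivative[OF assms]])

lemma partial_deriv_euler:
  assumes "open U" "holomorphic_in u U" "z \<in> U"
  shows "partial_deriv j (euler c u) z = euler (c + 1) (partial_deriv j u) z"
  by (rule partial_deriv_unique[OF euler_has_derivative[OF assms]])

lemma euler_cong:
  assumes "open U" "holomorphic_in u U" "\<And>z. z \<in> U \<Longrightarrow> u z = v z" "z \<in> U"
  shows "euler c u z = euler c v z"
  using assms(3,4) partial_deriv_cong[OF assms(1,4,3,2)] by (simp add: euler_def)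

lemma euler_pow_holomorphic:
  assumes "open U" "holomorphic_in u U"
  shows "holomorphic_in ((euler c ^^ m) u) U"
  using assms by (induction m) (auto intro: euler_holomorphic)

lemma partial_deriv_euler_pow:
  assumes "open U" "holomorphic_in u U" "z \<in> U"
  shows "partial_deriv j ((euler c ^^ m) u) z = (euler (c + 1) ^^ m) (partial_deriv j u) z"
  using assms(3)
proof (induction m arbitrary: z)
  case (Suc m)
  note hol = euler_pow_holomorphic[OF assms(1,2)]
  have "partial_deriv j ((euler c ^^ Suc m) u) z = euler (c + 1) (partial_deriv j ((euler c ^^ m) u)) z"
    using partial_deriv_euler[OF assms(1) hol Suc.prems] by simp
  also have "\<dots> = euler (c + 1) ((euler (c + 1) ^^ m) (partial_deriv j u)) z"
    by (rule euler_cong[OF assms(1) partial_deriv_holomorphic[OF assms(1) hol] Suc.IH Suc.prems])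
  finally show ?case by simp
qed simp

lemma iterated_partial_holomorphic:
  assumes "open U" "holomorphic_in u U"
  shows "holomorphic_in (foldr partial_deriv js u) U"
  by (induction js) (auto intro: partial_deriv_holomorphic assms)

lemma finite_lists_of_length [simp]: "finite {js :: 'n::finite list. length js = k}"
  using finite_lists_length_eq[of "UNIV :: 'n set" k] by simp

section \<open>The homogeneous expansion\<close>

lemma slice_derivative:
  fixes z :: "complex ^ 'n::finite"
  assumes "holomorphic_in u U" "w *s z \<in> U"
  shows "((\<lambda>t. u (t *s z)) has_field_derivative (\<Sum>j\<in>UNIV. z $ j * partial_deriv j u (w *s z))) (at w)"
  using holomorphic_in_line[OF assms(1), of 0 w z] assms(2) by simp

lemma sum_lists_Suc:
  "(\<Sum>js | length js = Suc k. g js) = (\<Sum>js | length js = k. \<Sum>j\<in>(UNIV :: 'n::finite set). g (j # js))"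
proof -
  have "{js :: 'n list. length js = Suc k} = (\<lambda>(js, j). j # js) ` ({js. length js = k} \<times> UNIV)"
    by (auto simp: length_Suc_conv image_iff)
  then have "(\<Sum>js | length js = Suc k. g js) = (\<Sum>(js, j)\<in>{js. length js = k} \<times> UNIV. g (j # js))"
    by (simp add: sum.reindex inj_on_def case_prod_unfold)
  then show ?thesis by (simp add: sum.cartesian_product)
qed

lemma slice_higher_deriv:
  fixes z :: "complex ^ 'n::finite"
  assumes "open U" "holomorphic_in f U" "w *s z \<in> U"
  shows "(deriv ^^ k) (\<lambda>t. f (t *s z)) w
     = (\<Sum>js | length js = k. (\<Prod>j\<leftarrow>js. z $ j) * foldr partial_deriv js f (w *s z))"
  using assms(3)
proof (induction k arbitrary: w)
  case (Suc k)
  let ?G = "\<lambda>w. \<Sum>js | length js = k. (\<Prod>j\<leftarrow>js. z $ j) * foldr partial_deriv js f (w *s z)"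
  let ?V = "(\<lambda>w. w *s z) -` U"
  have V: "open ?V" "w \<in> ?V"
    using Suc.prems assms(1) by (auto intro!: open_vimage linear_continuous_on bounded_linear_smult_left)
  have "(?G has_field_derivative (\<Sum>js | length js = k. (\<Prod>j\<leftarrow>js. z $ j) *
      (\<Sum>j\<in>UNIV. z $ j * partial_deriv j (foldr partial_deriv js f) (w *s z)))) (at w)"
    by (intro DERIV_sum DERIV_cmult slice_derivative[OF iterated_partial_holomorphic[OF assms(1,2)]] Suc.prems)
  then have "((deriv ^^ k) (\<lambda>t. f (t *s z)) has_field_derivative (\<Sum>js | length js = k. (\<Prod>j\<leftarrow>js. z $ j) *
      (\<Sum>j\<in>UNIV. z $ j * partial_deriv j (foldr partial_deriv js f) (w *s z)))) (at w)"
    by (rule has_field_derivative_transform_within_open[OF _ V]) (use Suc.IH in auto)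
  then have "deriv ((deriv ^^ k) (\<lambda>t. f (t *s z))) w = (\<Sum>js | length js = k. (\<Prod>j\<leftarrow>js. z $ j) *
      (\<Sum>j\<in>UNIV. z $ j * partial_deriv j (foldr partial_deriv js f) (w *s z)))"
    by (rule DERIV_imp_deriv)
  then show ?case
    by (simp add: sum_lists_Suc sum_distrib_left mult_ac)
qed simp

text \<open>Lists of indices with the same multiplicities contribute to the same monomial.\<close>

lemma homogeneous_poly_sum_lists:
  fixes a :: "'n::finite list \<Rightarrow> complex"
  shows "homogeneous_poly k (\<lambda>z. \<Sum>js | length js = k. a js * (\<Prod>j\<leftarrow>js. z $ j))"
  unfolding homogeneous_poly_def
proof (intro exI allI)
  fix z :: "complex ^ 'n"
  let ?S = "{js :: 'n list. length js = k}" and ?T = "{m :: 'n \<Rightarrow> nat. sum m UNIV = k}"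
  have prod: "(\<Prod>j\<leftarrow>js. z $ j) = (\<Prod>i\<in>UNIV. z $ i ^ count_list js i)" for js
  proof (induction js)
    case (Cons a js)
    have "(\<Prod>i\<in>UNIV. z $ i ^ count_list (a # js) i)
        = (\<Prod>i\<in>UNIV. (if i = a then z $ i else 1) * z $ i ^ count_list js i)"
      by (intro prod.cong) auto
    then show ?case using Cons by (simp add: prod.distrib)
  qed simp
  have "finite ?T"
  proof (rule finite_subset)
    show "?T \<subseteq> Pi\<^sub>E UNIV (\<lambda>_. {..k})"
      by (auto simp: PiE_def Pi_def intro: member_le_sum)
  qed (auto intro: finite_PiE)
  moreover have "count_list js \<in> ?T" if "js \<in> ?S" for js
    using that sum_count_set[of js UNIV] by simp
  ultimately have "(\<Sum>js\<in>?S. a js * (\<Prod>j\<leftarrow>js. z $ j))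
      = (\<Sum>m\<in>?T. \<Sum>js\<in>{js \<in> ?S. count_list js = m}. a js * (\<Prod>j\<leftarrow>js. z $ j))"
    by (intro sum.group[symmetric]) auto
  also have "\<dots> = (\<Sum>m\<in>?T. (\<Sum>js\<in>{js \<in> ?S. count_list js = m}. a js) * (\<Prod>i\<in>UNIV. z $ i ^ m i))"
    by (intro sum.cong refl) (auto simp: sum_distrib_right prod intro!: sum.cong)
  finally show "(\<Sum>js\<in>?S. a js * (\<Prod>j\<leftarrow>js. z $ j))
      = (\<Sum>m\<in>?T. (\<Sum>js\<in>{js \<in> ?S. count_list js = m}. a js) * (\<Prod>i\<in>UNIV. z $ i ^ m i))" .
qed

lemma homogeneous_poly_smult:
  assumes "homogeneous_poly k P"
  shows "P (t *s z) = t ^ k * P z"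
proof -
  obtain c where c: "\<And>z. P z = (\<Sum>m | sum m UNIV = k. c m * (\<Prod>i\<in>UNIV. z $ i ^ m i))"
    using assms by (auto simp: homogeneous_poly_def)
  show ?thesis
    unfolding c sum_distrib_left
    by (intro sum.cong refl) (auto simp: power_mult_distrib prod.distrib power_sum)
qed

lemma ball_dilation_room:
  fixes z :: "'a::real_normed_vector"
  assumes "z \<in> ball 0 1"
  obtains \<rho> where "1 < \<rho>" "\<rho> * norm z < 1"
proof (cases "z = 0")
  case False
  then have "1 < 1 / norm z" using assms by simp
  then obtain \<rho> where "1 < \<rho>" "\<rho> < 1 / norm z" using dense by blast
  then show ?thesis using that False by (simp add: field_simps)
qed (use that[of 2] in auto)

lemma smult_mem_ball:
  fixes z :: "complex ^ 'n::finite"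
  assumes "\<rho> * norm z < 1" "cmod w < \<rho>"
  shows "w *s z \<in> ball 0 1"
proof -
  have "cmod w * norm z \<le> \<rho> * norm z" using assms by (intro mult_right_mono) auto
  then show ?thesis using assms by simp
qed

text \<open>On a complex line through the origin a holomorphic function is given by its Taylor series, and
  its coefficients are the homogeneous polynomials collecting the derivatives of one order.\<close>

lemma homogeneous_expansion_exists:
  fixes f :: "complex ^ 'n::finite \<Rightarrow> complex"
  assumes "holomorphic_in f (ball 0 1)"
  shows "\<exists>F. (\<forall>k. homogeneous_poly k (F k)) \<and> (\<forall>z\<in>ball 0 1. (\<lambda>k. F k z) sums f z)"
proof (intro exI conjI allI ballI)
  let ?F = "\<lambda>k z. \<Sum>js | length js = k. foldr partial_deriv js f 0 / fact k * (\<Prod>j\<leftarrow>js. z $ j)"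
  show "homogeneous_poly k (?F k)" for k
    by (rule homogeneous_poly_sum_lists)
  fix z :: "complex ^ 'n" assume z: "z \<in> ball 0 1"
  let ?g = "\<lambda>t. f (t *s z)"
  obtain \<rho> where \<rho>: "1 < \<rho>" "\<rho> * norm z < 1" using ball_dilation_room[OF z] .
  have mem: "w *s z \<in> ball 0 1" if "w \<in> ball 0 \<rho>" for w
    using smult_mem_ball[OF \<rho>(2)] that by simp
  have "?g holomorphic_on ball 0 \<rho>"
    unfolding holomorphic_on_open[OF open_ball] using slice_derivative[OF assms mem] by blast
  then have "(\<lambda>k. (deriv ^^ k) ?g 0 / fact k * (1 - 0) ^ k) sums ?g 1"
    by (rule holomorphic_power_series) (use \<rho> in auto)
  moreover have "(deriv ^^ k) ?g 0 / fact k = ?F k z" for k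
    using slice_higher_deriv[OF open_ball assms, of 0 z k]
    by (simp add: sum_divide_distrib mult_ac)
  ultimately show "(\<lambda>k. ?F k z) sums f z" by simp
qed

lemma homogeneous_expansion:
  fixes f :: "complex ^ 'n::finite \<Rightarrow> complex"
  assumes "holomorphic_in f (ball 0 1)"
  shows "homogeneous_poly k (homogeneous_expansion f k)"
    and "z \<in> ball 0 1 \<Longrightarrow> (\<lambda>k. homogeneous_expansion f k z) sums f z"
  using someI_ex[OF homogeneous_expansion_exists[OF assms]] by (auto simp: homogeneous_expansion_def)

text \<open>Along \<open>t \<mapsto> t z\<close> the operator \<open>\<R>\<close> acts as \<open>t d/dt\<close>, which multiplies the coefficient of \<open>t\<^sup>k\<close>
  by \<open>k\<close>.\<close>

lemma euler_pow_slice_sums: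
  fixes z :: "complex ^ 'n::finite"
  assumes "holomorphic_in f (ball 0 1)" and \<rho>: "\<rho> * norm z < 1" and "cmod w < \<rho>"
  shows "(\<lambda>k. (of_nat k ^ m * homogeneous_expansion f k z) * w ^ k) sums (euler 0 ^^ m) f (w *s z)"
  using assms(3)
proof (induction m arbitrary: w)
  case 0
  then show ?case
    using homogeneous_expansion(2)[OF assms(1) smult_mem_ball[OF \<rho>, of w]] homogeneous_poly_smult[OF homogeneous_expansion(1)[OF assms(1)]]
    by (simp add: mult.commute)
next
  case (Suc m)
  have mem: "w *s z \<in> ball 0 1" by (rule smult_mem_ball[OF \<rho> Suc.prems])
  let ?c = "\<lambda>k. of_nat k ^ m * homogeneous_expansion f k z"
  let ?d = "\<Sum>j\<in>UNIV. z $ j * partial_deriv j ((euler 0 ^^ m) f) (w *s z)"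
  have "(\<lambda>k. diffs ?c k * w ^ k) sums ?d"
    by (rule termdiffs_sums_strong[OF Suc.IH slice_derivative[OF euler_pow_holomorphic[OF open_ball assms(1)] mem] Suc.prems])
  then have "(\<lambda>k. diffs ?c k * w ^ k * w) sums (?d * w)"
    by (rule sums_mult2)
  then have "(\<lambda>k. (of_nat (Suc k) ^ Suc m * homogeneous_expansion f (Suc k) z) * w ^ Suc k) sums (?d * w)"
    by (simp add: diffs_def mult_ac)
  then have "(\<lambda>k. (of_nat k ^ Suc m * homogeneous_expansion f k z) * w ^ k) sums (?d * w)"
    by (subst (asm) sums_Suc_iff) simp
  moreover have "?d * w = (euler 0 ^^ Suc m) f (w *s z)"
    by (simp add: euler_def[of 0 "(euler 0 ^^ m) f"] sum_distrib_left sum_distrib_right mult_ac)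
  ultimately show ?case by simp
qed

lemma radial_derivative_eq_euler_pow:
  fixes z :: "complex ^ 'n::finite"
  assumes "holomorphic_in f (ball 0 1)" "z \<in> ball 0 1" "0 < s"
  shows "radial_derivative (of_nat s) f z = (euler 0 ^^ s) f z"
proof -
  obtain \<rho> where \<rho>: "1 < \<rho>" "\<rho> * norm z < 1" using ball_dilation_room[OF assms(2)] .
  have "(\<lambda>k. of_nat k ^ s * homogeneous_expansion f k z) sums (euler 0 ^^ s) f z"
    using euler_pow_slice_sums[OF assms(1) \<rho>(2), of 1 s] \<rho>(1) by simp
  then have "(\<lambda>k. of_nat (Suc k) ^ s * homogeneous_expansion f (Suc k) z) sums (euler 0 ^^ s) f z"
    using assms(3) by (subst sums_Suc_iff) (simp add: power_0_left)
  moreover have "of_nat (Suc k) powr of_nat s = (of_nat (Suc k) :: complex) ^ s" for k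
    by (rule powr_nat') (use assms(3) in auto)
  ultimately show ?thesis
    unfolding radial_derivative_def by (simp add: sums_iff)
qed

section \<open>Unitary invariance of the sphere measure\<close>

lemma nn_integral_lborel_shift:
  assumes [measurable]: "g \<in> borel_measurable borel"
  shows "(\<integral>\<^sup>+ x. g (x + c) \<partial>lborel) = (\<integral>\<^sup>+ x. g x \<partial>(lborel :: 'a::euclidean_space measure))"
proof -
  have "(\<integral>\<^sup>+ x. g x \<partial>lborel) = (\<integral>\<^sup>+ x. g x \<partial>distr lborel borel ((+) c))"
    by (simp add: lborel_distr_plus)
  also have "\<dots> = (\<integral>\<^sup>+ x. g (c + x) \<partial>lborel)"
    by (rule nn_integral_distr) auto
  finally show ?thesis by (simp add: add.commute)
qed

lemma nn_integral_lborel_reflect: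
  assumes [measurable]: "g \<in> borel_measurable borel"
  shows "(\<integral>\<^sup>+ x. g (c - x) \<partial>lborel) = (\<integral>\<^sup>+ x. g x \<partial>(lborel :: 'a::euclidean_space measure))"
proof -
  have "(\<integral>\<^sup>+ x. g x \<partial>lborel) = (\<integral>\<^sup>+ x. g x \<partial>distr lborel borel (\<lambda>x. c + (-1) *\<^sub>R x))"
    using lborel_affine[of "-1" c] by (simp add: density_1 flip: one_ennreal_def)
  also have "\<dots> = (\<integral>\<^sup>+ x. g (c + (-1) *\<^sub>R x) \<partial>lborel)"
    by (rule nn_integral_distr) auto
  finally show ?thesis by simp
qed

text \<open>Two translation invariant measures are proportional, by Fubini's theorem; the image of Lebesgue
  measure under an isometry agrees with Lebesgue measure on the unit ball, so the factor is one.\<close>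

lemma lborel_distr_orthogonal:
  fixes T :: "'a::euclidean_space \<Rightarrow> 'a"
  assumes T: "orthogonal_transformation T"
  shows "distr lborel borel T = lborel"
proof (rule measure_eqI)
  have lin: "linear T" using T by (rule orthogonal_transformation_linear)
  have [measurable]: "T \<in> borel_measurable borel"
    by (intro borel_measurable_continuous_onI linear_continuous_on linear_conv_bounded_linear[THEN iffD1] lin)
  have surj: "surj T" using T by (rule orthogonal_transformation_surj)
  fix A assume "A \<in> sets (distr lborel borel T)"
  then have [measurable]: "A \<in> sets borel" by simp
  define B :: "'a set" where "B = ball 0 1"
  have [measurable]: "B \<in> sets borel" by (simp add: B_def)
  let ?\<mu> = "\<lambda>A. \<integral>\<^sup>+ x. indicator A (T x) \<partial>lborel"
  have mu: "emeasure (distr lborel borel T) A = ?\<mu> A" if [measurable]: "A \<in> sets borel" for A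
  proof -
    have "emeasure (distr lborel borel T) A = (\<integral>\<^sup>+ x. indicator A x \<partial>distr lborel borel T)" by simp
    also have "\<dots> = ?\<mu> A" by (rule nn_integral_distr) auto
    finally show ?thesis .
  qed
  have "?\<mu> A * emeasure lborel B = (\<integral>\<^sup>+ x. indicator A (T x) * (\<integral>\<^sup>+ y. indicator B y \<partial>lborel) \<partial>lborel)"
    by (simp add: nn_integral_multc)
  also have "\<dots> = (\<integral>\<^sup>+ x. (\<integral>\<^sup>+ y. indicator A (T x) * indicator B (y + T x) \<partial>lborel) \<partial>lborel)"
    by (simp add: nn_integral_cmult nn_integral_lborel_shift)
  also have "\<dots> = (\<integral>\<^sup>+ y. (\<integral>\<^sup>+ x. indicator A (T x) * indicator B (y + T x) \<partial>lborel) \<partial>lborel)"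
    by (rule lborel_pair.Fubini') measurable
  also have "\<dots> = (\<integral>\<^sup>+ y. (\<integral>\<^sup>+ x. indicator A (T x - y) * indicator B (T x) \<partial>lborel) \<partial>lborel)"
  proof (rule nn_integral_cong)
    fix y
    obtain c where c: "T c = y" using surj by (metis surjD)
    have "(\<integral>\<^sup>+ x. indicator A (T x - y) * indicator B (T x) \<partial>lborel)
        = (\<integral>\<^sup>+ x. indicator A (T (x + c) - y) * indicator B (T (x + c)) \<partial>lborel)"
      by (rule nn_integral_lborel_shift[symmetric]) measurable
    then show "(\<integral>\<^sup>+ x. indicator A (T x) * indicator B (y + T x) \<partial>lborel)
        = (\<integral>\<^sup>+ x. indicator A (T x - y) * indicator B (T x) \<partial>lborel)"
      by (simp add: linear_add[OF lin] c add.commute)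
  qed
  also have "\<dots> = (\<integral>\<^sup>+ x. (\<integral>\<^sup>+ y. indicator A (T x - y) * indicator B (T x) \<partial>lborel) \<partial>lborel)"
    by (rule lborel_pair.Fubini'[symmetric]) measurable
  also have "\<dots> = (\<integral>\<^sup>+ x. emeasure lborel A * indicator B (T x) \<partial>lborel)"
    by (simp add: nn_integral_multc nn_integral_lborel_reflect)
  also have "\<dots> = emeasure lborel A * ?\<mu> B"
    by (simp add: nn_integral_cmult)
  also have "?\<mu> B = emeasure lborel B"
  proof -
    have "?\<mu> B = (\<integral>\<^sup>+ x. indicator B x \<partial>lborel)"
      using T by (intro nn_integral_cong) (simp add: B_def orthogonal_transformation_norm split: split_indicator)
    then show ?thesis by simp
  qed
  finally have "?\<mu> A * emeasure lborel B = emeasure lborel A * emeasure lborel B" .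
  moreover have "emeasure lborel B \<noteq> 0"
    using content_ball_pos[of 1 "0::'a"] by (auto simp: B_def measure_def)
  moreover have "emeasure lborel B \<noteq> top"
    using emeasure_lborel_ball_finite[of "0::'a" 1] by (simp add: B_def)
  ultimately show "emeasure (distr lborel borel T) A = emeasure lborel A"
    unfolding mu[OF \<open>A \<in> sets borel\<close>] by (metis mult_divide_eq_ennreal)
qed simp

lemma sphere_measure_sets [measurable_cong]:
  "sets sphere_measure = sets (restrict_space borel (sphere 0 1 :: (complex ^ 'n::finite) set))"
  by (simp add: sphere_measure_def sets_restrict_space)

lemma space_sphere_measure [simp]: "space (sphere_measure :: (complex ^ 'n::finite) measure) = sphere 0 1"
  by (simp add: sphere_measure_def space_restrict_space)

lemma ident_sphere_measurable [measurable]: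
  "(\<lambda>\<zeta> :: complex ^ 'n::finite. \<zeta>) \<in> measurable sphere_measure borel"
proof -
  have "(\<lambda>\<zeta> :: complex ^ 'n. \<zeta>) \<in> measurable (restrict_space borel (sphere 0 1)) borel"
    by (rule measurable_restrict_space1) simp
  then show ?thesis
    by (simp only: measurable_cong_sets[OF sphere_measure_sets refl])
qed

lemma prob_space_ball: "prob_space (uniform_measure lborel (ball 0 1 :: 'a::euclidean_space set))"
proof (rule prob_space_uniform_measure)
  show "emeasure lborel (ball 0 1 :: 'a set) \<noteq> 0"
    using content_ball_pos[of 1 "0::'a"] by (auto simp: measure_def)
  show "emeasure lborel (ball 0 1 :: 'a set) \<noteq> \<infinity>"
    using emeasure_lborel_ball_finite[of "0::'a" 1] by simp
qed

lemma sgn_borel_measurable [measurable]: "sgn \<in> borel_measurable (borel :: (complex ^ 'n::finite) measure)"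
  unfolding sgn_div_norm[abs_def] by measurable

lemma prob_space_sphere_measure: "prob_space (sphere_measure :: (complex ^ 'n::finite) measure)"
proof
  interpret prob_space "uniform_measure lborel (ball 0 1 :: (complex ^ 'n) set)"
    by (rule prob_space_ball)
  interpret D: prob_space "distr (uniform_measure lborel (ball 0 1 :: (complex ^ 'n) set)) borel sgn"
    using sgn_borel_measurable by (intro prob_space_distr) (simp cong: measurable_cong_sets)
  have "emeasure (sphere_measure :: (complex ^ 'n) measure) (sphere 0 1)
     = emeasure (distr (uniform_measure lborel (ball 0 1)) borel sgn) (sphere 0 1 :: (complex ^ 'n) set)"
    by (simp add: sphere_measure_def emeasure_restrict_space)
  also have "\<dots> = 1"
  proof (subst D.emeasure_eq_1_AE)
    have "AE x in uniform_measure lborel (ball 0 1 :: (complex ^ 'n) set). x \<noteq> 0"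
    proof (rule AE_uniform_measureI)
      show "AE x in lborel. x \<in> ball 0 1 \<longrightarrow> x \<noteq> (0 :: complex ^ 'n)"
        using AE_lborel_singleton[of "0 :: complex ^ 'n"] by eventually_elim simp
    qed simp
    then have "AE x in uniform_measure lborel (ball 0 1 :: (complex ^ 'n) set). sgn x \<in> sphere 0 1"
      by eventually_elim (simp add: norm_sgn)
    then show "AE x in distr (uniform_measure lborel (ball 0 1)) borel sgn. x \<in> (sphere 0 1 :: (complex ^ 'n) set)"
      by (subst AE_distr_iff) (use sgn_borel_measurable in \<open>auto cong: measurable_cong_sets\<close>)
  qed auto
  finally show "emeasure (sphere_measure :: (complex ^ 'n) measure) (space sphere_measure) = 1"
    by simp
qed

interpretation sphere: prob_space "sphere_measure :: (complex ^ 'n::finite) measure"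
  by (rule prob_space_sphere_measure)

text \<open>The projection \<open>sgn\<close> commutes with linear isometries, and these preserve Lebesgue measure on the ball.\<close>

lemma distr_sphere_measure:
  fixes T :: "complex ^ 'n::finite \<Rightarrow> complex ^ 'n"
  assumes T: "orthogonal_transformation T"
  shows "T \<in> measurable sphere_measure sphere_measure" (is ?m)
    and "distr sphere_measure sphere_measure T = sphere_measure"
proof -
  have lin: "linear T" using T by (rule orthogonal_transformation_linear)
  have nT: "norm (T x) = norm x" for x using T by (rule orthogonal_transformation_norm)
  have [measurable]: "T \<in> borel_measurable borel"
    by (intro borel_measurable_continuous_onI linear_continuous_on linear_conv_bounded_linear[THEN iffD1] lin)
  show m[measurable]: ?m
    unfolding measurable_cong_sets[OF sphere_measure_sets sphere_measure_sets]
    by (rule measurable_restrict_space3) (auto simp: nT)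
  let ?U = "uniform_measure lborel (ball 0 1 :: (complex ^ 'n) set)"
  let ?D = "distr ?U borel sgn"
  have U: "distr ?U borel T = ?U"
  proof (rule measure_eqI)
    fix A assume "A \<in> sets (distr ?U borel T)"
    then have [measurable]: "A \<in> sets borel" by simp
    have "emeasure lborel (ball 0 1 \<inter> T -` A) = emeasure lborel (T -` (ball 0 1 \<inter> A) \<inter> space lborel)"
      by (rule arg_cong[of _ _ "emeasure lborel"]) (auto simp: nT)
    also have "\<dots> = emeasure (distr lborel borel T) (ball 0 1 \<inter> A)"
      by (rule emeasure_distr[symmetric]) auto
    also have "\<dots> = emeasure lborel (ball 0 1 \<inter> A)"
      by (simp add: lborel_distr_orthogonal[OF T])
    finally have *: "emeasure lborel (ball 0 1 \<inter> T -` A) = emeasure lborel (ball 0 1 \<inter> A)" .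
    have "T -` A \<in> sets borel" using measurable_sets[of T borel borel A] by simp
    moreover have "T \<in> measurable ?U borel"
      by (simp cong: measurable_cong_sets)
    ultimately show "emeasure (distr ?U borel T) A = emeasure ?U A"
      using * by (subst emeasure_distr) (auto simp: emeasure_uniform_measure)
  qed simp
  have sgnT: "sgn (T x) = T (sgn x)" for x
    by (simp add: sgn_div_norm nT linear_cmul[OF lin])
  have D: "distr ?D borel T = ?D"
  proof -
    have [measurable]: "T \<in> measurable ?U borel" "sgn \<in> measurable ?U borel"
      by (simp_all cong: measurable_cong_sets)
    have "distr ?D borel T = distr (distr ?U borel T) borel sgn"
      by (subst (1 2) distr_distr) (auto simp: comp_def sgnT)
    then show ?thesis by (simp add: U)
  qed
  show "distr sphere_measure sphere_measure T = sphere_measure"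
  proof (rule measure_eqI)
    fix A :: "(complex ^ 'n) set" assume "A \<in> sets (distr sphere_measure sphere_measure T)"
    then have A': "A \<in> sets sphere_measure" by simp
    then have A: "A \<in> sets borel" "A \<subseteq> sphere 0 1"
      by (auto simp: sphere_measure_sets sets_restrict_space)
    have eq: "T -` A \<inter> sphere 0 1 = T -` A" using A(2) by (auto simp: nT subset_iff)
    have "T -` A \<in> sets borel" using measurable_sets[of T borel borel A] A by simp
    have "emeasure (distr sphere_measure sphere_measure T) A = emeasure sphere_measure (T -` A)"
      using A' by (simp add: emeasure_distr eq)
    also have "\<dots> = emeasure ?D (T -` A)"
      unfolding sphere_measure_def using A eq by (subst emeasure_restrict_space) auto
    also have "\<dots> = emeasure (distr ?D borel T) A"
      using A by (simp add: emeasure_distr)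
    also have "\<dots> = emeasure sphere_measure A"
      unfolding D unfolding sphere_measure_def using A by (subst emeasure_restrict_space) auto
    finally show "emeasure (distr sphere_measure sphere_measure T) A = emeasure sphere_measure A" .
  qed simp
qed


section \<open>Bounds for integral means\<close>

text \<open>The bound \<open>\<parallel>\<phi>\<parallel>\<^sub>p \<le> C\<close> on the sphere, phrased without roots so that both kinds of exponent can be
  treated by Fubini arguments.\<close>

definition mean_le :: "ennreal \<Rightarrow> (complex ^ 'n::finite \<Rightarrow> real) \<Rightarrow> real \<Rightarrow> bool" where
  "mean_le p \<phi> C \<longleftrightarrow>
     (if p = top then AE \<zeta> in sphere_measure. \<phi> \<zeta> \<le> C
      else (\<integral>\<^sup>+ \<zeta>. ennreal (\<phi> \<zeta> powr enn2real p) \<partial>sphere_measure) \<le> ennreal (C powr enn2real p))"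

lemma enn2real_ge_one: "1 \<le> p \<Longrightarrow> p \<noteq> top \<Longrightarrow> 1 \<le> enn2real p"
  by (cases p) (auto simp flip: ennreal_1)

lemma mean_le_mono:
  assumes "1 \<le> p" "mean_le p \<phi> C" "0 \<le> C" "C \<le> D"
    and "\<And>\<zeta>. \<zeta> \<in> sphere 0 1 \<Longrightarrow> 0 \<le> \<psi> \<zeta> \<and> \<psi> \<zeta> \<le> \<phi> \<zeta>"
  shows "mean_le p \<psi> D"
proof (cases "p = top")
  case True
  have "AE \<zeta> in sphere_measure. \<psi> \<zeta> \<le> \<phi> \<zeta>" by (rule AE_I2) (use assms(5) in auto)
  moreover have "AE \<zeta> in sphere_measure. \<phi> \<zeta> \<le> C" using assms(2) True by (simp add: mean_le_def)
  ultimately have "AE \<zeta> in sphere_measure. \<psi> \<zeta> \<le> D" by eventually_elim (use assms(4) in simp)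
  then show ?thesis using True by (simp add: mean_le_def)
next
  case False
  note P = enn2real_ge_one[OF assms(1) False]
  have "(\<integral>\<^sup>+ \<zeta>. ennreal (\<psi> \<zeta> powr enn2real p) \<partial>sphere_measure) \<le> (\<integral>\<^sup>+ \<zeta>. ennreal (\<phi> \<zeta> powr enn2real p) \<partial>sphere_measure)"
    by (intro nn_integral_mono ennreal_leI powr_mono2) (use assms(5) P in auto)
  also have "\<dots> \<le> ennreal (C powr enn2real p)" using assms(2) False by (simp add: mean_le_def)
  also have "\<dots> \<le> ennreal (D powr enn2real p)"
    by (intro ennreal_leI powr_mono2) (use assms P in auto)
  finally show ?thesis using False by (simp add: mean_le_def)
qed

lemma mean_le_bounded:
  assumes "1 \<le> p" "\<And>\<zeta>. \<zeta> \<in> sphere 0 1 \<Longrightarrow> 0 \<le> \<phi> \<zeta> \<and> \<phi> \<zeta> \<le> C" "0 \<le> C"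
  shows "mean_le p (\<phi> :: complex ^ 'n::finite \<Rightarrow> real) C"
proof (rule mean_le_mono[OF assms(1) _ assms(3) order_refl, of "\<lambda>_. C"])
  show "mean_le p (\<lambda>_ :: complex ^ 'n. C) C"
    by (simp add: mean_le_def sphere.emeasure_space_1[simplified])
qed (use assms in auto)

lemma mean_le_cmult:
  assumes "1 \<le> p" "mean_le p \<phi> C" "0 \<le> C" "0 \<le> c"
    and [measurable]: "\<phi> \<in> borel_measurable sphere_measure" and nn: "\<And>\<zeta>. \<zeta> \<in> sphere 0 1 \<Longrightarrow> 0 \<le> \<phi> \<zeta>"
  shows "mean_le p (\<lambda>\<zeta>. c * \<phi> \<zeta>) (c * C)"
proof (cases "p = top")
  case True
  have "AE \<zeta> in sphere_measure. \<phi> \<zeta> \<le> C" using assms(2) True by (simp add: mean_le_def)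
  then have "AE \<zeta> in sphere_measure. c * \<phi> \<zeta> \<le> c * C" by eventually_elim (rule mult_left_mono[OF _ assms(4)])
  then show ?thesis using True by (simp add: mean_le_def)
next
  case False
  have "(\<integral>\<^sup>+ \<zeta>. ennreal ((c * \<phi> \<zeta>) powr enn2real p) \<partial>sphere_measure)
     = (\<integral>\<^sup>+ \<zeta>. ennreal (c powr enn2real p) * ennreal (\<phi> \<zeta> powr enn2real p) \<partial>sphere_measure)"
    by (intro nn_integral_cong) (use assms(4) nn in \<open>simp add: powr_mult ennreal_mult\<close>)
  also have "\<dots> = ennreal (c powr enn2real p) * (\<integral>\<^sup>+ \<zeta>. ennreal (\<phi> \<zeta> powr enn2real p) \<partial>sphere_measure)"
    by (rule nn_integral_cmult) measurable
  also have "\<dots> \<le> ennreal (c powr enn2real p) * ennreal (C powr enn2real p)"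
    using assms(2) False by (intro mult_left_mono) (auto simp: mean_le_def)
  also have "\<dots> = ennreal ((c * C) powr enn2real p)"
    using assms(3,4) by (simp add: powr_mult ennreal_mult)
  finally show ?thesis using False by (simp add: mean_le_def)
qed

text \<open>The sum is at most \<open>card K\<close> times the largest summand.\<close>

lemma sum_powr_le:
  fixes x :: "'k \<Rightarrow> real"
  assumes K: "finite K" and nn: "\<And>k. k \<in> K \<Longrightarrow> 0 \<le> x k" and P: "0 \<le> P"
  shows "(\<Sum>k\<in>K. x k) powr P \<le> real (card K) powr P * (\<Sum>k\<in>K. x k powr P)"
proof (cases "K = {}")
  case False
  have "Max (x ` K) \<in> x ` K" using K False by (intro Max_in) auto
  then obtain k0 where k0: "k0 \<in> K" "x k0 = Max (x ` K)" by force
  have "(\<Sum>k\<in>K. x k) \<le> real (card K) * x k0"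
    by (rule sum_bounded_above) (use k0 K in auto)
  then have "(\<Sum>k\<in>K. x k) powr P \<le> (real (card K) * x k0) powr P"
    using P by (intro powr_mono2 sum_nonneg nn)
  also have "\<dots> = real (card K) powr P * x k0 powr P" using nn[OF k0(1)] by (simp add: powr_mult)
  also have "\<dots> \<le> real (card K) powr P * (\<Sum>k\<in>K. x k powr P)"
    by (intro mult_left_mono member_le_sum[OF k0(1) _ K, of "\<lambda>k. x k powr P"]) auto
  finally show ?thesis .
qed simp

text \<open>Minkowski's inequality up to a constant that depends only on the number of summands.\<close>

lemma mean_le_sum:
  fixes \<phi> :: "'k \<Rightarrow> complex ^ 'n::finite \<Rightarrow> real"
  assumes p: "1 \<le> p" and K: "finite K" and "0 \<le> C"
    and le: "\<And>k. k \<in> K \<Longrightarrow> mean_le p (\<phi> k) C"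
    and [measurable]: "\<And>k. k \<in> K \<Longrightarrow> \<phi> k \<in> borel_measurable sphere_measure"
    and nn: "\<And>k \<zeta>. k \<in> K \<Longrightarrow> \<zeta> \<in> sphere 0 1 \<Longrightarrow> 0 \<le> \<phi> k \<zeta>"
    and \<psi>: "\<And>\<zeta>. \<zeta> \<in> sphere 0 1 \<Longrightarrow> 0 \<le> \<psi> \<zeta> \<and> \<psi> \<zeta> \<le> (\<Sum>k\<in>K. \<phi> k \<zeta>)"
  shows "mean_le p \<psi> ((real (card K))\<^sup>2 * C)"
proof (cases "K = {}")
  case True
  have "mean_le p \<psi> 0" by (rule mean_le_bounded[OF p]) (use \<psi> True in auto)
  then show ?thesis using True by simp
next
  case False
  define c where "c = real (card K)"
  have c: "1 \<le> c" using False K by (simp add: c_def card_gt_0_iff Suc_le_eq)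
  show ?thesis
  proof (cases "p = top")
    case True
    have "AE \<zeta> in sphere_measure. \<forall>k\<in>K. \<phi> k \<zeta> \<le> C"
      using le True K by (intro AE_finite_allI) (auto simp: mean_le_def)
    then have "AE \<zeta> in sphere_measure. \<psi> \<zeta> \<le> c\<^sup>2 * C"
      using AE_space
    proof eventually_elim
      case (elim \<zeta>)
      have "\<psi> \<zeta> \<le> (\<Sum>k\<in>K. \<phi> k \<zeta>)" using \<psi> elim by simp
      also have "\<dots> \<le> c * C" unfolding c_def by (rule sum_bounded_above) (use elim in auto)
      also have "\<dots> \<le> c * (c * C)" using c \<open>0 \<le> C\<close> by (intro mult_left_mono) (auto simp: mult_le_cancel_right1)
      finally show ?case by (simp add: power2_eq_square mult_ac)
    qed
    then show ?thesis using True by (simp add: mean_le_def c_def)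
  next
    case fin: False
    define P where "P = enn2real p"
    have P: "1 \<le> P" unfolding P_def by (rule enn2real_ge_one[OF p fin])
    have "(\<integral>\<^sup>+ \<zeta>. ennreal (\<psi> \<zeta> powr P) \<partial>sphere_measure) \<le> (\<integral>\<^sup>+ \<zeta>. (\<Sum>k\<in>K. ennreal (c powr P) * ennreal (\<phi> k \<zeta> powr P)) \<partial>sphere_measure)"
    proof (rule nn_integral_mono)
      fix \<zeta> :: "complex ^ 'n" assume "\<zeta> \<in> space sphere_measure"
      then have z: "\<zeta> \<in> sphere 0 1" by simp
      have "\<psi> \<zeta> powr P \<le> (\<Sum>k\<in>K. \<phi> k \<zeta>) powr P"
        using \<psi> z P by (intro powr_mono2) auto
      also have "\<dots> \<le> c powr P * (\<Sum>k\<in>K. \<phi> k \<zeta> powr P)"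
        unfolding c_def using nn z P by (intro sum_powr_le K) auto
      also have "\<dots> = (\<Sum>k\<in>K. c powr P * \<phi> k \<zeta> powr P)" by (rule sum_distrib_left)
      finally have "ennreal (\<psi> \<zeta> powr P) \<le> ennreal (\<Sum>k\<in>K. c powr P * \<phi> k \<zeta> powr P)" by (rule ennreal_leI)
      also have "\<dots> = (\<Sum>k\<in>K. ennreal (c powr P * \<phi> k \<zeta> powr P))" by (rule sum_ennreal[symmetric]) auto
      finally show "ennreal (\<psi> \<zeta> powr P) \<le> (\<Sum>k\<in>K. ennreal (c powr P) * ennreal (\<phi> k \<zeta> powr P))"
        by (simp add: ennreal_mult)
    qed
    also have "\<dots> = (\<Sum>k\<in>K. ennreal (c powr P) * (\<integral>\<^sup>+ \<zeta>. ennreal (\<phi> k \<zeta> powr P) \<partial>sphere_measure))"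
      by (subst nn_integral_sum) (auto intro!: sum.cong nn_integral_cmult)
    also have "\<dots> \<le> (\<Sum>k\<in>K. ennreal (c powr P) * ennreal (C powr P))"
      using le fin by (intro sum_mono mult_left_mono) (auto simp: mean_le_def P_def)
    also have "\<dots> = ennreal (c * (c powr P * C powr P))"
      using c by (simp add: c_def ennreal_mult ennreal_of_nat_eq_real_of_nat)
    also have "\<dots> \<le> ennreal ((c\<^sup>2 * C) powr P)"
    proof (rule ennreal_leI)
      have "c powr 1 \<le> c powr P" using c P by (intro powr_mono) auto
      then have "c * (c powr P * C powr P) \<le> c powr P * (c powr P * C powr P)"
        using c by (intro mult_right_mono) auto
      also have "\<dots> = (c\<^sup>2 * C) powr P" using c \<open>0 \<le> C\<close> by (simp add: powr_mult power2_eq_square)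
      finally show "c * (c powr P * C powr P) \<le> (c\<^sup>2 * C) powr P" .
    qed
    finally show ?thesis using fin by (simp add: mean_le_def P_def c_def)
  qed
qed

lemma mean_le_orthogonal:
  fixes T :: "complex ^ 'n::finite \<Rightarrow> complex ^ 'n"
  assumes T: "orthogonal_transformation T" and le: "mean_le p \<phi> C"
    and [measurable]: "\<phi> \<in> borel_measurable sphere_measure"
  shows "mean_le p (\<lambda>\<zeta>. \<phi> (T \<zeta>)) C"
proof -
  note [measurable] = distr_sphere_measure(1)[OF T]
  have "AE \<zeta> in sphere_measure. \<phi> (T \<zeta>) \<le> C" if "AE \<zeta> in sphere_measure. \<phi> \<zeta> \<le> C"
  proof -
    have "AE \<zeta> in distr sphere_measure sphere_measure T. \<phi> \<zeta> \<le> C"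
      unfolding distr_sphere_measure(2)[OF T] by (rule that)
    moreover have m: "{\<zeta> \<in> space sphere_measure. \<phi> \<zeta> \<le> C} \<in> sets sphere_measure"
      by measurable
    ultimately show ?thesis
      using iffD1[OF AE_distr_iff[OF distr_sphere_measure(1)[OF T] m]] by simp
  qed
  moreover have "(\<integral>\<^sup>+ \<zeta>. ennreal (\<phi> (T \<zeta>) powr enn2real p) \<partial>sphere_measure)
      = (\<integral>\<^sup>+ \<zeta>. ennreal (\<phi> \<zeta> powr enn2real p) \<partial>distr sphere_measure sphere_measure T)"
    by (rule nn_integral_distr[symmetric]) auto
  ultimately show ?thesis
    using le by (auto simp: mean_le_def distr_sphere_measure(2)[OF T])
qed

lemma powr_above_tangent:
  fixes c t P :: real
  assumes "1 \<le> P" "0 < c" "0 \<le> t"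
  shows "c powr P + P * c powr (P - 1) * (t - c) \<le> t powr P"
proof (cases "t = 0")
  case True
  have "c powr P = c powr (P - 1) * c" using assms by (simp add: powr_diff)
  then have "c powr P + P * c powr (P - 1) * (t - c) = (1 - P) * c powr P" using True by (simp add: algebra_simps)
  also have "\<dots> \<le> 0" using assms by (intro mult_nonpos_nonneg) auto
  finally show ?thesis using True by simp
next
  case False
  have "t powr P - c powr P \<ge> P * c powr (P - 1) * (t - c)"
  proof (rule convex_on_imp_above_tangent[OF powr_convex[OF assms(1)]])
    show "((\<lambda>x. x powr P) has_real_derivative P * c powr (P - 1)) (at c within {0<..})"
      using assms by (auto intro!: derivative_eq_intros has_field_derivative_at_within[OF has_real_derivative_powr])
  qed (use assms False in \<open>auto simp: interior_open\<close>)
  then show ?thesis by simp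
qed

text \<open>Jensen's inequality, from the tangent of \<open>x \<mapsto> x\<^sup>P\<close> at the mean of \<open>v\<close>.\<close>

lemma integral_powr_le:
  fixes v :: "real \<Rightarrow> real"
  assumes v: "continuous_on {0..1} v" "\<And>t. t \<in> {0..1} \<Longrightarrow> 0 \<le> v t" and P: "1 \<le> P"
  shows "integral {0..1} v powr P \<le> integral {0..1} (\<lambda>t. v t powr P)"
proof -
  define c where "c = integral {0..1} v"
  have c0: "0 \<le> c" unfolding c_def by (rule integral_nonneg[OF integrable_continuous_real[OF v(1)]]) (use v(2) in auto)
  have cont: "continuous_on {0..1} (\<lambda>t. v t powr P)"
    by (rule continuous_on_powr') (use v P in \<open>auto intro: continuous_intros\<close>)
  show ?thesis
  proof (cases "c = 0")
    case True
    then show ?thesis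
      unfolding c_def[symmetric] using integral_nonneg[OF integrable_continuous_real[OF cont]] by simp
  next
    case False
    then have "0 < c" using c0 by simp
    let ?h = "\<lambda>t. c powr P + P * c powr (P - 1) * (v t - c)"
    have vi: "(v has_integral c) {0..1}"
      unfolding c_def by (intro integrable_integral integrable_continuous_real v(1))
    have "((\<lambda>t. v t - c) has_integral (c - c)) {0..1}"
      using has_integral_diff[OF vi has_integral_const_real[of c 0 1]] by simp
    from has_integral_add[OF has_integral_const_real[of "c powr P" 0 1]
        has_integral_mult_right[OF this, of "P * c powr (P - 1)"]]
    have "(?h has_integral c powr P) {0..1}" by simp
    then have "c powr P \<le> integral {0..1} (\<lambda>t. v t powr P)"
      by (rule has_integral_le[OF _ integrable_integral[OF integrable_continuous_real[OF cont]]])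
        (use powr_above_tangent[OF P \<open>0 < c\<close>] v(2) in auto)
    then show ?thesis by (simp add: c_def)
  qed
qed

text \<open>Means do not increase under averaging: for finite \<open>p\<close> this is Jensen's inequality followed by
  Fubini's theorem, for \<open>p = \<infinity>\<close> it is Fubini's theorem for null sets.\<close>

lemma mean_le_average:
  fixes V :: "real \<Rightarrow> complex ^ 'n::finite \<Rightarrow> real"
  assumes p: "1 \<le> p" and C: "0 \<le> C"
    and cont: "continuous_on ({0..1} \<times> sphere 0 1) (\<lambda>(\<theta>, \<zeta>). V \<theta> \<zeta>)"
    and nn: "\<And>\<theta> \<zeta>. \<theta> \<in> {0..1} \<Longrightarrow> \<zeta> \<in> sphere 0 1 \<Longrightarrow> 0 \<le> V \<theta> \<zeta>"
    and \<phi>: "\<And>\<zeta>. \<zeta> \<in> sphere 0 1 \<Longrightarrow> 0 \<le> \<phi> \<zeta> \<and> \<phi> \<zeta> \<le> integral {0..1} (\<lambda>\<theta>. V \<theta> \<zeta>)"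
    and V: "\<And>\<theta>. \<theta> \<in> {0..1} \<Longrightarrow> mean_le p (V \<theta>) C"
  shows "mean_le p \<phi> C"
proof -
  define g where "g = (\<lambda>x :: real \<times> (complex ^ 'n). indicator ({0..1} \<times> sphere 0 1) x *\<^sub>R (\<lambda>(\<theta>, \<zeta>). V \<theta> \<zeta>) x)"
  have "g \<in> borel_measurable borel"
    unfolding g_def by (rule borel_measurable_continuous_on_indicator[OF _ cont]) (simp add: borel_closed closed_Times)
  then have [measurable]: "g \<in> borel_measurable (borel \<Otimes>\<^sub>M borel)" by (simp add: borel_prod)
  have g: "g (\<theta>, \<zeta>) = V \<theta> \<zeta> * indicator {0..1} \<theta>" if "\<zeta> \<in> sphere 0 1" for \<theta> \<zeta>
    using that by (auto simp: g_def split: split_indicator)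
  have gnn: "0 \<le> g x" for x using nn by (auto simp: g_def split: split_indicator)
  have Vc: "continuous_on {0..1} (\<lambda>\<theta>. V \<theta> \<zeta>)" if "\<zeta> \<in> sphere 0 1" for \<zeta>
  proof -
    have "continuous_on {0..1} (\<lambda>\<theta>. (\<lambda>(\<theta>, \<zeta>). V \<theta> \<zeta>) (\<theta>, \<zeta>))"
      by (rule continuous_on_compose2[OF cont]) (use that in \<open>auto intro!: continuous_intros\<close>)
    then show ?thesis by simp
  qed
  interpret L: pair_sigma_finite "lborel :: real measure" "sphere_measure :: (complex ^ 'n) measure" ..
  show ?thesis
  proof (cases "p = top")
    case True
    have "AE \<theta> in lborel. AE \<zeta> in sphere_measure. g (\<theta>, \<zeta>) \<le> C"
    proof (rule AE_I2)
      fix \<theta> :: real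
      show "AE \<zeta> in sphere_measure. g (\<theta>, \<zeta>) \<le> C"
      proof (cases "\<theta> \<in> {0..1}")
        case inside: True
        have "AE \<zeta> in sphere_measure. V \<theta> \<zeta> \<le> C" using V[OF inside] True by (simp add: mean_le_def)
        then show ?thesis using AE_space by eventually_elim (use inside in \<open>simp add: g\<close>)
      next
        case outside: False
        then have "g (\<theta>, \<zeta>) = 0" for \<zeta> by (auto simp: g_def split: split_indicator)
        then show ?thesis by (simp add: C)
      qed
    qed
    then have "AE \<zeta> in sphere_measure. AE \<theta> in lborel. g (\<theta>, \<zeta>) \<le> C"
      by (subst (asm) L.AE_commute) measurable
    then have "AE \<zeta> in sphere_measure. \<phi> \<zeta> \<le> C"
      using AE_space
    proof eventually_elim
      case (elim \<zeta>)
      then have z: "\<zeta> \<in> sphere 0 1" by simp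
      have "ennreal (integral {0..1} (\<lambda>\<theta>. V \<theta> \<zeta>)) = (\<integral>\<^sup>+ \<theta>. ennreal (V \<theta> \<zeta>) * indicator {0..1} \<theta> \<partial>lborel)"
        by (rule nn_integral_has_integral_lebesgue'[symmetric])
          (use nn z in \<open>auto intro!: integrable_integral integrable_continuous_real Vc\<close>)
      also have "\<dots> \<le> (\<integral>\<^sup>+ \<theta>. ennreal C * indicator {0..1::real} \<theta> \<partial>lborel)"
      proof -
        have "AE \<theta> in lborel. ennreal (V \<theta> \<zeta>) * indicator {0..1} \<theta> \<le> ennreal C * indicator {0..1} \<theta>"
          using elim(1) by eventually_elim (auto simp: g[OF z] intro!: ennreal_leI split: split_indicator)
        then show ?thesis by (rule nn_integral_mono_AE)
      qed
      also have "\<dots> = ennreal C" by (simp add: nn_integral_cmult)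
      finally have "integral {0..1} (\<lambda>\<theta>. V \<theta> \<zeta>) \<le> C" using C by simp
      then show ?case using \<phi>[OF z] by simp
    qed
    then show ?thesis using True by (simp add: mean_le_def)
  next
    case False
    define P where "P = enn2real p"
    have P: "1 \<le> P" unfolding P_def by (rule enn2real_ge_one[OF p False])
    have "(\<integral>\<^sup>+ \<zeta>. ennreal (\<phi> \<zeta> powr P) \<partial>sphere_measure)
      \<le> (\<integral>\<^sup>+ \<zeta>. (\<integral>\<^sup>+ \<theta>. ennreal (g (\<theta>, \<zeta>) powr P) \<partial>lborel) \<partial>sphere_measure)"
    proof (rule nn_integral_mono)
      fix \<zeta> :: "complex ^ 'n" assume "\<zeta> \<in> space sphere_measure"
      then have z: "\<zeta> \<in> sphere 0 1" by simp
      have cont: "continuous_on {0..1} (\<lambda>\<theta>. V \<theta> \<zeta> powr P)"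
        by (rule continuous_on_powr') (use Vc[OF z] nn[OF _ z] P in \<open>auto intro: continuous_intros\<close>)
      have "\<phi> \<zeta> powr P \<le> integral {0..1} (\<lambda>\<theta>. V \<theta> \<zeta>) powr P"
        using \<phi>[OF z] P by (intro powr_mono2) auto
      also have "\<dots> \<le> integral {0..1} (\<lambda>\<theta>. V \<theta> \<zeta> powr P)"
        by (rule integral_powr_le[OF Vc[OF z] nn[OF _ z] P])
      finally have "ennreal (\<phi> \<zeta> powr P) \<le> ennreal (integral {0..1} (\<lambda>\<theta>. V \<theta> \<zeta> powr P))" by (rule ennreal_leI)
      also have "\<dots> = (\<integral>\<^sup>+ \<theta>. ennreal (V \<theta> \<zeta> powr P) * indicator {0..1} \<theta> \<partial>lborel)"
        by (rule nn_integral_has_integral_lebesgue'[symmetric])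
          (auto intro!: integrable_integral integrable_continuous_real cont)
      also have "\<dots> = (\<integral>\<^sup>+ \<theta>. ennreal (g (\<theta>, \<zeta>) powr P) \<partial>lborel)"
        using P by (intro nn_integral_cong) (auto simp: g[OF z] split: split_indicator)
      finally show "ennreal (\<phi> \<zeta> powr P) \<le> (\<integral>\<^sup>+ \<theta>. ennreal (g (\<theta>, \<zeta>) powr P) \<partial>lborel)" .
    qed
    also have "\<dots> = (\<integral>\<^sup>+ \<theta>. (\<integral>\<^sup>+ \<zeta>. ennreal (g (\<theta>, \<zeta>) powr P) \<partial>sphere_measure) \<partial>lborel)"
      by (rule L.Fubini') measurable
    also have "\<dots> \<le> (\<integral>\<^sup>+ \<theta>. ennreal (C powr P) * indicator {0..1::real} \<theta> \<partial>lborel)"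
    proof (rule nn_integral_mono)
      fix \<theta> :: real
      show "(\<integral>\<^sup>+ \<zeta>. ennreal (g (\<theta>, \<zeta>) powr P) \<partial>sphere_measure) \<le> ennreal (C powr P) * indicator {0..1} \<theta>"
      proof (cases "\<theta> \<in> {0..1}")
        case True
        have "(\<integral>\<^sup>+ \<zeta>. ennreal (g (\<theta>, \<zeta>) powr P) \<partial>sphere_measure) = (\<integral>\<^sup>+ \<zeta>. ennreal (V \<theta> \<zeta> powr P) \<partial>sphere_measure)"
          using True by (intro nn_integral_cong) (simp add: g)
        then show ?thesis using V[OF True] True False by (simp add: mean_le_def P_def)
      next
        case outside: False
        then have "g (\<theta>, \<zeta>) = 0" for \<zeta> by (auto simp: g_def split: split_indicator)
        then show ?thesis by simp
      qed
    qed
    also have "\<dots> = ennreal (C powr P)" by (simp add: nn_integral_cmult)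
    finally show ?thesis using False by (simp add: mean_le_def P_def)
  qed
qed

lemma epowr_le_iff:
  assumes "0 < a" "0 \<le> c"
  shows "epowr x a \<le> ennreal c \<longleftrightarrow> x \<le> ennreal (c powr (1 / a))"
proof (cases "x = top")
  case False
  then obtain y where y: "x = ennreal y" "0 \<le> y" by (cases x) auto
  have "y powr a \<le> c \<longleftrightarrow> y \<le> c powr (1 / a)"
  proof
    assume "y powr a \<le> c"
    then have "(y powr a) powr (1 / a) \<le> c powr (1 / a)" using assms by (intro powr_mono2) auto
    then show "y \<le> c powr (1 / a)" using assms y by (simp add: powr_powr)
  next
    assume "y \<le> c powr (1 / a)"
    then have "y powr a \<le> (c powr (1 / a)) powr a" using assms y by (intro powr_mono2) auto
    then show "y powr a \<le> c" using assms y by (simp add: powr_powr)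
  qed
  then show ?thesis using y assms by (simp add: epowr_def)
qed (simp add: epowr_def top_unique)

lemma integral_mean_le_iff:
  assumes p: "1 \<le> p" and C: "0 \<le> C"
    and [measurable]: "(\<lambda>\<zeta>. norm (g (r *\<^sub>R \<zeta>))) \<in> borel_measurable sphere_measure"
  shows "integral_mean p r g \<le> ennreal C \<longleftrightarrow> mean_le p (\<lambda>\<zeta>. norm (g (r *\<^sub>R \<zeta>))) C"
proof (cases "p = top")
  case True
  let ?h = "\<lambda>\<zeta>. ennreal (norm (g (r *\<^sub>R \<zeta>)))"
  have "esssup sphere_measure ?h \<le> ennreal C \<longleftrightarrow> (AE \<zeta> in sphere_measure. ?h \<zeta> \<le> ennreal C)"
  proof
    assume *: "esssup sphere_measure ?h \<le> ennreal C"
    show "AE \<zeta> in sphere_measure. ?h \<zeta> \<le> ennreal C"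
      using esssup_AE[of ?h sphere_measure] by eventually_elim (use * in auto)
  qed (intro esssup_I; measurable)
  then show ?thesis using True C by (simp add: integral_mean_def mean_le_def)
next
  case False
  have "0 < enn2real p" using enn2real_ge_one[OF p False] by simp
  then show ?thesis using False C by (simp add: integral_mean_def mean_le_def epowr_le_iff)
qed

section \<open>Averages over unitary orbits\<close>

text \<open>Cauchy's formulas for the value and the derivative at the centre of the unit disc.\<close>

lemma circle_average_bounds:
  assumes cont: "continuous_on (cball 0 1) \<psi>" and hol: "\<psi> holomorphic_on ball 0 1"
  shows "cmod (\<psi> 0) \<le> integral {0..1} (\<lambda>\<theta>. cmod (\<psi> (exp (2 * of_real pi * \<i> * of_real \<theta>))))"
    and "cmod (deriv \<psi> 0) \<le> integral {0..1} (\<lambda>\<theta>. cmod (\<psi> (exp (2 * of_real pi * \<i> * of_real \<theta>))))"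
proof -
  let ?e = "\<lambda>\<theta>::real. exp (2 * of_real pi * \<i> * of_real \<theta>)"
  have e: "cmod (?e \<theta>) = 1" for \<theta> by simp
  have cont': "continuous_on {0..1} (\<lambda>\<theta>. \<psi> (?e \<theta>))"
    by (rule continuous_on_compose2[OF cont]) (auto intro!: continuous_intros simp: e)
  have *: "cmod ((deriv ^^ k) \<psi> 0) / fact k \<le> integral {0..1} (\<lambda>\<theta>. cmod (\<psi> (?e \<theta>)))" for k
  proof -
    have "((\<lambda>u. \<psi> u / (u - 0) ^ Suc k) has_contour_integral (2 * pi * \<i> / fact k * (deriv ^^ k) \<psi> 0)) (circlepath 0 1)"
      by (rule Cauchy_has_contour_integral_higher_derivative_circlepath[OF cont hol]) simp
    then have "((\<lambda>\<theta>. \<psi> (?e \<theta>) / ?e \<theta> ^ Suc k * (2 * pi * \<i> * ?e \<theta>)) has_integral (2 * pi * \<i> / fact k * (deriv ^^ k) \<psi> 0)) {0..1}"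
      by (simp only: has_contour_integral vector_derivative_circlepath) (simp add: circlepath)
    then have I: "((\<lambda>\<theta>. 2 * pi * \<i> * (\<psi> (?e \<theta>) / ?e \<theta> ^ k)) has_integral (2 * pi * \<i> / fact k * (deriv ^^ k) \<psi> 0)) {0..1}"
      by (rule has_integral_eq[rotated]) (simp add: field_simps)
    have "cmod (2 * pi * \<i> / fact k * (deriv ^^ k) \<psi> 0) \<le> integral {0..1} (\<lambda>\<theta>. 2 * pi * cmod (\<psi> (?e \<theta>)))"
      unfolding integral_unique[OF I, symmetric]
    proof (rule integral_norm_bound_integral)
      show "(\<lambda>\<theta>. 2 * pi * cmod (\<psi> (?e \<theta>))) integrable_on {0..1}"
        by (intro integrable_continuous_real continuous_intros cont')
    qed (use I in \<open>auto simp: norm_mult norm_divide norm_power\<close>)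
    then have "2 * pi * (cmod ((deriv ^^ k) \<psi> 0) / fact k) \<le> 2 * pi * integral {0..1} (\<lambda>\<theta>. cmod (\<psi> (?e \<theta>)))"
      by (simp add: norm_mult norm_divide)
    then show ?thesis by (rule mult_left_le_imp_le) simp
  qed
  show "cmod (\<psi> 0) \<le> integral {0..1} (\<lambda>\<theta>. cmod (\<psi> (?e \<theta>)))" using *[of 0] by simp
  show "cmod (deriv \<psi> 0) \<le> integral {0..1} (\<lambda>\<theta>. cmod (\<psi> (?e \<theta>)))" using *[of 1] by simp
qed

definition disc_moebius :: "real \<Rightarrow> complex \<Rightarrow> complex" where
  "disc_moebius a \<tau> = (of_real a + \<tau>) / (1 + of_real a * \<tau>)"

lemma moebius_denominator:
  assumes "0 \<le> a" "a < 1" "cmod \<tau> \<le> 1"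
  shows "1 + of_real a * \<tau> \<noteq> 0"
proof
  assume "1 + of_real a * \<tau> = 0"
  then have "of_real a * \<tau> = -1" by (simp add: add_eq_0_iff)
  then have "cmod (of_real a * \<tau>) = 1" by simp
  moreover have "cmod (of_real a * \<tau>) \<le> a * 1"
    using assms by (simp add: norm_mult mult_left_le)
  ultimately show False using assms by simp
qed

lemma norm_moebius:
  assumes "0 \<le> a" "a < 1" "cmod \<tau> \<le> 1"
  shows "cmod (disc_moebius a \<tau>) \<le> 1" and "cmod \<tau> = 1 \<Longrightarrow> cmod (disc_moebius a \<tau>) = 1"
proof -
  have *: "(cmod (1 + of_real a * \<tau>))\<^sup>2 - (cmod (of_real a + \<tau>))\<^sup>2 = (1 - a\<^sup>2) * (1 - (cmod \<tau>)\<^sup>2)"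
    unfolding cmod_power2 by (simp add: power2_eq_square algebra_simps)
  have "0 \<le> (1 - a\<^sup>2) * (1 - (cmod \<tau>)\<^sup>2)"
    using assms by (intro mult_nonneg_nonneg) (auto simp: power_le_one)
  then have "(cmod (of_real a + \<tau>))\<^sup>2 \<le> (cmod (1 + of_real a * \<tau>))\<^sup>2" using * by linarith
  then have "cmod (of_real a + \<tau>) \<le> cmod (1 + of_real a * \<tau>)" by (rule power2_le_imp_le) simp
  then show "cmod (disc_moebius a \<tau>) \<le> 1"
    using moebius_denominator[OF assms] by (simp add: disc_moebius_def norm_divide divide_le_eq)
  assume "cmod \<tau> = 1"
  then have "cmod (of_real a + \<tau>) = cmod (1 + of_real a * \<tau>)" using * by (simp add: power2_eq_iff_nonneg)
  then show "cmod (disc_moebius a \<tau>) = 1"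
    using moebius_denominator[OF assms] by (simp add: disc_moebius_def norm_divide)
qed

lemma moebius_derivative:
  assumes "0 \<le> a" "a < 1" "cmod \<tau> \<le> 1"
  shows "(disc_moebius a has_field_derivative (1 - of_real a ^ 2) / (1 + of_real a * \<tau>) ^ 2) (at \<tau>)"
  unfolding disc_moebius_def
  using moebius_denominator[OF assms]
  by (auto intro!: derivative_eq_intros simp: field_simps power2_eq_square)

lemma moebius_continuous:
  assumes "0 \<le> a" "a < 1" "continuous_on S g" "\<And>x. x \<in> S \<Longrightarrow> cmod (g x) \<le> 1"
  shows "continuous_on S (\<lambda>x. disc_moebius a (g x))"
  unfolding disc_moebius_def
  by (intro continuous_intros assms(3)) (use moebius_denominator assms in auto)

definition unitary_involution :: "(complex ^ 'n::finite \<Rightarrow> complex ^ 'n) \<Rightarrow> bool" where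
  "unitary_involution J \<longleftrightarrow> (\<forall>x y. J (x + y) = J x + J y) \<and> (\<forall>c x. J (c *s x) = c *s J x) \<and>
     (\<forall>x. norm (J x) = norm x) \<and> (\<forall>x. J (J x) = x)"

text \<open>On the eigenspaces of the involution \<open>J\<close> for the eigenvalues \<open>1\<close> and \<open>-1\<close> this is multiplication by
  \<open>disc_moebius a \<tau>\<close> and by \<open>disc_moebius a (- \<tau>)\<close>; in other words it is the automorphism \<open>disc_moebius a\<close> of the
  disc applied to the operator \<open>\<tau> J\<close>, which is unitary for \<open>\<tau>\<close> on the unit circle.\<close>

definition spin :: "(complex ^ 'n::finite \<Rightarrow> complex ^ 'n) \<Rightarrow> real \<Rightarrow> complex \<Rightarrow> complex ^ 'n \<Rightarrow> complex ^ 'n" where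
  "spin J a \<tau> \<zeta> = ((disc_moebius a \<tau> + disc_moebius a (- \<tau>)) / 2) *s \<zeta> + ((disc_moebius a \<tau> - disc_moebius a (- \<tau>)) / 2) *s J \<zeta>"

lemma unitary_involution_linear:
  assumes "unitary_involution J"
  shows "linear J"
proof (rule linearI)
  show "J (x + y) = J x + J y" for x y using assms by (simp add: unitary_involution_def)
  have "r *\<^sub>R x = complex_of_real r *s x" for r and x :: "complex ^ 'a"
    by (simp add: vec_eq_iff scaleR_conv_of_real[where 'a=complex])
  then show "J (r *\<^sub>R x) = r *\<^sub>R J x" for r x using assms by (simp add: unitary_involution_def)
qed

text \<open>The two eigenparts of \<open>\<zeta>\<close> are orthogonal, together with all their complex multiples, because \<open>J\<close>
  preserves inner products and changes the sign of one of them.\<close>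

lemma norm_spin:
  assumes J: "unitary_involution J"
  shows "(norm (spin J a \<tau> \<zeta>))\<^sup>2 = (cmod (disc_moebius a \<tau>))\<^sup>2 * (norm ((1/2) *s (\<zeta> + J \<zeta>)))\<^sup>2
     + (cmod (disc_moebius a (- \<tau>)))\<^sup>2 * (norm ((1/2) *s (\<zeta> - J \<zeta>)))\<^sup>2"
proof -
  have orth: "orthogonal_transformation J"
    using J unitary_involution_linear[OF J] by (auto simp: orthogonal_transformation unitary_involution_def)
  define x where "x = disc_moebius a \<tau> *s ((1/2) *s (\<zeta> + J \<zeta>))"
  define y where "y = disc_moebius a (- \<tau>) *s ((1/2) *s (\<zeta> - J \<zeta>))"
  have diff: "J (x - y) = J x - J y" for x y
    by (rule linear_diff[OF unitary_involution_linear[OF J]])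
  have "J x = x"
    using J by (simp add: x_def unitary_involution_def add.commute)
  moreover have "J y = - y"
    using J by (simp add: y_def unitary_involution_def diff vec_eq_iff algebra_simps)
  moreover have "inner (J x) (J y) = inner x y"
    using orth by (simp add: orthogonal_transformation_def)
  ultimately have "inner x y = 0" by simp
  moreover have "spin J a \<tau> \<zeta> = x + y"
    by (simp add: spin_def x_def y_def vec_eq_iff field_simps)
  ultimately have "(norm (spin J a \<tau> \<zeta>))\<^sup>2 = (norm x)\<^sup>2 + (norm y)\<^sup>2"
    by (simp add: power2_norm_eq_inner inner_add_left inner_add_right inner_commute)
  then show ?thesis by (simp only: x_def y_def norm_vector_smult power_mult_distrib)
qed

lemma norm_eigenparts:
  assumes J: "unitary_involution J"
  shows "(norm \<zeta>)\<^sup>2 = (norm ((1/2) *s (\<zeta> + J \<zeta>)))\<^sup>2 + (norm ((1/2) *s (\<zeta> - J \<zeta>)))\<^sup>2"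
proof -
  have "spin J 0 1 \<zeta> = J \<zeta>" by (simp add: spin_def disc_moebius_def vec_eq_iff)
  then show ?thesis
    using norm_spin[OF J, of 0 1 \<zeta>] J by (simp add: disc_moebius_def unitary_involution_def)
qed

lemma norm_spin_le:
  assumes J: "unitary_involution J" and "0 \<le> a" "a < 1" "cmod \<tau> \<le> 1"
  shows "norm (spin J a \<tau> \<zeta>) \<le> norm \<zeta>"
proof (rule power2_le_imp_le)
  have m: "(cmod (disc_moebius a \<tau>))\<^sup>2 \<le> 1" "(cmod (disc_moebius a (- \<tau>)))\<^sup>2 \<le> 1"
    using norm_moebius(1)[of a] assms by (auto simp: power_le_one)
  show "(norm (spin J a \<tau> \<zeta>))\<^sup>2 \<le> (norm \<zeta>)\<^sup>2"
    unfolding norm_spin[OF J] norm_eigenparts[OF J, of \<zeta>]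
    using m by (intro add_mono mult_left_le_one_le) auto
qed simp

lemma spin_orthogonal:
  assumes J: "unitary_involution J" and "0 \<le> a" "a < 1" "cmod \<tau> = 1"
  shows "orthogonal_transformation (spin J a \<tau>)"
  unfolding orthogonal_transformation
proof (intro conjI allI)
  have lin: "linear J" by (rule unitary_involution_linear[OF J])
  show "linear (spin J a \<tau>)"
    by (rule linearI) (simp_all add: spin_def linear_add[OF lin] linear_cmul[OF lin] vec_eq_iff field_simps scaleR_conv_of_real[where 'a=complex])
  fix \<zeta>
  have "(norm (spin J a \<tau> \<zeta>))\<^sup>2 = (norm \<zeta>)\<^sup>2"
    unfolding norm_spin[OF J] norm_eigenparts[OF J, of \<zeta>]
    using norm_moebius(2)[of a \<tau>] norm_moebius(2)[of a "- \<tau>"] assms by simp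
  then show "norm (spin J a \<tau> \<zeta>) = norm \<zeta>" by (simp add: power2_eq_iff_nonneg)
qed

text \<open>The curve \<open>\<tau> \<mapsto> R \<cdot> spin J (r/R) \<tau> \<zeta>\<close> passes through \<open>r \<zeta>\<close> in the direction of \<open>J \<zeta>\<close> at \<open>\<tau> = 0\<close>, and it runs
  on the sphere of radius \<open>R\<close> for \<open>\<tau>\<close> on the unit circle. So the one-variable Cauchy formulas bound the value
  and the derivative in the direction \<open>J \<zeta>\<close> at \<open>r \<zeta>\<close> by an average over unitary images of \<open>R \<zeta>\<close>.\<close>

lemma spin_average_bounds:
  fixes u :: "complex ^ 'n::finite \<Rightarrow> complex"
  assumes u: "holomorphic_in u (ball 0 1)" and J: "unitary_involution J"
    and r: "0 \<le> r" "r < R" "R < 1" and \<zeta>: "norm \<zeta> = 1"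
  defines "A \<equiv> integral {0..1} (\<lambda>\<theta>. cmod (u (R *\<^sub>R spin J (r/R) (exp (2 * of_real pi * \<i> * of_real \<theta>)) \<zeta>)))"
  shows "cmod (u (r *\<^sub>R \<zeta>)) \<le> A"
    and "(R - r) * cmod (\<Sum>j\<in>UNIV. J \<zeta> $ j * partial_deriv j u (r *\<^sub>R \<zeta>)) \<le> A"
proof -
  define a where "a = r / R"
  have a: "0 \<le> a" "a < 1" and R: "0 < R" using r by (auto simp: a_def)
  have aR: "R * a = r" using R by (simp add: a_def)
  define \<gamma> where "\<gamma> = (\<lambda>\<tau>. R *\<^sub>R spin J a \<tau> \<zeta>)"
  define \<psi> where "\<psi> = (\<lambda>\<tau>. u (\<gamma> \<tau>))"
  define m' :: "complex \<Rightarrow> complex" where "m' = (\<lambda>\<tau>. (1 - of_real a ^ 2) / (1 + of_real a * \<tau>) ^ 2)"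
  define d where "d = (\<lambda>\<tau>. of_real R *s (((m' \<tau> - m' (- \<tau>)) / 2) *s \<zeta> + ((m' \<tau> + m' (- \<tau>)) / 2) *s J \<zeta>))"
  have mem: "\<gamma> \<tau> \<in> ball 0 1" if "cmod \<tau> \<le> 1" for \<tau>
  proof -
    have "R * norm (spin J a \<tau> \<zeta>) \<le> R * 1"
      using norm_spin_le[OF J a that, of \<zeta>] R \<zeta> by (intro mult_left_mono) auto
    also have "\<dots> < 1" using r by simp
    finally show ?thesis using R by (simp add: \<gamma>_def)
  qed
  have der: "(\<psi> has_field_derivative (\<Sum>j\<in>UNIV. d \<tau> $ j * partial_deriv j u (\<gamma> \<tau>))) (at \<tau>)" if "cmod \<tau> \<le> 1" for \<tau>
    unfolding \<psi>_def
  proof (rule holomorphic_in_curve[where \<gamma>=\<gamma> and U="ball 0 1"])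
    show "holomorphic_in u (ball 0 1)" "\<gamma> \<tau> \<in> ball 0 1" by (rule u, rule mem[OF that])
    fix j
    have m1: "(disc_moebius a has_field_derivative m' \<tau>) (at \<tau>)"
      unfolding m'_def by (rule moebius_derivative[OF a that])
    have "(disc_moebius a has_field_derivative m' (- \<tau>)) (at (- \<tau>))"
      unfolding m'_def by (rule moebius_derivative[OF a]) (use that in simp)
    then have m2: "((\<lambda>\<tau>. disc_moebius a (- \<tau>)) has_field_derivative m' (- \<tau>) * (- 1)) (at \<tau>)"
      by (rule DERIV_chain2) (auto intro!: derivative_eq_intros)
    show "((\<lambda>t. \<gamma> t $ j) has_field_derivative d \<tau> $ j) (at \<tau>)"
      unfolding \<gamma>_def d_def spin_def
      by (auto intro!: derivative_eq_intros m1 m2 simp: scaleR_conv_of_real[where 'a=complex] algebra_simps diff_divide_distrib add_divide_distrib)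
  qed
  have hol: "\<psi> holomorphic_on ball 0 1"
    unfolding holomorphic_on_open[OF open_ball] using der by (metis dist_0_norm less_imp_le mem_ball)
  have cont: "continuous_on (cball 0 1) \<psi>"
    by (intro continuous_at_imp_continuous_on ballI DERIV_isCont[OF der]) simp
  have g0: "\<gamma> 0 = r *\<^sub>R \<zeta>"
    by (simp add: \<gamma>_def spin_def disc_moebius_def vec_eq_iff scaleR_conv_of_real[where 'a=complex] aR[symmetric])
  have A: "A = integral {0..1} (\<lambda>\<theta>. cmod (\<psi> (exp (2 * of_real pi * \<i> * of_real \<theta>))))"
    by (simp add: A_def \<psi>_def \<gamma>_def a_def)
  show "cmod (u (r *\<^sub>R \<zeta>)) \<le> A"
    using circle_average_bounds(1)[OF cont hol] by (simp add: A) (simp add: \<psi>_def g0)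
  have "d 0 = of_real (R * (1 - a\<^sup>2)) *s J \<zeta>"
    by (simp add: d_def m'_def vec_eq_iff)
  then have "deriv \<psi> 0 = of_real (R * (1 - a\<^sup>2)) * (\<Sum>j\<in>UNIV. J \<zeta> $ j * partial_deriv j u (r *\<^sub>R \<zeta>))"
    using DERIV_imp_deriv[OF der[of 0]] by (simp add: g0 sum_distrib_left mult_ac)
  then have "cmod (deriv \<psi> 0) = \<bar>R * (1 - a\<^sup>2)\<bar> * cmod (\<Sum>j\<in>UNIV. J \<zeta> $ j * partial_deriv j u (r *\<^sub>R \<zeta>))"
    by (simp only: norm_mult norm_of_real)
  then have dA: "\<bar>R * (1 - a\<^sup>2)\<bar> * cmod (\<Sum>j\<in>UNIV. J \<zeta> $ j * partial_deriv j u (r *\<^sub>R \<zeta>)) \<le> A"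
    using circle_average_bounds(2)[OF cont hol] by (simp add: A)
  have "R - r = R * (1 - a)" using aR by (simp add: algebra_simps)
  also have "\<dots> \<le> R * (1 - a\<^sup>2)"
    using a R by (intro mult_left_mono) (auto simp: power2_eq_square mult_left_le)
  also have "\<dots> \<le> \<bar>R * (1 - a\<^sup>2)\<bar>" by simp
  finally show "(R - r) * cmod (\<Sum>j\<in>UNIV. J \<zeta> $ j * partial_deriv j u (r *\<^sub>R \<zeta>)) \<le> A"
    using dA by (meson mult_right_mono norm_ge_zero order_trans)
qed

lemma borel_measurable_sphere_continuous:
  fixes \<phi> :: "complex ^ 'n::finite \<Rightarrow> real"
  assumes "continuous_on (sphere 0 1) \<phi>"
  shows "\<phi> \<in> borel_measurable sphere_measure"
  using borel_measurable_continuous_on_restrict[OF assms]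
  by (simp only: measurable_cong_sets[OF sphere_measure_sets refl])

lemma continuous_on_dilation:
  assumes "continuous_on (ball 0 1) g" "0 \<le> r" "r < 1"
  shows "continuous_on (sphere 0 1) (\<lambda>\<zeta> :: 'a::real_normed_vector. g (r *\<^sub>R \<zeta>))"
  by (rule continuous_on_compose2[OF assms(1)]) (use assms in \<open>auto intro!: continuous_intros\<close>)

lemma mean_le_spin_average:
  fixes G :: "complex ^ 'n::finite \<Rightarrow> real"
  assumes p: "1 \<le> p" and C: "0 \<le> C" and J: "unitary_involution J"
    and r: "0 \<le> r" "r < R" "R < 1"
    and G: "continuous_on (ball 0 1) G" "\<And>z. z \<in> ball 0 1 \<Longrightarrow> 0 \<le> G z"
    and le: "mean_le p (\<lambda>\<zeta>. G (R *\<^sub>R \<zeta>)) C"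
    and \<phi>: "\<And>\<zeta>. \<zeta> \<in> sphere 0 1 \<Longrightarrow> 0 \<le> \<phi> \<zeta> \<and>
       \<phi> \<zeta> \<le> integral {0..1} (\<lambda>\<theta>. G (R *\<^sub>R spin J (r/R) (exp (2 * of_real pi * \<i> * of_real \<theta>)) \<zeta>))"
  shows "mean_le p \<phi> C"
proof (rule mean_le_average[OF p C _ _ \<phi>])
  let ?e = "\<lambda>\<theta>::real. exp (2 * of_real pi * \<i> * of_real \<theta>)"
  have a: "0 \<le> r / R" "r / R < 1" using r by auto
  have T: "orthogonal_transformation (spin J (r/R) (?e \<theta>))" for \<theta>
    by (rule spin_orthogonal[OF J a]) simp
  have mem: "R *\<^sub>R spin J (r/R) (?e \<theta>) \<zeta> \<in> ball 0 1" if "\<zeta> \<in> sphere 0 1" for \<theta> \<zeta>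
    using orthogonal_transformation_norm[OF T, of \<theta> \<zeta>] that r by simp
  show "0 \<le> G (R *\<^sub>R spin J (r/R) (?e \<theta>) \<zeta>)" if "\<zeta> \<in> sphere 0 1" for \<theta> \<zeta>
    by (rule G(2)[OF mem[OF that]])
  show "continuous_on ({0..1} \<times> sphere 0 1) (\<lambda>(\<theta>, \<zeta>). G (R *\<^sub>R spin J (r/R) (?e \<theta>) \<zeta>))"
    unfolding case_prod_unfold
  proof (rule continuous_on_compose2[OF G(1)])
    have e: "continuous_on ({0..1} \<times> sphere 0 1) (\<lambda>x. ?e (fst x))" "continuous_on ({0..1} \<times> sphere 0 1) (\<lambda>x. - ?e (fst x))"
      by (intro continuous_intros)+
    have s: "continuous_on ({0..1} \<times> sphere 0 1) (\<lambda>x. f x *s g x)"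
      if "continuous_on ({0..1} \<times> sphere 0 1) f" "continuous_on ({0..1} \<times> sphere 0 1) g"
      for f and g :: "real \<times> (complex ^ 'n) \<Rightarrow> complex ^ 'n"
      using that by (auto simp: vector_scalar_mult_def intro!: continuous_intros)
    have "continuous_on UNIV J"
      by (intro linear_continuous_on linear_conv_bounded_linear[THEN iffD1] unitary_involution_linear J)
    then have "continuous_on ({0..1} \<times> sphere 0 1) (\<lambda>x. J (snd x))"
      by (rule continuous_on_compose2) (auto intro!: continuous_intros)
    then show "continuous_on ({0..1} \<times> sphere 0 1) (\<lambda>x. R *\<^sub>R spin J (r/R) (?e (fst x)) (snd x))"
      unfolding spin_def
      by (intro continuous_intros s moebius_continuous[OF a] e) auto
  qed (use mem in auto)
  show "mean_le p (\<lambda>\<zeta>. G (R *\<^sub>R spin J (r/R) (?e \<theta>) \<zeta>)) C" for \<theta>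
    by (rule mean_le_orthogonal[OF T le])
      (intro borel_measurable_sphere_continuous continuous_on_dilation G; use r in simp)
qed

section \<open>Means of holomorphic functions and of their derivatives\<close>

lemma unitary_involution_id: "unitary_involution (\<lambda>z. z)"
  by (simp add: unitary_involution_def)

definition coordinate_reflection :: "'n \<Rightarrow> complex ^ 'n::finite \<Rightarrow> complex ^ 'n" where
  "coordinate_reflection j z = (\<chi> k. if k = j then - z $ j else z $ k)"

definition coordinate_swap :: "'n \<Rightarrow> 'n \<Rightarrow> complex \<Rightarrow> complex ^ 'n::finite \<Rightarrow> complex ^ 'n" where
  "coordinate_swap i j \<omega> z = (\<chi> k. if k = j then \<omega> * z $ i else if k = i then cnj \<omega> * z $ j else z $ k)"

lemma norm_vec_cong_square:
  fixes x y :: "complex ^ 'n::finite"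
  assumes "(\<Sum>k\<in>UNIV. (cmod (x $ k))\<^sup>2) = (\<Sum>k\<in>UNIV. (cmod (y $ k))\<^sup>2)"
  shows "norm x = norm y"
  using assms by (simp add: norm_vec_def L2_set_def)

lemma unitary_involution_reflection: "unitary_involution (coordinate_reflection (j :: 'n::finite))"
  unfolding unitary_involution_def
proof (intro conjI allI)
  fix x :: "complex ^ 'n"
  show "norm (coordinate_reflection j x) = norm x"
    by (rule norm_vec_cong_square, rule sum.cong) (auto simp: coordinate_reflection_def)
qed (auto simp: coordinate_reflection_def vec_eq_iff algebra_simps)

lemma sum_UNIV_split2:
  assumes "i \<noteq> (j :: 'n::finite)"
  shows "(\<Sum>k\<in>UNIV. f k) = f i + f j + (\<Sum>k\<in>UNIV - {i, j}. f k :: 'b::comm_monoid_add)"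
proof -
  have "(\<Sum>k\<in>UNIV. f k) = (\<Sum>k\<in>{i, j}. f k) + (\<Sum>k\<in>UNIV - {i, j}. f k)"
    using sum.union_disjoint[of "{i, j}" "UNIV - {i, j}" f] by (simp add: Un_absorb1)
  then show ?thesis using assms by (simp add: add.assoc)
qed

lemma unitary_involution_swap:
  assumes "i \<noteq> (j :: 'n::finite)" "cmod \<omega> = 1"
  shows "unitary_involution (coordinate_swap i j \<omega>)"
  unfolding unitary_involution_def
proof (intro conjI allI)
  have \<omega>: "\<omega> * cnj \<omega> = 1" "cnj \<omega> * \<omega> = 1"
    using assms(2) complex_norm_square[of \<omega>] by (simp_all add: mult.commute)
  fix x :: "complex ^ 'n"
  show "norm (coordinate_swap i j \<omega> x) = norm x"
    by (rule norm_vec_cong_square)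
      (use assms in \<open>simp add: sum_UNIV_split2[OF assms(1)] coordinate_swap_def norm_mult add.commute\<close>)
  show "coordinate_swap i j \<omega> (coordinate_swap i j \<omega> x) = x"
    using assms(1) \<omega> by (auto simp: coordinate_swap_def vec_eq_iff simp flip: mult.assoc)
qed (auto simp: coordinate_swap_def vec_eq_iff algebra_simps)

text \<open>The operators \<open>z\<^sub>i \<partial>\<^sub>j\<close> are combinations of four derivatives in the directions \<open>J z\<close>: for \<open>i \<noteq> j\<close>
  this is Fourier inversion over the fourth roots of unity \<open>\<omega>\<close> in \<open>coordinate_swap i j \<omega>\<close>. To have the same
  index set for \<open>i = j\<close>, the reflection occurs three times there.\<close>

definition coordinate_involution :: "'n \<Rightarrow> 'n \<Rightarrow> nat \<Rightarrow> complex ^ 'n::finite \<Rightarrow> complex ^ 'n" where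
  "coordinate_involution i j k =
     (if i \<noteq> j then coordinate_swap i j (\<i> ^ k) else if k = 0 then (\<lambda>z. z) else coordinate_reflection j)"

lemma unitary_coordinate_involution: "unitary_involution (coordinate_involution i j k)"
  by (auto simp: coordinate_involution_def unitary_involution_id unitary_involution_reflection
      norm_power intro!: unitary_involution_swap)

lemma coordinate_derivative_bound:
  fixes D :: "complex ^ 'n::finite"
  shows "cmod (z $ i * D $ j) \<le> (\<Sum>k<4. cmod (\<Sum>l\<in>UNIV. coordinate_involution i j k z $ l * D $ l))"
proof -
  let ?S = "\<lambda>k. \<Sum>l\<in>UNIV. coordinate_involution i j k z $ l * D $ l"
  have four: "(\<Sum>k<4. f k) = f 0 + f 1 + f 2 + f (3::nat)" for f :: "nat \<Rightarrow> real"
    by (simp add: eval_nat_numeral lessThan_Suc add_ac)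
  show ?thesis
  proof (cases "i = j")
    case True
    have "?S 0 - ?S 1 = (\<Sum>l\<in>UNIV. if l = j then 2 * (z $ j * D $ j) else 0)"
      unfolding sum_subtractf[symmetric] using True
      by (intro sum.cong) (auto simp: coordinate_involution_def coordinate_reflection_def)
    then have "2 * (z $ i * D $ j) = ?S 0 - ?S 1" using True by simp
    then have "cmod (2 * (z $ i * D $ j)) \<le> cmod (?S 0) + cmod (?S 1)" by (metis norm_triangle_ineq4)
    then have "2 * cmod (z $ i * D $ j) \<le> cmod (?S 0) + cmod (?S 1)" by (simp add: norm_mult)
    then show ?thesis unfolding four
      using norm_ge_zero[of "?S 2"] norm_ge_zero[of "?S 3"] norm_ge_zero[of "z $ i * D $ j"] by linarith
  next
    case False
    define X where "X = (\<Sum>l\<in>UNIV - {i, j}. z $ l * D $ l)"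
    have S: "?S k = cnj (\<i> ^ k) * (z $ j * D $ i) + \<i> ^ k * (z $ i * D $ j) + X" for k
      using False unfolding sum_UNIV_split2[OF False] X_def
      by (simp add: coordinate_involution_def coordinate_swap_def mult.assoc)
    have "4 * (z $ i * D $ j) = ?S 0 - ?S 2 + (- \<i>) * ?S 1 + \<i> * ?S 3"
      unfolding S by (simp add: power2_eq_square power3_eq_cube algebra_simps)
    then have "cmod (4 * (z $ i * D $ j)) = cmod (?S 0 - ?S 2 + (- \<i>) * ?S 1 + \<i> * ?S 3)" by simp
    also have "\<dots> \<le> cmod (?S 0) + cmod (?S 2) + cmod ((- \<i>) * ?S 1) + cmod (\<i> * ?S 3)"
      by (intro norm_triangle_le add_mono norm_triangle_ineq4 order_refl)
    finally have "4 * cmod (z $ i * D $ j) \<le> cmod (?S 0) + cmod (?S 2) + cmod (?S 1) + cmod (?S 3)"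
      by (simp add: norm_mult)
    then show ?thesis unfolding four using norm_ge_zero[of "z $ i * D $ j"] by linarith
  qed
qed

text \<open>On the unit sphere \<open>\<partial>\<^sub>j = \<Sum>\<^sub>i cnj \<zeta>\<^sub>i (\<zeta>\<^sub>i \<partial>\<^sub>j)\<close>, so there is no loss where \<open>\<zeta>\<^sub>i\<close> is small.\<close>

lemma partial_derivative_pointwise_bound:
  fixes \<zeta> D :: "complex ^ 'n::finite"
  assumes "norm \<zeta> = 1"
  shows "cmod (D $ j) \<le> (\<Sum>(i, k)\<in>UNIV \<times> {..<4}. cmod (\<Sum>l\<in>UNIV. coordinate_involution i j k \<zeta> $ l * D $ l))"
proof -
  have "(\<Sum>i\<in>UNIV. (cmod (\<zeta> $ i))\<^sup>2) = 1"
    using assms by (simp add: norm_vec_def L2_set_def)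
  then have "(\<Sum>i\<in>UNIV. cnj (\<zeta> $ i) * \<zeta> $ i) = 1"
    by (simp add: mult.commute complex_norm_square[symmetric] flip: of_real_sum of_real_power)
  then have "D $ j = (\<Sum>i\<in>UNIV. cnj (\<zeta> $ i) * \<zeta> $ i) * D $ j" by simp
  also have "\<dots> = (\<Sum>i\<in>UNIV. cnj (\<zeta> $ i) * (\<zeta> $ i * D $ j))" by (simp add: sum_distrib_right mult.assoc)
  finally have "cmod (D $ j) \<le> (\<Sum>i\<in>UNIV. cmod (cnj (\<zeta> $ i) * (\<zeta> $ i * D $ j)))"
    by (metis norm_sum)
  also have "\<dots> \<le> (\<Sum>i\<in>UNIV. (\<Sum>k<4. cmod (\<Sum>l\<in>UNIV. coordinate_involution i j k \<zeta> $ l * D $ l)))"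
  proof (rule sum_mono)
    fix i
    have "cmod (\<zeta> $ i) \<le> 1" using Finite_Cartesian_Product.norm_nth_le[of \<zeta> i] assms by simp
    then have "cmod (cnj (\<zeta> $ i) * (\<zeta> $ i * D $ j)) \<le> cmod (\<zeta> $ i * D $ j)"
      unfolding norm_mult[of "cnj (\<zeta> $ i)"] by (intro mult_left_le_one_le) auto
    also note coordinate_derivative_bound
    finally show "cmod (cnj (\<zeta> $ i) * (\<zeta> $ i * D $ j)) \<le> (\<Sum>k<4. cmod (\<Sum>l\<in>UNIV. coordinate_involution i j k \<zeta> $ l * D $ l))" .
  qed
  finally show ?thesis by (simp add: sum.cartesian_product)
qed

text \<open>The functions of interest are continuous on the ball, so their integral means are finite.\<close>

definition lp_mean :: "ennreal \<Rightarrow> (complex ^ 'n::finite \<Rightarrow> 'b::real_normed_vector) \<Rightarrow> real \<Rightarrow> real" where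
  "lp_mean p g r = enn2real (integral_mean p r g)"

lemma lp_mean_nonneg [simp]: "0 \<le> lp_mean p g r"
  by (simp add: lp_mean_def)

context
  fixes p :: ennreal and g :: "complex ^ 'n::finite \<Rightarrow> 'b::real_normed_vector" and r :: real
  assumes p: "1 \<le> p" and g: "continuous_on (ball 0 1) g" and r: "0 \<le> r" "r < 1"
begin

lemma dilation_borel_measurable: "(\<lambda>\<zeta>. norm (g (r *\<^sub>R \<zeta>))) \<in> borel_measurable sphere_measure"
  by (intro borel_measurable_sphere_continuous continuous_on_norm continuous_on_dilation g r)

lemma integral_mean_eq_lp_mean: "integral_mean p r g = ennreal (lp_mean p g r)"
proof -
  have "compact ((\<lambda>\<zeta>. g (r *\<^sub>R \<zeta>)) ` sphere 0 1)"
    by (intro compact_continuous_image continuous_on_dilation g r) auto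
  then obtain B where B: "\<And>\<zeta>. \<zeta> \<in> sphere 0 1 \<Longrightarrow> norm (g (r *\<^sub>R \<zeta>)) \<le> B"
    by (meson bounded_iff compact_imp_bounded image_eqI)
  have "integral_mean p r g \<le> ennreal (max B 0)"
    unfolding integral_mean_le_iff[OF p max.cobounded2 dilation_borel_measurable]
    by (rule mean_le_bounded[OF p]) (use B in \<open>auto intro: max.coboundedI1\<close>)
  then have "integral_mean p r g < top" by (simp add: order_le_less_trans)
  then show ?thesis by (simp add: lp_mean_def)
qed

lemma lp_mean_le_iff:
  assumes "0 \<le> C"
  shows "lp_mean p g r \<le> C \<longleftrightarrow> mean_le p (\<lambda>\<zeta>. norm (g (r *\<^sub>R \<zeta>))) C"
  using integral_mean_le_iff[OF p assms dilation_borel_measurable] assms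
  by (simp add: integral_mean_eq_lp_mean)

lemma mean_le_lp_mean: "mean_le p (\<lambda>\<zeta>. norm (g (r *\<^sub>R \<zeta>))) (lp_mean p g r)"
  using lp_mean_le_iff[of "lp_mean p g r"] by simp

end

lemma lp_mean_sum_le:
  fixes g :: "complex ^ 'n::finite \<Rightarrow> 'b::real_normed_vector" and h :: "'k \<Rightarrow> complex ^ 'n \<Rightarrow> 'c::real_normed_vector"
  assumes p: "1 \<le> p" and g: "continuous_on (ball 0 1) g" and r: "0 \<le> r" "r < 1"
    and h: "\<And>k. k \<in> K \<Longrightarrow> continuous_on (ball 0 1) (h k)" and K: "finite K" and c: "0 \<le> c"
    and le: "\<And>z. z \<in> ball 0 1 \<Longrightarrow> norm (g z) \<le> c * (\<Sum>k\<in>K. norm (h k z))"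
  shows "lp_mean p g r \<le> c * ((real (card K))\<^sup>2 * (\<Sum>k\<in>K. lp_mean p (h k) r))"
proof -
  let ?C = "\<Sum>k\<in>K. lp_mean p (h k) r"
  have C: "0 \<le> ?C" by (simp add: sum_nonneg)
  have m: "(\<lambda>\<zeta>. norm (h k (r *\<^sub>R \<zeta>))) \<in> borel_measurable sphere_measure" if "k \<in> K" for k
    by (rule dilation_borel_measurable[OF p h[OF that] r])
  have "mean_le p (\<lambda>\<zeta>. \<Sum>k\<in>K. norm (h k (r *\<^sub>R \<zeta>))) ((real (card K))\<^sup>2 * ?C)"
  proof (rule mean_le_sum[OF p K C, of "\<lambda>k \<zeta>. norm (h k (r *\<^sub>R \<zeta>))"])
    fix k assume k: "k \<in> K"
    show "mean_le p (\<lambda>\<zeta>. norm (h k (r *\<^sub>R \<zeta>))) ?C"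
      by (rule mean_le_mono[OF p mean_le_lp_mean[OF p h[OF k] r]])
        (use k K in \<open>auto intro!: member_le_sum\<close>)
    show "(\<lambda>\<zeta>. norm (h k (r *\<^sub>R \<zeta>))) \<in> borel_measurable sphere_measure" by (rule m[OF k])
  qed (auto simp: sum_nonneg)
  then have "mean_le p (\<lambda>\<zeta>. c * (\<Sum>k\<in>K. norm (h k (r *\<^sub>R \<zeta>)))) (c * ((real (card K))\<^sup>2 * ?C))"
    by (rule mean_le_cmult[OF p]) (use C c m in \<open>auto simp: sum_nonneg\<close>)
  then have "mean_le p (\<lambda>\<zeta>. norm (g (r *\<^sub>R \<zeta>))) (c * ((real (card K))\<^sup>2 * ?C))"
    by (rule mean_le_mono[OF p]) (use le r c C in auto)
  then show ?thesis
    by (subst lp_mean_le_iff[OF p g r]) (use C c in auto)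
qed

text \<open>Assuming the mean value inequality instead of holomorphy makes this applicable to gradients.\<close>

lemma lp_mean_mono_of_average:
  fixes g :: "complex ^ 'n::finite \<Rightarrow> 'b::real_normed_vector"
  assumes p: "1 \<le> p" and g: "continuous_on (ball 0 1) g" and r: "0 \<le> r" "r < R" "R < 1"
    and avg: "\<And>\<zeta>. norm \<zeta> = 1 \<Longrightarrow> norm (g (r *\<^sub>R \<zeta>))
       \<le> integral {0..1} (\<lambda>\<theta>. norm (g (R *\<^sub>R spin (\<lambda>z. z) (r/R) (exp (2 * of_real pi * \<i> * of_real \<theta>)) \<zeta>)))"
  shows "lp_mean p g r \<le> lp_mean p g R"
proof -
  have "mean_le p (\<lambda>\<zeta>. norm (g (r *\<^sub>R \<zeta>))) (lp_mean p g R)"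
    by (rule mean_le_spin_average[OF p lp_mean_nonneg unitary_involution_id r, of "\<lambda>z. norm (g z)"])
      (use avg r in \<open>auto intro!: continuous_on_norm g mean_le_lp_mean[OF p g]\<close>)
  then show ?thesis
    by (subst lp_mean_le_iff[OF p g]) (use r in auto)
qed

lemma lp_mean_mono:
  fixes u :: "complex ^ 'n::finite \<Rightarrow> complex"
  assumes p: "1 \<le> p" and u: "holomorphic_in u (ball 0 1)" and r: "0 \<le> r" "r \<le> R" "R < 1"
  shows "lp_mean p u r \<le> lp_mean p u R"
proof (cases "r = R")
  case False
  then show ?thesis
    using lp_mean_mono_of_average[OF p holomorphic_in_continuous_on[OF u] r(1) _ r(3)]
      spin_average_bounds(1)[OF u unitary_involution_id r(1) _ r(3)] r(2) by force
qed simp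

text \<open>A Cauchy estimate in the mean: sum the averages that bound the derivatives in the directions \<open>J \<zeta>\<close> over
  the involutions that generate \<open>\<partial>\<^sub>j\<close>.\<close>

lemma lp_mean_partial_deriv:
  fixes u :: "complex ^ 'n::finite \<Rightarrow> complex"
  assumes p: "1 \<le> p" and u: "holomorphic_in u (ball 0 1)" and r: "0 \<le> r" "r < R" "R < 1"
  shows "lp_mean p (partial_deriv j u) r \<le> (real (CARD('n) * 4))\<^sup>2 * (lp_mean p u R / (R - r))"
proof -
  let ?K = "(UNIV :: 'n set) \<times> {..<4::nat}"
  let ?C = "lp_mean p u R / (R - r)"
  have C: "0 \<le> ?C" using r by simp
  note cont = holomorphic_in_continuous_on[OF u]
  note hol = partial_deriv_holomorphic[OF open_ball u]
  note cont' = holomorphic_in_continuous_on[OF hol]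
  have r1: "r < 1" using r by simp
  let ?D = "\<lambda>(i, k) \<zeta>. cmod (\<Sum>l\<in>UNIV. coordinate_involution i j k \<zeta> $ l * partial_deriv l u (r *\<^sub>R \<zeta>))"
  have "mean_le p (\<lambda>\<zeta>. norm (partial_deriv j u (r *\<^sub>R \<zeta>))) ((real (card ?K))\<^sup>2 * ?C)"
  proof (rule mean_le_sum[OF p _ C, of ?K ?D])
    fix x assume "x \<in> ?K"
    obtain i k where x: "x = (i, k)" by (cases x)
    note J = unitary_coordinate_involution[of i j k]
    have Jc: "continuous_on (sphere 0 1) (coordinate_involution i j k)"
      by (intro linear_continuous_on linear_conv_bounded_linear[THEN iffD1] unitary_involution_linear J)
    have "continuous_on (sphere 0 1) (\<lambda>\<zeta>. cmod (\<Sum>l\<in>UNIV. coordinate_involution i j k \<zeta> $ l * partial_deriv l u (r *\<^sub>R \<zeta>)))"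
      by (intro continuous_intros Jc continuous_on_dilation[OF cont' r(1) r1] continuous_on_component)
    then show m: "?D x \<in> borel_measurable sphere_measure"
      unfolding x prod.case by (rule borel_measurable_sphere_continuous)
    have "mean_le p (\<lambda>\<zeta>. (R - r) * ?D x \<zeta>) (lp_mean p u R)"
      by (rule mean_le_spin_average[OF p lp_mean_nonneg J r, of "\<lambda>z. norm (u z)"])
        (use spin_average_bounds(2)[OF u J r] r in
          \<open>auto simp: x intro!: continuous_on_norm cont mean_le_lp_mean[OF p cont]\<close>)
    then have "mean_le p (\<lambda>\<zeta>. 1 / (R - r) * ((R - r) * ?D x \<zeta>)) (1 / (R - r) * lp_mean p u R)"
      by (rule mean_le_cmult[OF p]) (use r m in \<open>auto simp: x\<close>)
    then show "mean_le p (?D x) ?C" using r by simp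
  next
    show "0 \<le> cmod (partial_deriv j u (r *\<^sub>R \<zeta>)) \<and> cmod (partial_deriv j u (r *\<^sub>R \<zeta>)) \<le> (\<Sum>x\<in>?K. ?D x \<zeta>)"
      if "\<zeta> \<in> sphere 0 1" for \<zeta>
      using partial_derivative_pointwise_bound[of \<zeta> "\<chi> l. partial_deriv l u (r *\<^sub>R \<zeta>)" j] that
      by (simp add: case_prod_unfold)
  qed auto
  then have "lp_mean p (partial_deriv j u) r \<le> (real (card ?K))\<^sup>2 * ?C"
    using lp_mean_le_iff[OF p cont' r(1) r1 mult_nonneg_nonneg[OF zero_le_power2 C]] by blast
  then show ?thesis by (simp add: mult.commute)
qed

lemma radial_path_derivative:
  fixes u :: "complex ^ 'n::finite \<Rightarrow> complex"
  assumes u: "holomorphic_in u (ball 0 1)" and z: "t *\<^sub>R z \<in> ball 0 1"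
  shows "((\<lambda>t::real. u (t *\<^sub>R z)) has_vector_derivative (\<Sum>k\<in>UNIV. z $ k * partial_deriv k u (t *\<^sub>R z))) (at t)"
proof -
  have sc: "complex_of_real s *s z = s *\<^sub>R z" for s
    by (simp add: vec_eq_iff scaleR_conv_of_real[where 'a=complex])
  have "((\<lambda>w. u (w *s z)) has_field_derivative (\<Sum>k\<in>UNIV. z $ k * partial_deriv k u (of_real t *s z))) (at (of_real t))"
    by (rule slice_derivative[OF u]) (use z in \<open>simp add: sc\<close>)
  then show ?thesis
    using has_vector_derivative_real_field[of "\<lambda>w. u (w *s z)"] by (simp add: sc)
qed

text \<open>Integration of \<open>d/ds (s\<^sup>c u(s z)) = s\<^sup>c\<^sup>-\<^sup>1 ((\<R> + c) u)(s z)\<close> over \<open>t \<le> s \<le> 1\<close>. The factor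
  \<open>1/t\<close> bounds \<open>s\<^sup>c\<^sup>-\<^sup>1\<close> also for \<open>c = 0\<close>.\<close>

lemma radial_increment_bound:
  fixes u :: "complex ^ 'n::finite \<Rightarrow> complex" and c :: nat
  assumes u: "holomorphic_in u (ball 0 1)" and z: "z \<in> ball 0 1" and t: "0 < t" "t \<le> 1"
  shows "cmod (u z) \<le> cmod (u (t *\<^sub>R z))
     + integral {0..1} (\<lambda>\<theta>. (1 - t) / t * cmod (euler (of_nat c) u ((t + \<theta> * (1 - t)) *\<^sub>R z)))"
proof -
  define v where "v = euler (of_nat c) u"
  define s where "s = (\<lambda>\<theta>. t + \<theta> * (1 - t))"
  define G where "G = (\<lambda>\<sigma>. complex_of_real (\<sigma> ^ c) * u (\<sigma> *\<^sub>R z))"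
  define F where "F = (\<lambda>\<theta>. (1 - t) *\<^sub>R (complex_of_real (s \<theta> ^ c / s \<theta>) * v (s \<theta> *\<^sub>R z)))"
  have hol: "holomorphic_in v (ball 0 1)" unfolding v_def by (rule euler_holomorphic[OF open_ball u])
  have s: "t \<le> s \<theta>" "s \<theta> \<le> 1" if "\<theta> \<in> {0..1}" for \<theta>
    using that t mult_right_mono[of \<theta> 1 "1 - t"] by (auto simp: s_def)
  have mem: "\<sigma> *\<^sub>R z \<in> ball 0 1" if "t \<le> \<sigma>" "\<sigma> \<le> 1" for \<sigma>
    using that z t mult_left_le_one_le[of "norm z" \<sigma>] by simp
  have dG: "(G has_vector_derivative (complex_of_real (\<sigma> ^ c / \<sigma>) * v (\<sigma> *\<^sub>R z))) (at \<sigma>)" if "t \<le> \<sigma>" "\<sigma> \<le> 1" for \<sigma>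
  proof -
    have \<sigma>: "\<sigma> \<noteq> 0" using that t by simp
    have "((\<lambda>\<sigma>. \<sigma> ^ c) has_real_derivative (real c * \<sigma> ^ (c - Suc 0))) (at \<sigma>)" by (rule DERIV_pow)
    also have "real c * \<sigma> ^ (c - Suc 0) = real c * (\<sigma> ^ c / \<sigma>)" using \<sigma> by (cases c) auto
    finally have d: "((\<lambda>\<sigma>. complex_of_real (\<sigma> ^ c)) has_vector_derivative complex_of_real (real c * (\<sigma> ^ c / \<sigma>))) (at \<sigma>)"
      by (intro has_vector_derivative_of_real) (simp add: has_real_derivative_iff_has_vector_derivative)
    have comp: "(\<sigma> *\<^sub>R z) $ k = complex_of_real \<sigma> * z $ k" for k
      by (simp add: scaleR_conv_of_real[where 'a=complex])
    have "complex_of_real (\<sigma> ^ c) * (\<Sum>k\<in>UNIV. z $ k * partial_deriv k u (\<sigma> *\<^sub>R z))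
        + complex_of_real (real c * (\<sigma> ^ c / \<sigma>)) * u (\<sigma> *\<^sub>R z) = complex_of_real (\<sigma> ^ c / \<sigma>) * v (\<sigma> *\<^sub>R z)"
      unfolding v_def euler_def comp using \<sigma> by (simp add: sum_distrib_left sum_divide_distrib field_simps)
    then show ?thesis
      unfolding G_def using has_vector_derivative_mult[OF d radial_path_derivative[OF u mem[OF that]]] by simp
  qed
  have I: "(F has_integral (G (s 1) - G (s 0))) {0..1}"
  proof (rule fundamental_theorem_of_calculus)
    fix \<theta> :: real assume \<theta>: "\<theta> \<in> {0..1}"
    have "(s has_vector_derivative (1 - t)) (at \<theta>)"
      unfolding s_def by (auto intro!: derivative_eq_intros)
    from vector_diff_chain_at[OF this dG[OF s[OF \<theta>]]]
    have "((\<lambda>\<theta>. G (s \<theta>)) has_vector_derivative F \<theta>) (at \<theta>)" by (simp add: F_def o_def)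
    then show "((\<lambda>\<theta>. G (s \<theta>)) has_vector_derivative F \<theta>) (at \<theta> within {0..1})"
      by (rule has_vector_derivative_at_within)
  qed simp
  have cv: "continuous_on {0..1} (\<lambda>\<theta>. cmod (v (s \<theta> *\<^sub>R z)))"
    by (intro continuous_on_norm continuous_on_compose2[OF holomorphic_in_continuous_on[OF hol]])
      (use mem[OF s] in \<open>auto simp: s_def intro!: continuous_intros\<close>)
  have "cmod (G (s 1) - G (s 0)) \<le> integral {0..1} (\<lambda>\<theta>. (1 - t) / t * cmod (v (s \<theta> *\<^sub>R z)))"
    unfolding integral_unique[OF I, symmetric]
  proof (rule integral_norm_bound_integral)
    fix \<theta> :: real assume \<theta>: "\<theta> \<in> {0..1}"
    have "s \<theta> ^ c / s \<theta> \<le> 1 / t" using s[OF \<theta>] t by (intro frac_le power_le_one) auto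
    then have "(1 - t) * (s \<theta> ^ c / s \<theta> * cmod (v (s \<theta> *\<^sub>R z))) \<le> (1 - t) * (1 / t * cmod (v (s \<theta> *\<^sub>R z)))"
      using t by (intro mult_left_mono mult_right_mono) auto
    then show "norm (F \<theta>) \<le> (1 - t) / t * cmod (v (s \<theta> *\<^sub>R z))"
      using s[OF \<theta>] t by (simp add: F_def norm_mult norm_divide norm_power)
  next
    show "(\<lambda>\<theta>. (1 - t) / t * cmod (v (s \<theta> *\<^sub>R z))) integrable_on {0..1}"
      by (intro integrable_continuous_real continuous_on_mult continuous_on_const cv)
  qed (use I in auto)
  moreover have "cmod (G (s 0)) \<le> cmod (u (t *\<^sub>R z))"
    using t by (simp add: G_def s_def norm_mult norm_power power_le_one mult_left_le_one_le)
  moreover have "cmod (u z) \<le> cmod (G (s 0)) + cmod (G (s 1) - G (s 0))"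
    using norm_triangle_ineq[of "G (s 0)" "G (s 1) - G (s 0)"] by (simp add: G_def s_def)
  ultimately show ?thesis by (simp add: v_def s_def)
qed

lemma lp_mean_along_ray:
  fixes u :: "complex ^ 'n::finite \<Rightarrow> complex" and c :: nat
  assumes p: "1 \<le> p" and u: "holomorphic_in u (ball 0 1)" and r: "0 \<le> r" "r < 1" and t: "0 < t" "t \<le> 1"
  shows "lp_mean p u r \<le> 4 * (lp_mean p u (t * r) + (1 - t) / t * lp_mean p (euler (of_nat c) u) r)"
proof -
  define v where "v = euler (of_nat c) u"
  define k where "k = (1 - t) / t"
  define \<rho> where "\<rho> = (\<lambda>\<theta>. (t + \<theta> * (1 - t)) * r)"
  let ?C = "lp_mean p u (t * r) + k * lp_mean p v r"
  have k: "0 \<le> k" using t by (simp add: k_def)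
  then have C: "0 \<le> ?C" by simp
  have hol: "holomorphic_in v (ball 0 1)" unfolding v_def by (rule euler_holomorphic[OF open_ball u])
  note cu = holomorphic_in_continuous_on[OF u] and cv = holomorphic_in_continuous_on[OF hol]
  have \<rho>: "0 \<le> \<rho> \<theta>" "\<rho> \<theta> < 1" "\<rho> \<theta> \<le> r" if "\<theta> \<in> {0..1}" for \<theta>
  proof -
    have "0 \<le> t + \<theta> * (1 - t)" "t + \<theta> * (1 - t) \<le> 1"
      using that t mult_right_mono[of \<theta> 1 "1 - t"] by auto
    then show "0 \<le> \<rho> \<theta>" "\<rho> \<theta> < 1" "\<rho> \<theta> \<le> r"
      using r mult_left_le_one_le[of r "t + \<theta> * (1 - t)"] by (auto simp: \<rho>_def)
  qed
  have tr: "0 \<le> t * r" "t * r < 1" using t r mult_left_le_one_le[of r t] by auto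
  let ?V = "\<lambda>\<theta> \<zeta>. cmod (u ((t * r) *\<^sub>R \<zeta>)) + k * cmod (v (\<rho> \<theta> *\<^sub>R \<zeta>))"
  have "mean_le p (\<lambda>\<zeta>. cmod (u (r *\<^sub>R \<zeta>))) ((real (card (UNIV :: bool set)))\<^sup>2 * ?C)"
  proof (rule mean_le_average[OF p, of _ ?V])
    show "continuous_on ({0..1} \<times> sphere 0 1) (\<lambda>(\<theta>, \<zeta>). ?V \<theta> \<zeta>)"
      unfolding case_prod_unfold
      by (intro continuous_on_add continuous_on_norm continuous_on_mult continuous_on_const
          continuous_on_compose2[OF cu] continuous_on_compose2[OF cv])
        (use \<rho> tr in \<open>auto simp: \<rho>_def intro!: continuous_intros\<close>)
    show "0 \<le> ?V \<theta> \<zeta>" for \<theta> \<zeta> using k by simp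
  next
    fix \<zeta> :: "complex ^ 'n" assume z: "\<zeta> \<in> sphere 0 1"
    have "continuous_on {0..1} (\<lambda>\<theta>. cmod (v (\<rho> \<theta> *\<^sub>R \<zeta>)))"
      by (intro continuous_on_norm continuous_on_compose2[OF cv])
        (use \<rho> z in \<open>auto simp: \<rho>_def intro!: continuous_intros\<close>)
    then have "integral {0..1} (\<lambda>\<theta>. ?V \<theta> \<zeta>)
        = cmod (u ((t * r) *\<^sub>R \<zeta>)) + integral {0..1} (\<lambda>\<theta>. k * cmod (v (\<rho> \<theta> *\<^sub>R \<zeta>)))"
      by (subst integral_add) (auto intro!: integrable_continuous_real continuous_on_mult)
    then show "0 \<le> cmod (u (r *\<^sub>R \<zeta>)) \<and> cmod (u (r *\<^sub>R \<zeta>)) \<le> integral {0..1} (\<lambda>\<theta>. ?V \<theta> \<zeta>)"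
      using radial_increment_bound[OF u _ t, of "r *\<^sub>R \<zeta>" c] z r by (simp add: v_def k_def \<rho>_def)
  next
    fix \<theta> :: real assume \<theta>: "\<theta> \<in> {0..1}"
    let ?h = "\<lambda>b \<zeta>. if b then cmod (u ((t * r) *\<^sub>R \<zeta>)) else k * cmod (v (\<rho> \<theta> *\<^sub>R \<zeta>))"
    note mv = dilation_borel_measurable[OF p cv \<rho>(1,2)[OF \<theta>]] and mu = dilation_borel_measurable[OF p cu tr]
    show "mean_le p (?V \<theta>) ((real (card (UNIV :: bool set)))\<^sup>2 * ?C)"
    proof (rule mean_le_sum[OF p _ C, of _ ?h])
      have "mean_le p (\<lambda>\<zeta>. cmod (u ((t * r) *\<^sub>R \<zeta>))) ?C"
        by (rule mean_le_mono[OF p mean_le_lp_mean[OF p cu tr]]) (use k in auto)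
      moreover have "mean_le p (\<lambda>\<zeta>. k * cmod (v (\<rho> \<theta> *\<^sub>R \<zeta>))) ?C"
      proof (rule mean_le_mono[OF p])
        show "mean_le p (\<lambda>\<zeta>. k * cmod (v (\<rho> \<theta> *\<^sub>R \<zeta>))) (k * lp_mean p v (\<rho> \<theta>))"
          by (rule mean_le_cmult[OF p mean_le_lp_mean[OF p cv \<rho>(1,2)[OF \<theta>]] _ k mv]) auto
        have "k * lp_mean p v (\<rho> \<theta>) \<le> k * lp_mean p v r"
          using \<rho>[OF \<theta>] r k by (intro mult_left_mono lp_mean_mono[OF p hol]) auto
        then show "k * lp_mean p v (\<rho> \<theta>) \<le> ?C" using lp_mean_nonneg[of p u "t * r"] by linarith
      qed (use k in auto)
      ultimately show "mean_le p (?h b) ?C" for b by (cases b) auto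
      show "?h b \<in> borel_measurable sphere_measure" for b
        using mu mv by (cases b) auto
    qed (use k in \<open>auto simp: UNIV_bool\<close>)
  qed (use C in auto)
  then have "lp_mean p u r \<le> (real (card (UNIV :: bool set)))\<^sup>2 * ?C"
    by (subst lp_mean_le_iff[OF p cu r]) (use C in auto)
  then show ?thesis by (simp add: v_def k_def)
qed

section \<open>Weighted norms in the radial variable\<close>

text \<open>Finiteness of the radial part of the mixed norm, with the weight \<open>1 - r\<^sup>2\<close> replaced by the comparable
  \<open>1 - r\<close> and restricted to radii near the boundary, which suffices for increasing means.\<close>

definition weighted_finite :: "ennreal \<Rightarrow> real \<Rightarrow> (real \<Rightarrow> real) \<Rightarrow> bool" where
  "weighted_finite q \<beta> b \<longleftrightarrow>
     (if q = top then \<exists>D. \<forall>r\<in>{1/2<..<1}. b r \<le> D * (1 - r) powr (- \<beta>)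
      else (\<integral>\<^sup>+ r. ennreal (b r powr enn2real q * (1 - r) powr (enn2real q * \<beta> - 1)) * indicator {1/2<..<1} r \<partial>lborel) < top)"

lemma weighted_finite_topI:
  "(\<And>r. r \<in> {1/2<..<1} \<Longrightarrow> b r \<le> D * (1 - r) powr (- \<beta>)) \<Longrightarrow> weighted_finite top \<beta> b"
  unfolding weighted_finite_def if_P[OF refl] by blast

lemma weighted_integrand_measurable:
  assumes "mono_on {0..<1} (b :: real \<Rightarrow> real)" "S \<subseteq> {0..<1}" and [measurable]: "S \<in> sets borel" "w \<in> borel_measurable borel"
  shows "(\<lambda>r. ennreal (b r powr Q * w r) * indicator S r) \<in> borel_measurable borel"
proof -
  have "b \<in> borel_measurable (restrict_space borel {0..<1})"
    using assms(1) by (rule borel_measurable_mono_on_fnc)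
  then have [measurable]: "(\<lambda>r. indicator {0..<1} r *\<^sub>R b r) \<in> borel_measurable borel"
    by (subst (asm) borel_measurable_restrict_space_iff) (auto simp: mult.commute)
  have "(\<lambda>r. ennreal ((indicator {0..<1} r *\<^sub>R b r) powr Q * w r) * indicator S r) \<in> borel_measurable borel"
    by measurable
  moreover have "ennreal ((indicator {0..<1} r *\<^sub>R b r) powr Q * w r) * indicator S r
      = ennreal (b r powr Q * w r) * indicator S r" for r
    using assms(2) by (auto split: split_indicator)
  ultimately show ?thesis by simp
qed

lemma weighted_finite_sum_bound:
  fixes a :: "'k \<Rightarrow> real \<Rightarrow> real"
  assumes q: "1 \<le> q" and K: "finite K" and C: "0 \<le> C"
    and mono: "\<And>k. k \<in> K \<Longrightarrow> mono_on {0..<1} (a k)"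
    and nn: "\<And>k r. k \<in> K \<Longrightarrow> 0 \<le> a k r"
    and fin: "\<And>k. k \<in> K \<Longrightarrow> weighted_finite q \<beta> (a k)"
    and b: "\<And>r. r \<in> {1/2<..<1} \<Longrightarrow> 0 \<le> b r \<and> b r \<le> C * (\<Sum>k\<in>K. a k r)"
  shows "weighted_finite q \<beta> b"
proof (cases "q = top")
  case True
  have "\<forall>k\<in>K. \<exists>D. \<forall>r\<in>{1/2<..<1}. a k r \<le> D * (1 - r) powr (- \<beta>)"
    using fin True by (simp add: weighted_finite_def)
  then obtain D where D: "\<And>k r. k \<in> K \<Longrightarrow> r \<in> {1/2<..<1} \<Longrightarrow> a k r \<le> D k * (1 - r) powr (- \<beta>)"
    by metis
  have "b r \<le> (C * (\<Sum>k\<in>K. D k)) * (1 - r) powr (- \<beta>)" if r: "r \<in> {1/2<..<1}" for r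
  proof -
    have "b r \<le> C * (\<Sum>k\<in>K. a k r)" using b[OF r] by simp
    also have "\<dots> \<le> C * (\<Sum>k\<in>K. D k * (1 - r) powr (- \<beta>))"
      using C D[OF _ r] by (intro mult_left_mono sum_mono) auto
    finally show ?thesis by (simp add: sum_distrib_right mult.assoc)
  qed
  then show ?thesis unfolding True by (rule weighted_finite_topI)
next
  case False
  define Q where "Q = enn2real q"
  have Q: "1 \<le> Q" unfolding Q_def by (rule enn2real_ge_one[OF q False])
  define e where "e = Q * \<beta> - 1"
  define c where "c = C powr Q * real (card K) powr Q"
  let ?F = "\<lambda>k r. ennreal (a k r powr Q * (1 - r) powr e) * indicator {1/2<..<1} r"
  have [measurable]: "?F k \<in> borel_measurable borel" if "k \<in> K" for k
    by (rule weighted_integrand_measurable[OF mono[OF that]]) auto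
  have "(\<integral>\<^sup>+ r. ennreal (b r powr Q * (1 - r) powr e) * indicator {1/2<..<1} r \<partial>lborel)
      \<le> (\<integral>\<^sup>+ r. (\<Sum>k\<in>K. ennreal c * ?F k r) \<partial>lborel)"
  proof (rule nn_integral_mono)
    fix r :: real
    show "ennreal (b r powr Q * (1 - r) powr e) * indicator {1/2<..<1} r \<le> (\<Sum>k\<in>K. ennreal c * ?F k r)"
    proof (cases "r \<in> {1/2<..<1}")
      case r: True
      have "b r powr Q \<le> (C * (\<Sum>k\<in>K. a k r)) powr Q" using b[OF r] Q by (intro powr_mono2) auto
      also have "\<dots> = C powr Q * (\<Sum>k\<in>K. a k r) powr Q" using C nn by (simp add: powr_mult sum_nonneg)
      also have "\<dots> \<le> C powr Q * (real (card K) powr Q * (\<Sum>k\<in>K. a k r powr Q))"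
        using Q nn by (intro mult_left_mono sum_powr_le K) auto
      finally have "b r powr Q * (1 - r) powr e \<le> c * (\<Sum>k\<in>K. a k r powr Q) * (1 - r) powr e"
        by (intro mult_right_mono) (auto simp: c_def mult.assoc)
      also have "\<dots> = (\<Sum>k\<in>K. c * (a k r powr Q * (1 - r) powr e))"
        by (simp add: sum_distrib_left sum_distrib_right mult.assoc)
      finally have "ennreal (b r powr Q * (1 - r) powr e) \<le> ennreal (\<Sum>k\<in>K. c * (a k r powr Q * (1 - r) powr e))"
        by (rule ennreal_leI)
      also have "\<dots> = (\<Sum>k\<in>K. ennreal (c * (a k r powr Q * (1 - r) powr e)))"
        by (rule sum_ennreal[symmetric]) (simp add: c_def)
      finally show ?thesis using r by (simp add: ennreal_mult c_def)
    qed simp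
  qed
  also have "\<dots> = (\<Sum>k\<in>K. ennreal c * (\<integral>\<^sup>+ r. ?F k r \<partial>lborel))"
    by (subst nn_integral_sum) (auto intro!: sum.cong nn_integral_cmult)
  also have "\<dots> < top"
    using fin False K by (auto simp: weighted_finite_def Q_def[symmetric] e_def[symmetric] ennreal_mult_less_top)
  finally show ?thesis using False by (simp add: weighted_finite_def Q_def e_def)
qed

lemma weighted_finite_const:
  assumes q: "1 \<le> q" and \<beta>: "0 < \<beta>" and "0 \<le> c"
  shows "weighted_finite q \<beta> (\<lambda>_. c)"
proof (cases "q = top")
  case True
  have "c \<le> c * (1 - r) powr (- \<beta>)" if "r \<in> {1/2<..<1}" for r :: real
  proof -
    have "1 \<le> (1 - r) powr (- \<beta>)" using that \<beta> powr_mono2'[of "- \<beta>" "1 - r" 1] by simp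
    then show ?thesis using \<open>0 \<le> c\<close> by (simp add: mult_le_cancel_left1)
  qed
  then show ?thesis unfolding True by (rule weighted_finite_topI)
next
  case False
  define Q where "Q = enn2real q"
  have Q: "1 \<le> Q" unfolding Q_def by (rule enn2real_ge_one[OF q False])
  define e where "e = Q * \<beta> - 1"
  have e: "-1 < e" using Q \<beta> by (simp add: e_def)
  have "(\<integral>\<^sup>+ r. ennreal (c powr Q * (1 - r) powr e) * indicator {1/2<..<1} r \<partial>lborel)
      \<le> (\<integral>\<^sup>+ r. ennreal (c powr Q) * (ennreal ((1 - r) powr e) * indicator {0..1} (1 - r)) \<partial>lborel)"
    by (intro nn_integral_mono) (auto simp: ennreal_mult split: split_indicator)
  also have "\<dots> = ennreal (c powr Q) * (\<integral>\<^sup>+ r. ennreal ((1 - r) powr e) * indicator {0..1} (1 - r) \<partial>lborel)"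
    by (rule nn_integral_cmult) measurable
  also have "(\<integral>\<^sup>+ r. ennreal ((1 - r) powr e) * indicator {0..1} (1 - r) \<partial>lborel)
      = (\<integral>\<^sup>+ r. ennreal (r powr e) * indicator {0..1::real} r \<partial>lborel)"
    using nn_integral_lborel_reflect[of "\<lambda>r. ennreal (r powr e) * indicator {0..1::real} r" 1] by simp
  also have "\<dots> = ennreal (1 powr (e + 1) / (e + 1))"
    by (rule nn_integral_has_integral_lebesgue') (use has_integral_powr_from_0[OF e, of 1] in auto)
  finally have "(\<integral>\<^sup>+ r. ennreal (c powr Q * (1 - r) powr e) * indicator {1/2<..<1} r \<partial>lborel) < top"
    by (rule order_le_less_trans) (simp add: ennreal_mult_less_top)
  then show ?thesis using False by (simp add: weighted_finite_def Q_def e_def)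
qed


lemma nn_integral_affine_near_one:
  fixes f :: "real \<Rightarrow> ennreal"
  assumes [measurable]: "f \<in> borel_measurable borel" and "0 < l"
  shows "(\<integral>\<^sup>+ r. f (1 - l * (1 - r)) \<partial>lborel) = ennreal (1 / l) * (\<integral>\<^sup>+ r. f r \<partial>lborel)"
proof -
  have "(\<integral>\<^sup>+ r. f r \<partial>lborel) = ennreal l * (\<integral>\<^sup>+ r. f ((1 - l) + l * r) \<partial>lborel)"
    using nn_integral_real_affine[of f l "1 - l"] assms by simp
  then have "ennreal (1 / l) * (\<integral>\<^sup>+ r. f r \<partial>lborel) = (ennreal (1 / l) * ennreal l) * (\<integral>\<^sup>+ r. f (1 - l * (1 - r)) \<partial>lborel)"
    by (simp add: mult.assoc algebra_simps)
  also have "ennreal (1 / l) * ennreal l = 1" using \<open>0 < l\<close> by (simp flip: ennreal_mult)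
  finally show ?thesis by simp
qed

text \<open>A form of Hardy's inequality. The dilation \<open>1 - r \<mapsto> l (1 - r)\<close> shrinks weighted norms by a factor of at most
  \<open>l\<^sup>-\<^sup>\<beta>\<close>, so for large \<open>l\<close> the dilated copy of \<open>b\<close> on the right can be absorbed into the left-hand side. As
  this needs finite quantities, the integrals are first truncated at \<open>s < 1\<close>; for \<open>q = \<infinity>\<close> the same is achieved by
  induction over the shells on which \<open>1 - r\<close> is comparable to \<open>l\<^sup>-\<^sup>n\<close>.\<close>

lemma weighted_finite_absorb:
  assumes q: "1 \<le> q" and \<beta>: "0 < \<beta>" and l: "1 < l" "16 \<le> l powr \<beta>" and C: "0 \<le> C"
    and mono: "mono_on {0..<1} a" "mono_on {0..<1} b"
    and nn: "\<And>r. 0 \<le> a r" "\<And>r. 0 \<le> b r"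
    and fin: "weighted_finite q \<beta> a"
    and rec: "\<And>r. r \<in> {1 - 1 / (2 * l)<..<1} \<Longrightarrow> b r \<le> 4 * b (1 - l * (1 - r)) + C * a ((1 + r) / 2)"
  shows "weighted_finite q \<beta> b"
proof -
  define r0 where "r0 = 1 - 1 / (2 * l)"
  have r0: "1/2 < r0" "r0 < 1" "l * (1 - r0) = 1/2" using l(1) by (auto simp: r0_def field_simps)
  have dil: "1/2 < 1 - l * (1 - r)" "1 - l * (1 - r) < r" if "r \<in> {r0<..<1}" for r
  proof -
    have "l * (1 - r) < l * (1 - r0)" using that l(1) by (intro mult_strict_left_mono) auto
    then show "1/2 < 1 - l * (1 - r)" using r0(3) by simp
    have "1 * (1 - r) < l * (1 - r)" using that l(1) by (intro mult_strict_right_mono) auto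
    then show "1 - l * (1 - r) < r" by simp
  qed
  have small: "l powr (- \<beta>) \<le> 1 / 16"
  proof -
    have "1 / (l powr \<beta>) \<le> 1 / 16" using l(2) by (intro divide_left_mono) auto
    then show ?thesis by (simp add: powr_minus_divide)
  qed
  show ?thesis
  proof (cases "q = top")
    case True
    from fin obtain D0 where D0: "\<And>r. r \<in> {1/2<..<1} \<Longrightarrow> a r \<le> D0 * (1 - r) powr (- \<beta>)"
      unfolding weighted_finite_def if_P[OF True] by blast
    \<comment> \<open>The first entry starts the induction; the second makes the term with \<open>a\<close> at most half of the bound.\<close>
    define D where "D = max (b r0) (2 * (C * (D0 * (1/2) powr (- \<beta>))))"
    have D: "0 \<le> D" using nn(2)[of r0] by (simp add: D_def)
    have base: "b r \<le> D * (1 - r) powr (- \<beta>)" if "r \<in> {1/2<..r0}" for r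
    proof -
      have "b r \<le> b r0" using mono(2) that r0 by (auto simp: mono_on_def)
      also have "\<dots> \<le> D * 1" by (simp add: D_def)
      also have "\<dots> \<le> D * (1 - r) powr (- \<beta>)"
        using D powr_mono2'[of "- \<beta>" "1 - r" 1] that r0 \<beta> by (intro mult_left_mono) auto
      finally show ?thesis .
    qed
    have *: "b r \<le> D * (1 - r) powr (- \<beta>)" if "r \<in> {1/2<..<1}" "1 / l ^ n \<le> 2 * l * (1 - r)" for n r
      using that
    proof (induction n arbitrary: r)
      case 0
      then have "r \<le> r0" using l(1) by (simp add: r0_def field_simps)
      then show ?case using base 0 by simp
    next
      case (Suc n)
      show ?case
      proof (cases "r \<le> r0")
        case False
        then have r: "r \<in> {r0<..<1}" using Suc.prems by simp
        have "1 / l ^ n = l * (1 / l ^ Suc n)" using l(1) by simp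
        also have "\<dots> \<le> l * (2 * l * (1 - r))" using Suc.prems(2) l(1) by (intro mult_left_mono) auto
        finally have "b (1 - l * (1 - r)) \<le> D * (1 - (1 - l * (1 - r))) powr (- \<beta>)"
          using dil[OF r] r by (intro Suc.IH) (auto simp: mult_ac)
        also have "\<dots> = D * (l powr (- \<beta>) * (1 - r) powr (- \<beta>))"
          using l(1) r by (simp add: powr_mult)
        also have "\<dots> \<le> D * (1 / 16 * (1 - r) powr (- \<beta>))"
          using small D by (intro mult_left_mono mult_right_mono) auto
        finally have 1: "4 * b (1 - l * (1 - r)) \<le> D / 4 * (1 - r) powr (- \<beta>)" by simp
        have "a ((1 + r) / 2) \<le> D0 * (1 - (1 + r) / 2) powr (- \<beta>)"
          using r r0 by (intro D0) auto
        also have "(1 - (1 + r) / 2) = (1/2) * (1 - r)" by (simp add: field_simps)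
        also have "\<dots> powr (- \<beta>) = (1/2) powr (- \<beta>) * (1 - r) powr (- \<beta>)"
          by (rule powr_mult)
        finally have "C * a ((1 + r) / 2) \<le> C * (D0 * ((1/2) powr (- \<beta>) * (1 - r) powr (- \<beta>)))"
          using C by (intro mult_left_mono)
        also have "\<dots> = (C * (D0 * (1/2) powr (- \<beta>))) * (1 - r) powr (- \<beta>)" by (simp add: mult.assoc)
        also have "\<dots> \<le> D / 2 * (1 - r) powr (- \<beta>)"
          by (intro mult_right_mono) (auto simp: D_def)
        finally have 2: "C * a ((1 + r) / 2) \<le> D / 2 * (1 - r) powr (- \<beta>)" .
        have "b r \<le> D / 4 * (1 - r) powr (- \<beta>) + D / 2 * (1 - r) powr (- \<beta>)"
          using rec[of r] r 1 2 by (simp add: r0_def)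
        also have "\<dots> = (3 / 4 * D) * (1 - r) powr (- \<beta>)" by (simp add: algebra_simps)
        also have "\<dots> \<le> D * (1 - r) powr (- \<beta>)" using D by (intro mult_right_mono) auto
        finally show ?thesis .
      qed (use base Suc.prems in auto)
    qed
    have "b r \<le> D * (1 - r) powr (- \<beta>)" if r: "r \<in> {1/2<..<1}" for r
    proof -
      have "1 / l < 1" using l(1) by simp
      moreover have "0 < 2 * l * (1 - r)" using r l(1) by simp
      ultimately obtain n where "(1 / l) ^ n < 2 * l * (1 - r)"
        using real_arch_pow_inv by blast
      then show ?thesis by (intro *[OF r, of n]) (simp add: power_divide)
    qed
    then show ?thesis unfolding True by (rule weighted_finite_topI)
  next
    case False
    define Q where "Q = enn2real q"
    have Q: "1 \<le> Q" unfolding Q_def by (rule enn2real_ge_one[OF q False])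
    define e where "e = Q * \<beta> - 1"
    define B where "B = (\<lambda>S r. ennreal (b r powr Q * (1 - r) powr e) * indicator S r)"
    define A where "A = (\<lambda>r. ennreal (a r powr Q * (1 - r) powr e) * indicator {1/2<..<1} r)"
    have Bm [measurable]: "B S \<in> borel_measurable borel" if "S \<subseteq> {0..<1}" "S \<in> sets borel" for S
      unfolding B_def by (rule weighted_integrand_measurable[OF mono(2) that]; measurable)
    have Am [measurable]: "A \<in> borel_measurable borel"
      unfolding A_def by (rule weighted_integrand_measurable[OF mono(1)]) auto
    have IA: "(\<integral>\<^sup>+ r. A r \<partial>lborel) < top"
      using fin False by (simp add: weighted_finite_def A_def Q_def e_def)
    have Bfin: "(\<integral>\<^sup>+ r. B {x..s} r \<partial>lborel) < top" if "0 \<le> x" "s < 1" for x s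
    proof -
      have "B {x..s} r \<le> ennreal (b s powr Q * max 1 ((1 - s) powr e)) * indicator {x..s} r" for r
      proof (cases "r \<in> {x..s}")
        case True
        have "b r powr Q \<le> b s powr Q"
          using mono(2) True that nn(2) Q by (intro powr_mono2) (auto simp: mono_on_def)
        moreover have "(1 - r) powr e \<le> max 1 ((1 - s) powr e)"
        proof (cases "0 \<le> e")
          case True
          then have "(1 - r) powr e \<le> 1 powr e" using \<open>r \<in> {x..s}\<close> that by (intro powr_mono2) auto
          then show ?thesis by simp
        next
          case False
          then have "(1 - r) powr e \<le> (1 - s) powr e" using \<open>r \<in> {x..s}\<close> that by (intro powr_mono2') auto
          then show ?thesis by simp
        qed
        ultimately show ?thesis using True by (auto simp: B_def intro!: ennreal_leI mult_mono)
      qed (simp add: B_def)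
      then have "(\<integral>\<^sup>+ r. B {x..s} r \<partial>lborel)
          \<le> (\<integral>\<^sup>+ r. ennreal (b s powr Q * max 1 ((1 - s) powr e)) * indicator {x..s} r \<partial>lborel)"
        by (rule nn_integral_mono)
      also have "\<dots> < top" by (simp add: nn_integral_cmult ennreal_mult_less_top emeasure_lborel_Icc_eq)
      finally show ?thesis .
    qed
    let ?B0 = "\<integral>\<^sup>+ r. B {1/2..r0} r \<partial>lborel"
    define X where "X = ennreal ((2 * C) powr Q * (2 * 2 powr e)) * (\<integral>\<^sup>+ r. A r \<partial>lborel)"
    have trunc: "(\<integral>\<^sup>+ r. B {r0<..<s} r \<partial>lborel) \<le> ?B0 + 2 * X" if s: "s \<in> {r0<..<1}" for s
    proof -
      let ?I = "\<integral>\<^sup>+ r. B {r0<..<s} r \<partial>lborel"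
      let ?f = "\<lambda>r. ennreal (8 powr Q * l powr (- e)) * B ({1/2..r0} \<union> {r0<..<s}) (1 - l * (1 - r))"
      let ?g = "\<lambda>r. ennreal ((2 * C) powr Q * 2 powr e) * A ((1 + r) / 2)"
      have S: "{1/2..r0} \<union> {r0<..<s} \<subseteq> {0..<1}" "{1/2..r0} \<union> {r0<..<s} \<in> sets borel" using r0 s by auto
      note [measurable] = Bm[OF S]
      have "?I \<le> (\<integral>\<^sup>+ r. ?f r + ?g r \<partial>lborel)"
      proof (rule nn_integral_mono)
        fix r :: real
        show "B {r0<..<s} r \<le> ?f r + ?g r"
        proof (cases "r \<in> {r0<..<s}")
          case True
          then have r: "r \<in> {r0<..<1}" using s by simp
          let ?x = "b (1 - l * (1 - r))" and ?y = "a ((1 + r) / 2)"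
          have "b r powr Q \<le> (4 * ?x + C * ?y) powr Q"
            using rec[of r] r nn Q by (intro powr_mono2) (auto simp: r0_def)
          \<comment> \<open>The two summands are indexed by truth values.\<close>
          also have "4 * ?x + C * ?y = (\<Sum>k\<in>(UNIV :: bool set). if k then 4 * ?x else C * ?y)"
            by (simp add: UNIV_bool)
          also have "\<dots> powr Q \<le> real (card (UNIV :: bool set)) powr Q
              * (\<Sum>k\<in>(UNIV :: bool set). (if k then 4 * ?x else C * ?y) powr Q)"
            by (rule sum_powr_le) (use nn C Q in auto)
          also have "\<dots> = 2 powr Q * ((4 * ?x) powr Q + (C * ?y) powr Q)"
            by (simp add: UNIV_bool)
          also have "\<dots> = 8 powr Q * ?x powr Q + (2 * C) powr Q * ?y powr Q"
            using nn C powr_mult[of 2 4 Q] by (simp add: powr_mult distrib_left)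
          finally have "b r powr Q * (1 - r) powr e
             \<le> (8 powr Q * ?x powr Q + (2 * C) powr Q * ?y powr Q) * (1 - r) powr e"
            by (rule mult_right_mono) simp
          also have "\<dots> = (8 powr Q * l powr (- e)) * (?x powr Q * (l * (1 - r)) powr e)
              + ((2 * C) powr Q * 2 powr e) * (?y powr Q * ((1/2) * (1 - r)) powr e)"
          proof -
            have 1: "l powr (- e) * (l * (1 - r)) powr e = (1 - r) powr e"
              unfolding powr_mult using l(1) by (simp add: powr_minus)
            have "2 * ((1/2) * (1 - r)) = 1 - r" by simp
            then have 2: "2 powr e * ((1/2) * (1 - r)) powr e = (1 - r) powr e" by (metis powr_mult)
            have "(8 powr Q * l powr (- e)) * (?x powr Q * (l * (1 - r)) powr e)
                = 8 powr Q * ?x powr Q * (l powr (- e) * (l * (1 - r)) powr e)" by (simp only: mult_ac)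
            moreover have "((2 * C) powr Q * 2 powr e) * (?y powr Q * ((1/2) * (1 - r)) powr e)
                = (2 * C) powr Q * ?y powr Q * (2 powr e * ((1/2) * (1 - r)) powr e)" by (simp only: mult_ac)
            ultimately show ?thesis unfolding 1 2 by (simp only: distrib_right)
          qed
          finally have "b r powr Q * (1 - r) powr e
              \<le> (8 powr Q * l powr (- e)) * (?x powr Q * (l * (1 - r)) powr e)
               + ((2 * C) powr Q * 2 powr e) * (?y powr Q * ((1/2) * (1 - r)) powr e)" .
          from ennreal_leI[OF this]
          have "ennreal (b r powr Q * (1 - r) powr e)
              \<le> ennreal ((8 powr Q * l powr (- e)) * (?x powr Q * (l * (1 - r)) powr e))
               + ennreal (((2 * C) powr Q * 2 powr e) * (?y powr Q * ((1/2) * (1 - r)) powr e))"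
            by (subst (asm) ennreal_plus) simp_all
          moreover have "B {r0<..<s} r = ennreal (b r powr Q * (1 - r) powr e)"
            using True by (simp add: B_def)
          moreover have "1 - l * (1 - r) \<in> {1/2..r0} \<union> {r0<..<s}"
            using dil[OF r] True by auto
          then have "?f r = ennreal ((8 powr Q * l powr (- e)) * (?x powr Q * (l * (1 - r)) powr e))"
            by (simp add: B_def ennreal_mult)
          moreover have half: "1 - (1 + r) / 2 = (1/2) * (1 - r)" by (simp add: field_simps)
          have "?g r = ennreal (((2 * C) powr Q * 2 powr e) * (?y powr Q * ((1/2) * (1 - r)) powr e))"
            unfolding A_def half using r r0 by (simp add: ennreal_mult)
          ultimately show ?thesis by simp
        qed (simp add: B_def)
      qed
      also have "\<dots> = (\<integral>\<^sup>+ r. ?f r \<partial>lborel) + (\<integral>\<^sup>+ r. ?g r \<partial>lborel)"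
        by (rule nn_integral_add) measurable
      also have "(\<integral>\<^sup>+ r. ?f r \<partial>lborel) = ennreal (8 powr Q * l powr (- e)) *
           (ennreal (1 / l) * (\<integral>\<^sup>+ r. B ({1/2..r0} \<union> {r0<..<s}) r \<partial>lborel))"
        using l(1) by (subst nn_integral_cmult) (auto simp: nn_integral_affine_near_one)
      also have "\<dots> \<le> ennreal (1/2) * (?B0 + ?I)"
      proof -
        have "(\<integral>\<^sup>+ r. B ({1/2..r0} \<union> {r0<..<s}) r \<partial>lborel) = (\<integral>\<^sup>+ r. B {1/2..r0} r + B {r0<..<s} r \<partial>lborel)"
          by (intro nn_integral_cong) (auto simp: B_def split: split_indicator)
        also have "\<dots> = ?B0 + ?I"
          using r0 s by (intro nn_integral_add) (auto intro!: Bm)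
        finally have eq: "(\<integral>\<^sup>+ r. B ({1/2..r0} \<union> {r0<..<s}) r \<partial>lborel) = ?B0 + ?I" .
        \<comment> \<open>The factor \<open>4\<close> in the recursion and \<open>2\<close> from the convexity bound are beaten by \<open>l\<^sup>-\<^sup>\<beta> \<le> 1/16\<close>.\<close>
        have "8 powr Q * l powr (- e) * (1 / l) = 8 powr Q * l powr (- e - 1)"
          using l(1) by (simp add: powr_diff)
        also have "\<dots> = 8 powr Q * (l powr (- \<beta>)) powr Q"
          by (simp add: e_def powr_powr mult.commute)
        also have "\<dots> \<le> 8 powr Q * (1/16) powr Q"
          using small Q by (intro mult_left_mono powr_mono2) auto
        also have "\<dots> = (1/2) powr Q" using powr_mult[of 8 "1/16" Q] by simp
        also have "\<dots> \<le> (1/2) powr 1" using Q by (intro powr_mono') auto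
        finally have "8 powr Q * l powr (- e) * (1 / l) \<le> 1/2" by simp
        from ennreal_leI[OF this]
        have "ennreal (8 powr Q * l powr (- e)) * ennreal (1 / l) \<le> ennreal (1/2)"
          using l(1) by (subst (asm) ennreal_mult) simp_all
        then show ?thesis unfolding eq mult.assoc[symmetric] by (rule mult_right_mono) simp
      qed
      also have "(\<integral>\<^sup>+ r. ?g r \<partial>lborel) = X"
      proof -
        have "(\<integral>\<^sup>+ r. ?g r \<partial>lborel) = ennreal ((2 * C) powr Q * 2 powr e) * (ennreal (1 / (1/2)) * (\<integral>\<^sup>+ r. A r \<partial>lborel))"
        proof -
          have "(1 + r) / 2 = 1 - (1/2) * (1 - r)" for r :: real by (simp add: field_simps)
          then show ?thesis
            by (subst nn_integral_cmult) (simp, simp only:, subst nn_integral_affine_near_one, auto)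
        qed
        also have "\<dots> = (ennreal ((2 * C) powr Q * 2 powr e) * ennreal 2) * (\<integral>\<^sup>+ r. A r \<partial>lborel)"
          by (simp add: mult.assoc)
        also have "ennreal ((2 * C) powr Q * 2 powr e) * ennreal 2 = ennreal ((2 * C) powr Q * (2 * 2 powr e))"
          by (subst ennreal_mult[symmetric]) (auto simp: mult_ac)
        finally show ?thesis by (simp add: X_def)
      qed
      finally have I: "?I \<le> ennreal (1/2) * (?B0 + ?I) + X" by (simp add: add_mono)
      have "?I \<le> (\<integral>\<^sup>+ r. B {r0..s} r \<partial>lborel)"
        by (intro nn_integral_mono) (auto simp: B_def split: split_indicator)
      then have Ifin: "?I < top" using Bfin[of r0 s] r0 s by auto
      have Xfin: "X < top" using IA by (simp add: X_def ennreal_mult_less_top)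
      have B0fin: "?B0 < top" using Bfin[of "1/2" r0] r0 by simp
      obtain i b0 x where ibx: "?I = ennreal i" "0 \<le> i" "?B0 = ennreal b0" "0 \<le> b0" "X = ennreal x" "0 \<le> x"
        using Ifin Xfin B0fin by (metis ennreal_cases less_irrefl)
      have e1: "ennreal (1/2 * (b0 + i) + x) = ennreal (1/2 * (b0 + i)) + ennreal x"
        by (rule ennreal_plus) (use ibx in auto)
      have e2: "ennreal (1/2 * (b0 + i)) = ennreal (1/2) * ennreal (b0 + i)"
        by (rule ennreal_mult) (use ibx in auto)
      have e3: "ennreal (b0 + i) = ennreal b0 + ennreal i"
        by (rule ennreal_plus) (use ibx in auto)
      have "ennreal i \<le> ennreal (1/2 * (b0 + i) + x)"
        unfolding e1 e2 e3 using I unfolding ibx(1,3,5) .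
      then have "i \<le> 1/2 * (b0 + i) + x"
        using ibx by (subst (asm) ennreal_le_iff) auto
      then have "i \<le> b0 + 2 * x" by (simp add: field_simps)
      then have "ennreal i \<le> ennreal (b0 + 2 * x)" by (rule ennreal_leI)
      then show ?thesis using ibx by (simp add: ennreal_mult)
    qed
    have lim: "(\<integral>\<^sup>+ r. B {r0<..<1} r \<partial>lborel) \<le> ?B0 + 2 * X"
    proof -
      define s where "s = (\<lambda>n. 1 - (1 - r0) / (real n + 2))"
      have s: "s n \<in> {r0<..<1}" for n
      proof -
        have "(1 - r0) / (real n + 2) < (1 - r0) / 1"
          using r0 by (intro divide_strict_left_mono) auto
        moreover have "0 < (1 - r0) / (real n + 2)" using r0 by (intro divide_pos_pos) auto
        ultimately show ?thesis by (simp add: s_def)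
      qed
      have inc: "s m \<le> s n" if "m \<le> n" for m n
        using that r0 by (auto simp: s_def intro!: divide_left_mono)
      have "\<exists>n. r < s n" if "r < 1" for r
      proof -
        have "s \<longlonglongrightarrow> 1" unfolding s_def by real_asymp
        from order_tendstoD(1)[OF this that] show ?thesis
          by (meson eventually_sequentially order_refl)
      qed
      moreover have "r < 1" if "r < s n" for r n using that s[of n] by simp
      ultimately have U: "{r0<..<1} = (\<Union>n. {r0<..<s n})" by auto
      let ?M = "density lborel (B {r0<..<1})"
      have "B {r0<..<1} \<in> borel_measurable borel" by (rule Bm) (use r0 in auto)
      then have BM: "B {r0<..<1} \<in> borel_measurable lborel" by simp
      have em: "emeasure ?M S = (\<integral>\<^sup>+ r. B S r \<partial>lborel)" if "S \<subseteq> {r0<..<1}" "S \<in> sets borel" for S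
        using that BM by (subst emeasure_density) (auto simp: B_def intro!: nn_integral_cong split: split_indicator)
      have "(SUP n. emeasure ?M {r0<..<s n}) = emeasure ?M (\<Union>n. {r0<..<s n})"
      proof (rule SUP_emeasure_incseq)
        show "incseq (\<lambda>n. {r0<..<s n})"
        proof (rule monoI)
          fix m n :: nat assume "m \<le> n"
          then show "{r0<..<s m} \<subseteq> {r0<..<s n}" using inc[of m n] by auto
        qed
      qed auto
      then have "(\<integral>\<^sup>+ r. B {r0<..<1} r \<partial>lborel) = (SUP n. emeasure ?M {r0<..<s n})"
        by (simp add: U[symmetric] em)
      also have "\<dots> \<le> ?B0 + 2 * X"
      proof (rule SUP_least)
        fix n
        have "emeasure ?M {r0<..<s n} = (\<integral>\<^sup>+ r. B {r0<..<s n} r \<partial>lborel)"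
          using s[of n] by (intro em) auto
        then show "emeasure ?M {r0<..<s n} \<le> ?B0 + 2 * X" using trunc[OF s[of n]] by simp
      qed
      finally show ?thesis .
    qed
    have "(\<integral>\<^sup>+ r. B {1/2<..<1} r \<partial>lborel) \<le> (\<integral>\<^sup>+ r. B {1/2..r0} r + B {r0<..<1} r \<partial>lborel)"
      by (intro nn_integral_mono) (auto simp: B_def split: split_indicator)
    also have "\<dots> = ?B0 + (\<integral>\<^sup>+ r. B {r0<..<1} r \<partial>lborel)"
      using r0 by (intro nn_integral_add) (auto intro!: Bm)
    also have "\<dots> \<le> ?B0 + (?B0 + 2 * X)" by (intro add_left_mono lim)
    also have "\<dots> < top"
      using Bfin[of "1/2" r0] r0 IA by (simp add: X_def ennreal_mult_less_top)
    finally show ?thesis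
      using False by (simp add: weighted_finite_def B_def Q_def e_def)
  qed
qed

section \<open>Finiteness of mixed norms\<close>

lemma powr_between:
  fixes x e :: real
  assumes "1/2 \<le> x" "x \<le> 2"
  shows "2 powr (- \<bar>e\<bar>) \<le> x powr e" "x powr e \<le> 2 powr \<bar>e\<bar>"
proof -
  have h: "(1/2 :: real) powr e = 2 powr (- e)" for e
    by (simp add: powr_divide powr_minus_divide)
  have "2 powr (- \<bar>e\<bar>) \<le> x powr e \<and> x powr e \<le> 2 powr \<bar>e\<bar>"
  proof (cases "0 \<le> e")
    case True
    then show ?thesis
      using powr_mono2[of e "1/2" x] powr_mono2[of e x 2] assms by (simp add: h)
  next
    case False
    then show ?thesis
      using powr_mono2'[of e x 2] powr_mono2'[of e "1/2" x] assms by (simp add: h)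
  qed
  then show "2 powr (- \<bar>e\<bar>) \<le> x powr e" "x powr e \<le> 2 powr \<bar>e\<bar>" by auto
qed

lemma one_minus_square_powr:
  fixes r e :: real
  assumes "0 \<le> r" "r < 1"
  shows "(1 - r\<^sup>2) powr e = (1 + r) powr e * (1 - r) powr e"
proof -
  have "1 - r\<^sup>2 = (1 + r) * (1 - r)" by (simp add: power2_eq_square algebra_simps)
  then show ?thesis by (simp add: powr_mult)
qed

lemma epowr_less_top_iff: "epowr x a < top \<longleftrightarrow> x < top"
  by (auto simp: epowr_def less_top)

text \<open>Near the boundary the weights differ by bounded factors, and the other radii contribute a finite amount
  because the means increase. For \<open>q = \<infinity>\<close>, monotonicity also turns a bound at almost every radius into one at
  every radius.\<close>

lemma mixed_norm_finite_iff:
  fixes g :: "complex ^ 'n::finite \<Rightarrow> 'b::real_normed_vector"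
  assumes p: "1 \<le> p" and q: "1 \<le> q" and \<beta>: "0 < \<beta>"
    and g: "continuous_on (ball 0 1) g" and mono: "mono_on {0..<1} (lp_mean p g)"
  shows "mixed_norm p q \<beta> g < top \<longleftrightarrow> weighted_finite q \<beta> (lp_mean p g)"
proof (cases "q = top")
  case True
  let ?b = "lp_mean p g"
  let ?L = "restrict_space lborel {0..<1::real}"
  let ?F = "\<lambda>r. ennreal ((1 - r\<^sup>2) powr \<beta>) * integral_mean p r g"
  have F: "?F r = ennreal ((1 - r\<^sup>2) powr \<beta> * ?b r)" if "r \<in> {0..<1}" for r
    using integral_mean_eq_lp_mean[OF p g] that by (simp add: ennreal_mult)
  have "mixed_norm p q \<beta> g = esssup ?L ?F" using True by (simp add: mixed_norm_def)
  moreover have "esssup ?L ?F < top \<longleftrightarrow> weighted_finite top \<beta> ?b"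
  proof
    assume fin: "weighted_finite top \<beta> ?b"
    obtain D where D: "\<And>r. r \<in> {1/2<..<1} \<Longrightarrow> ?b r \<le> D * (1 - r) powr (- \<beta>)"
      using fin unfolding weighted_finite_def if_P[OF refl] by blast
    have "?b \<in> borel_measurable (restrict_space borel {0..<1})"
      using mono by (rule borel_measurable_mono_on_fnc)
    then have [measurable]: "?b \<in> borel_measurable ?L"
      by (subst measurable_cong_sets[of ?L "restrict_space borel {0..<1}"]) (auto simp: sets_restrict_space)
    have [measurable]: "(\<lambda>r. r) \<in> borel_measurable ?L"
      by (rule measurable_restrict_space1) simp
    have "(\<lambda>r. ennreal ((1 - r\<^sup>2) powr \<beta> * ?b r)) \<in> borel_measurable ?L"
      by measurable
    then have "?F \<in> borel_measurable ?L"
      by (subst measurable_cong[of ?L]) (auto simp: F space_restrict_space)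
    moreover have "?F r \<le> ennreal (max (2 powr \<beta> * D) (?b (1/2)))" if r: "r \<in> {0..<1}" for r
    proof -
      have "(1 - r\<^sup>2) powr \<beta> * ?b r \<le> max (2 powr \<beta> * D) (?b (1/2))"
      proof (cases "r \<le> 1/2")
        case le: True
        have "?b r \<le> ?b (1/2)" using mono r le by (auto simp: mono_on_def)
        moreover have "(1 - r\<^sup>2) powr \<beta> \<le> 1 powr \<beta>"
          using r \<beta> by (intro powr_mono2) (auto simp: power_le_one)
        ultimately have "(1 - r\<^sup>2) powr \<beta> * ?b r \<le> 1 * ?b (1/2)"
          by (intro mult_mono) auto
        then show ?thesis by simp
      next
        case False
        have "(1 - r\<^sup>2) powr \<beta> * ?b r \<le> ((1 + r) powr \<beta> * (1 - r) powr \<beta>) * (D * (1 - r) powr (- \<beta>))"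
          using D[of r] False r by (simp add: one_minus_square_powr mult_left_mono)
        also have "\<dots> = (1 + r) powr \<beta> * D * ((1 - r) powr \<beta> * (1 - r) powr (- \<beta>))" by (simp only: mult_ac)
        also have "(1 - r) powr \<beta> * (1 - r) powr (- \<beta>) = 1"
          using r by (simp flip: powr_add)
        also have "(1 + r) powr \<beta> * D * 1 \<le> 2 powr \<beta> * D"
        proof -
          have "0 \<le> D * (1 - r) powr (- \<beta>)" using D[of r] False r lp_mean_nonneg[of p g r] by (meson greaterThanLessThan_iff atLeastLessThan_iff not_le order_trans)
          then have "0 \<le> D" using r by (simp add: zero_le_mult_iff)
          moreover have "(1 + r) powr \<beta> \<le> 2 powr \<beta>" using r \<beta> by (intro powr_mono2) auto
          ultimately show ?thesis by (simp add: mult_right_mono)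
        qed
        finally show ?thesis by simp
      qed
      then show ?thesis unfolding F[OF r] by (rule ennreal_leI)
    qed
    then have "AE r in ?L. ?F r \<le> ennreal (max (2 powr \<beta> * D) (?b (1/2)))"
      by (intro AE_I2) (simp add: space_restrict_space)
    ultimately have "esssup ?L ?F \<le> ennreal (max (2 powr \<beta> * D) (?b (1/2)))"
      by (rule esssup_I)
    then show "esssup ?L ?F < top" by (rule order_le_less_trans) simp
  next
    assume "esssup ?L ?F < top"
    then obtain S where S: "esssup ?L ?F = ennreal S" "0 \<le> S" by (cases "esssup ?L ?F") auto
    have "AE r in ?L. ?F r \<le> ennreal S" using esssup_AE[of ?F ?L] by (simp add: S)
    then have AE: "AE r in lborel. r \<in> {0..<1} \<longrightarrow> ?F r \<le> ennreal S"
      by (subst (asm) AE_restrict_space_iff) auto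
    show "weighted_finite top \<beta> ?b"
    proof (rule weighted_finite_topI)
      fix r :: real assume r: "r \<in> {1/2<..<1}"
      have "\<exists>x\<in>{r<..<(1 + r) / 2}. ?F x \<le> ennreal S"
      proof (rule ccontr)
        assume "\<not> ?thesis"
        with AE have "AE x in lborel. x \<notin> {r<..<(1 + r) / 2}"
          using r by (auto elim!: eventually_mono)
        then have "{r<..<(1 + r) / 2} \<in> null_sets lborel"
          by (subst (asm) AE_iff_null_sets[symmetric]) auto
        then have "emeasure lborel {r<..<(1 + r) / 2} = 0" by auto
        then show False using r by (simp add: emeasure_lborel_Ioo)
      qed
      then obtain x where x: "r < x" "x < (1 + r) / 2" "?F x \<le> ennreal S" by auto
      then have x1: "x \<in> {0..<1}" using r by auto
      then have *: "(1 - x\<^sup>2) powr \<beta> * ?b x \<le> S" using x(3) S(2) by (simp add: F)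
      have "(1 - r) / 2 \<le> 1 * (1 - x)" using x(2) by (simp add: field_simps)
      also have "\<dots> \<le> (1 + x) * (1 - x)" using x1 by (intro mult_right_mono) auto
      also have "\<dots> = 1 - x\<^sup>2" by (simp add: power2_eq_square algebra_simps)
      finally have "((1 - r) / 2) powr \<beta> \<le> (1 - x\<^sup>2) powr \<beta>" using r \<beta> by (intro powr_mono2) auto
      moreover have "?b r \<le> ?b x" using mono r x x1 by (auto simp: mono_on_def)
      ultimately have "((1 - r) / 2) powr \<beta> * ?b r \<le> (1 - x\<^sup>2) powr \<beta> * ?b x"
        by (intro mult_mono) auto
      with * have "((1 - r) / 2) powr \<beta> * ?b r \<le> S" by linarith
      then have "?b r \<le> S * (2 powr \<beta> * (1 - r) powr (- \<beta>))"
        using r by (simp add: powr_divide powr_minus_divide field_simps)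
      then show "?b r \<le> (S * 2 powr \<beta>) * (1 - r) powr (- \<beta>)" by (simp add: mult.assoc)
    qed
  qed
  ultimately show ?thesis using True by simp
next
  case False
  let ?b = "lp_mean p g"
  define Q where "Q = enn2real q"
  have Q: "1 \<le> Q" unfolding Q_def by (rule enn2real_ge_one[OF q False])
  define e where "e = Q * \<beta> - 1"
  define N where "N = 2 * CARD('n) - 1"
  let ?w = "\<lambda>r. (1 - r\<^sup>2) powr e * r ^ N"
  let ?X = "\<lambda>r. ennreal (?b r powr Q * ?w r) * indicator {0<..<1} r"
  let ?Y = "\<lambda>r. ennreal (?b r powr Q * (1 - r) powr e) * indicator {1/2<..<1} r"
  have Xm [measurable]: "?X \<in> borel_measurable borel"
    by (rule weighted_integrand_measurable[OF mono]) auto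
  have Ym [measurable]: "?Y \<in> borel_measurable borel"
    by (rule weighted_integrand_measurable[OF mono]) auto
  have eq: "(\<integral>\<^sup>+ r \<in> {0<..<1}. epowr (integral_mean p r g) Q * ennreal ((1 - r\<^sup>2) powr e) * ennreal (r ^ N) \<partial>lborel)
     = (\<integral>\<^sup>+ r. ?X r \<partial>lborel)"
  proof (rule nn_integral_cong)
    fix r :: real
    show "epowr (integral_mean p r g) Q * ennreal ((1 - r\<^sup>2) powr e) * ennreal (r ^ N) * indicator {0<..<1} r = ?X r"
    proof (cases "r \<in> {0<..<1}")
      case True
      then have "integral_mean p r g = ennreal (?b r)" using integral_mean_eq_lp_mean[OF p g] by simp
      then show ?thesis using True by (simp add: epowr_def ennreal_mult mult.assoc)
    qed simp
  qed
  have "mixed_norm p q \<beta> g = epowr (of_nat (2 * CARD('n)) *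
      (\<integral>\<^sup>+ r \<in> {0<..<1}. epowr (integral_mean p r g) Q * ennreal ((1 - r\<^sup>2) powr e) * ennreal (r ^ N) \<partial>lborel)) (1 / Q)"
    by (simp only: mixed_norm_def if_False False Q_def e_def N_def)
  then have "mixed_norm p q \<beta> g < top \<longleftrightarrow> (\<integral>\<^sup>+ r. ?X r \<partial>lborel) < top"
    unfolding eq by (auto simp: epowr_less_top_iff ennreal_mult_less_top ennreal_of_nat_eq_real_of_nat)
  also have "\<dots> \<longleftrightarrow> (\<integral>\<^sup>+ r. ?Y r \<partial>lborel) < top"
  proof
    assume X: "(\<integral>\<^sup>+ r. ?X r \<partial>lborel) < top"
    define K where "K = 2 powr \<bar>e\<bar> * 2 ^ N"
    have "(\<integral>\<^sup>+ r. ?Y r \<partial>lborel) \<le> (\<integral>\<^sup>+ r. ennreal K * ?X r \<partial>lborel)"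
    proof (rule nn_integral_mono)
      fix r :: real
      show "?Y r \<le> ennreal K * ?X r"
      proof (cases "r \<in> {1/2<..<1}")
        case True
        have "2 powr (- \<bar>e\<bar>) \<le> (1 + r) powr e" using True by (intro powr_between) auto
        then have "2 powr \<bar>e\<bar> * 2 powr (- \<bar>e\<bar>) \<le> 2 powr \<bar>e\<bar> * (1 + r) powr e" by (intro mult_left_mono) auto
        then have 1: "1 \<le> 2 powr \<bar>e\<bar> * (1 + r) powr e" by (simp flip: powr_add)
        have 2: "1 \<le> 2 ^ N * r ^ N"
          using True one_le_power[of "2 * r" N] unfolding power_mult_distrib by simp
        have "1 * 1 \<le> (2 powr \<bar>e\<bar> * (1 + r) powr e) * (2 ^ N * r ^ N)"
          using 1 2 by (intro mult_mono) auto
        then have "?b r powr Q * (1 - r) powr e * 1 \<le> ?b r powr Q * (1 - r) powr e * ((2 powr \<bar>e\<bar> * (1 + r) powr e) * (2 ^ N * r ^ N))"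
          by (intro mult_left_mono) auto
        also have "\<dots> = K * (?b r powr Q * ?w r)"
          using True by (simp add: K_def one_minus_square_powr mult_ac)
        finally have "ennreal (?b r powr Q * (1 - r) powr e) \<le> ennreal (K * (?b r powr Q * ?w r))"
          by (intro ennreal_leI) simp
        moreover have "0 \<le> K" by (simp add: K_def)
        ultimately show ?thesis using True by (simp add: ennreal_mult')
      qed simp
    qed
    also have "\<dots> = ennreal K * (\<integral>\<^sup>+ r. ?X r \<partial>lborel)" by (rule nn_integral_cmult) measurable
    also have "\<dots> < top" using X by (simp add: ennreal_mult_less_top)
    finally show "(\<integral>\<^sup>+ r. ?Y r \<partial>lborel) < top" .
  next
    assume Y: "(\<integral>\<^sup>+ r. ?Y r \<partial>lborel) < top"
    define K where "K = 2 powr \<bar>e\<bar>"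
    define c where "c = ?b (1/2) powr Q * K"
    have "(\<integral>\<^sup>+ r. ?X r \<partial>lborel) \<le> (\<integral>\<^sup>+ r. ennreal c * indicator {0..1} r + ennreal K * ?Y r \<partial>lborel)"
    proof (rule nn_integral_mono)
      fix r :: real
      show "?X r \<le> ennreal c * indicator {0..1} r + ennreal K * ?Y r"
      proof (cases "r \<in> {0<..<1}")
        case r: True
        have rN: "r ^ N \<le> 1" "0 \<le> r ^ N" using r by (auto intro: power_le_one)
        show ?thesis
        proof (cases "r \<le> 1/2")
          case True
          have "r\<^sup>2 \<le> (1/2)\<^sup>2" using r True by (intro power_mono) auto
          then have "r\<^sup>2 \<le> 1/4" by (simp add: power_divide)
          then have "1/2 \<le> 1 - r\<^sup>2" by linarith
          moreover have "1 - r\<^sup>2 \<le> 2" using zero_le_power2[of r] by linarith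
          ultimately have "(1 - r\<^sup>2) powr e \<le> K"
            unfolding K_def by (rule powr_between)
          then have "(1 - r\<^sup>2) powr e * r ^ N \<le> K * 1" using rN by (intro mult_mono) (auto simp: K_def)
          moreover have "?b r powr Q \<le> ?b (1/2) powr Q"
            using mono r True Q by (intro powr_mono2) (auto simp: mono_on_def)
          ultimately have "?b r powr Q * ?w r \<le> c"
            unfolding c_def using rN by (intro mult_mono) auto
          then have "ennreal (?b r powr Q * ?w r) \<le> ennreal c" by (rule ennreal_leI)
          then show ?thesis using r True by simp
        next
          case False
          have "(1 + r) powr e \<le> K" unfolding K_def using r by (intro powr_between) auto
          then have "(1 + r) powr e * (1 - r) powr e * r ^ N \<le> K * (1 - r) powr e * 1"
            using rN by (intro mult_mono) (auto simp: K_def)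
          then have "?b r powr Q * ?w r \<le> ?b r powr Q * (K * (1 - r) powr e)"
            using r by (intro mult_left_mono) (auto simp: one_minus_square_powr)
          also have "\<dots> = K * (?b r powr Q * (1 - r) powr e)" by (simp only: mult_ac)
          finally have "ennreal (?b r powr Q * ?w r) \<le> ennreal (K * (?b r powr Q * (1 - r) powr e))" by (rule ennreal_leI)
          also have "\<dots> = ennreal K * ennreal (?b r powr Q * (1 - r) powr e)"
            by (rule ennreal_mult) (auto simp: K_def)
          finally show ?thesis using r False by (simp add: add_increasing)
        qed
      qed simp
    qed
    also have "\<dots> = ennreal c + ennreal K * (\<integral>\<^sup>+ r. ?Y r \<partial>lborel)"
      by (subst nn_integral_add) (auto simp: nn_integral_cmult)
    also have "\<dots> < top" using Y by (simp add: ennreal_mult_less_top)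
    finally show "(\<integral>\<^sup>+ r. ?X r \<partial>lborel) < top" .
  qed
  also have "\<dots> \<longleftrightarrow> weighted_finite q \<beta> ?b"
    using False by (simp add: weighted_finite_def Q_def e_def)
  finally show ?thesis .
qed

section \<open>Gradients and radial derivatives\<close>

lemma lp_mean_mono_on:
  fixes u :: "complex ^ 'n::finite \<Rightarrow> complex"
  assumes "1 \<le> p" "holomorphic_in u (ball 0 1)"
  shows "mono_on {0..<1} (lp_mean p u)"
  by (auto intro!: mono_onI lp_mean_mono[OF assms])

lemma weighted_finite_lp_mean_sum:
  fixes g :: "complex ^ 'n::finite \<Rightarrow> 'b::real_normed_vector" and h :: "'k \<Rightarrow> complex ^ 'n \<Rightarrow> 'c::real_normed_vector"
  assumes p: "1 \<le> p" and q: "1 \<le> q" and g: "continuous_on (ball 0 1) g" and K: "finite K" and c: "0 \<le> c"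
    and h: "\<And>k. k \<in> K \<Longrightarrow> continuous_on (ball 0 1) (h k)"
    and mono: "\<And>k. k \<in> K \<Longrightarrow> mono_on {0..<1} (lp_mean p (h k))"
    and fin: "\<And>k. k \<in> K \<Longrightarrow> weighted_finite q \<beta> (lp_mean p (h k))"
    and le: "\<And>z. z \<in> ball 0 1 \<Longrightarrow> norm (g z) \<le> c * (\<Sum>k\<in>K. norm (h k z))"
  shows "weighted_finite q \<beta> (lp_mean p g)"
proof (rule weighted_finite_sum_bound[OF q K, of "c * (real (card K))\<^sup>2"])
  show "0 \<le> lp_mean p g r \<and> lp_mean p g r \<le> c * (real (card K))\<^sup>2 * (\<Sum>k\<in>K. lp_mean p (h k) r)"
    if "r \<in> {1/2<..<1}" for r
    using lp_mean_sum_le[OF p g _ _ h K c le] that by (simp add: mult.assoc)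
qed (use mono fin c in auto)

lemma weighted_finite_lp_mean_le:
  fixes g :: "complex ^ 'n::finite \<Rightarrow> 'b::real_normed_vector" and h :: "complex ^ 'n \<Rightarrow> 'c::real_normed_vector"
  assumes "1 \<le> p" "1 \<le> q" "continuous_on (ball 0 1) g" "continuous_on (ball 0 1) h"
    and "mono_on {0..<1} (lp_mean p h)" "weighted_finite q \<beta> (lp_mean p h)"
    and "\<And>z. z \<in> ball 0 1 \<Longrightarrow> norm (g z) \<le> norm (h z)"
  shows "weighted_finite q \<beta> (lp_mean p g)"
  by (rule weighted_finite_lp_mean_sum[where K="{()}" and c=1 and h="\<lambda>_. h"]) (use assms in auto)

lemma weighted_finite_lp_mean_cong:
  fixes u v :: "complex ^ 'n::finite \<Rightarrow> complex"
  assumes "1 \<le> p" "1 \<le> q" "holomorphic_in u (ball 0 1)" "\<And>z. z \<in> ball 0 1 \<Longrightarrow> u z = v z"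
    and "weighted_finite q \<beta> (lp_mean p u)"
  shows "weighted_finite q \<beta> (lp_mean p v)"
  by (rule weighted_finite_lp_mean_le[OF assms(1,2) _ _ lp_mean_mono_on[OF assms(1,3)] assms(5)])
    (use assms(4) in \<open>auto intro!: holomorphic_in_continuous_on assms(3) holomorphic_in_cong[OF open_ball assms(4)]\<close>)

lemma gradient_order_L2_set:
  "gradient_order s f z = L2_set (\<lambda>js. cmod (foldr partial_deriv js f z)) {js. length js = s}"
  by (simp add: gradient_order_def L2_set_def)

lemma gradient_order_continuous:
  fixes f :: "complex ^ 'n::finite \<Rightarrow> complex"
  assumes "holomorphic_in f (ball 0 1)"
  shows "continuous_on (ball 0 1) (gradient_order s f)"
  unfolding gradient_order_def[abs_def]
  by (intro continuous_intros holomorphic_in_continuous_on iterated_partial_holomorphic open_ball assms)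

lemma spin_id: "spin (\<lambda>z. z) a \<tau> \<zeta> = disc_moebius a \<tau> *s \<zeta>"
  by (simp add: spin_def vec_eq_iff field_simps)

text \<open>The gradient is a Euclidean norm, so at a given point it is the absolute value of a linear
  combination \<open>h\<close> of derivatives of \<open>f\<close>, and \<open>\<bar>h\<bar>\<close> is dominated by the gradient everywhere. Thus it
  inherits the mean value inequality from holomorphic functions.\<close>

lemma lp_mean_gradient_mono_on:
  fixes f :: "complex ^ 'n::finite \<Rightarrow> complex"
  assumes p: "1 \<le> p" and f: "holomorphic_in f (ball 0 1)"
  shows "mono_on {0..<1} (lp_mean p (gradient_order s f))"
proof (rule mono_onI)
  fix r R :: real assume rR: "r \<in> {0..<1}" "R \<in> {0..<1}" "r \<le> R"
  let ?G = "gradient_order s f" and ?S = "{js :: 'n list. length js = s}"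
  note G = gradient_order_continuous[OF f, of s]
  have G0: "0 \<le> ?G z" for z by (simp add: gradient_order_L2_set L2_set_nonneg)
  show "lp_mean p ?G r \<le> lp_mean p ?G R"
  proof (cases "r = R")
    case False
    then have r: "0 \<le> r" "r < R" "R < 1" using rR by auto
    let ?e = "\<lambda>\<theta>::real. exp (2 * of_real pi * \<i> * of_real \<theta>)"
    show ?thesis
    proof (rule lp_mean_mono_of_average[OF p G r])
      fix \<zeta> :: "complex ^ 'n" assume \<zeta>: "norm \<zeta> = 1"
      let ?\<gamma> = "\<lambda>\<theta>. R *\<^sub>R spin (\<lambda>z. z) (r/R) (?e \<theta>) \<zeta>"
      have a: "0 \<le> r / R" "r / R < 1" using r by auto
      have mem: "?\<gamma> \<theta> \<in> ball 0 1" for \<theta>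
        using orthogonal_transformation_norm[OF spin_orthogonal[OF unitary_involution_id a], of "?e \<theta>" \<zeta>] \<zeta> r
        by simp
      have c\<gamma>: "continuous_on {0..1} ?\<gamma>"
        unfolding spin_id
        by (intro continuous_on_scaleR continuous_on_const bounded_linear.continuous_on[OF bounded_linear_smult_left]
            moebius_continuous[OF a] continuous_intros) auto
      define z0 where "z0 = r *\<^sub>R \<zeta>"
      have cG: "continuous_on {0..1} (\<lambda>\<theta>. ?G (?\<gamma> \<theta>))"
        by (rule continuous_on_compose2[OF G c\<gamma>]) (use mem in auto)
      have "?G z0 \<le> integral {0..1} (\<lambda>\<theta>. ?G (?\<gamma> \<theta>))"
      proof (cases "?G z0 = 0")
        case True
        then show ?thesis using integral_nonneg[OF integrable_continuous_real[OF cG]] G0 by simp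
      next
        case False
        then have pos: "0 < ?G z0" using G0[of z0] by simp
        \<comment> \<open>A unit vector, so the Cauchy-Schwarz inequality gives \<open>\<bar>h\<bar> \<le> ?G\<close>, with equality at \<open>z0\<close>.\<close>
        define w where "w = (\<lambda>js. cnj (foldr partial_deriv js f z0) / of_real (?G z0))"
        define h where "h = (\<lambda>z. \<Sum>js\<in>?S. w js * foldr partial_deriv js f z)"
        have hol: "holomorphic_in h (ball 0 1)"
        proof -
          have "holomorphic_in (\<lambda>z. w js * foldr partial_deriv js f z) (ball 0 1)" for js
            by (rule holomorphic_inI[OF has_derivative_holomorphic_cmult[OF iterated_partial_holomorphic[OF open_ball f]]])
          then show ?thesis unfolding h_def by (intro holomorphic_inI[OF has_derivative_holomorphic_sum])
        qed
        have "(\<Sum>js\<in>?S. (cmod (foldr partial_deriv js f z0))\<^sup>2) = (?G z0)\<^sup>2"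
          by (simp add: gradient_order_def sum_nonneg)
        then have sq: "(\<Sum>js\<in>?S. cnj (foldr partial_deriv js f z0) * foldr partial_deriv js f z0) = of_real ((?G z0)\<^sup>2)"
          by (simp add: mult.commute[of "cnj _"] complex_norm_square[symmetric] flip: of_real_sum of_real_power)
        have "h z0 = of_real ((?G z0)\<^sup>2) / of_real (?G z0)"
          unfolding h_def w_def sq[symmetric] by (simp add: sum_divide_distrib)
        then have h0: "h z0 = of_real (?G z0)" using pos by (simp add: power2_eq_square)
        have w1: "L2_set (\<lambda>js. cmod (w js)) ?S = 1"
        proof -
          have "L2_set (\<lambda>js. cmod (w js)) ?S = L2_set (\<lambda>js. 1 / ?G z0 * cmod (foldr partial_deriv js f z0)) ?S"
            using pos by (simp add: w_def norm_divide)
          also have "\<dots> = 1 / ?G z0 * ?G z0"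
            unfolding gradient_order_L2_set[of s f z0] using pos
            by (subst L2_set_right_distrib[symmetric]) (auto simp: gradient_order_L2_set)
          finally show ?thesis using pos by simp
        qed
        have hG: "cmod (h z) \<le> ?G z" for z
        proof -
          have "cmod (h z) \<le> (\<Sum>js\<in>?S. \<bar>cmod (w js)\<bar> * \<bar>cmod (foldr partial_deriv js f z)\<bar>)"
            unfolding h_def by (rule sum_norm_le) (simp add: norm_mult)
          also have "\<dots> \<le> L2_set (\<lambda>js. cmod (w js)) ?S * L2_set (\<lambda>js. cmod (foldr partial_deriv js f z)) ?S"
            by (rule L2_set_mult_ineq)
          finally show ?thesis by (simp add: w1 gradient_order_L2_set)
        qed
        have ch: "continuous_on {0..1} (\<lambda>\<theta>. cmod (h (?\<gamma> \<theta>)))"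
          by (intro continuous_on_norm continuous_on_compose2[OF holomorphic_in_continuous_on[OF hol] c\<gamma>])
            (use mem in auto)
        have "?G z0 = cmod (h z0)" using pos by (simp add: h0)
        also have "\<dots> \<le> integral {0..1} (\<lambda>\<theta>. cmod (h (?\<gamma> \<theta>)))"
          unfolding z0_def by (rule spin_average_bounds(1)[OF hol unitary_involution_id r \<zeta>])
        also have "\<dots> \<le> integral {0..1} (\<lambda>\<theta>. ?G (?\<gamma> \<theta>))"
          by (intro integral_le integrable_continuous_real ch cG hG)
        finally show ?thesis .
      qed
      then show "norm (?G (r *\<^sub>R \<zeta>)) \<le> integral {0..1} (\<lambda>\<theta>. norm (?G (?\<gamma> \<theta>)))"
        using G0 by (simp add: z0_def)
    qed
  qed simp
qed

lemma weighted_finite_gradient_iff: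
  fixes f :: "complex ^ 'n::finite \<Rightarrow> complex"
  assumes p: "1 \<le> p" and q: "1 \<le> q" and f: "holomorphic_in f (ball 0 1)"
  shows "weighted_finite q \<beta> (lp_mean p (gradient_order s f)) \<longleftrightarrow>
     (\<forall>js. length js = s \<longrightarrow> weighted_finite q \<beta> (lp_mean p (foldr partial_deriv js f)))"
proof
  note hol = iterated_partial_holomorphic[OF open_ball f]
  note G = gradient_order_continuous[OF f, of s]
  {
    assume fin: "weighted_finite q \<beta> (lp_mean p (gradient_order s f))"
    show "\<forall>js. length js = s \<longrightarrow> weighted_finite q \<beta> (lp_mean p (foldr partial_deriv js f))"
    proof (intro allI impI)
      fix js :: "'n list" assume js: "length js = s"
      show "weighted_finite q \<beta> (lp_mean p (foldr partial_deriv js f))"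
      proof (rule weighted_finite_lp_mean_le[OF p q holomorphic_in_continuous_on[OF hol] G lp_mean_gradient_mono_on[OF p f] fin])
        show "cmod (foldr partial_deriv js f z) \<le> norm (gradient_order s f z)" for z
          unfolding gradient_order_L2_set
          using member_le_L2_set[OF finite_lists_of_length, of js s "\<lambda>js. cmod (foldr partial_deriv js f z)"] js
          by (simp add: L2_set_nonneg)
      qed
    qed
  }
  assume fin: "\<forall>js. length js = s \<longrightarrow> weighted_finite q \<beta> (lp_mean p (foldr partial_deriv js f))"
  show "weighted_finite q \<beta> (lp_mean p (gradient_order s f))"
  proof (rule weighted_finite_lp_mean_sum[OF p q G, of "{js. length js = s}" 1 "\<lambda>js. foldr partial_deriv js f"])
    show "norm (gradient_order s f z) \<le> 1 * (\<Sum>js | length js = s. cmod (foldr partial_deriv js f z))" for z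
      unfolding gradient_order_L2_set by (simp add: L2_set_nonneg L2_set_le_sum)
  qed (use fin in \<open>auto intro!: holomorphic_in_continuous_on hol lp_mean_mono_on[OF p]\<close>)
qed

subsection \<open>From gradients to radial derivatives\<close>

lemma norm_component_mult_le:
  fixes z :: "complex ^ 'n::finite"
  assumes "z \<in> ball 0 1"
  shows "cmod (z $ k * w) \<le> cmod w"
  using Finite_Cartesian_Product.norm_nth_le[of z k] assms by (simp add: norm_mult mult_left_le_one_le)

text \<open>Compare the radii \<open>r\<close> and \<open>r/2\<close>: the means at \<open>r/2\<close> are bounded, and the increment is controlled by \<open>\<R> g\<close>.\<close>

lemma weighted_finite_of_partial_derivs:
  fixes g :: "complex ^ 'n::finite \<Rightarrow> complex"
  assumes p: "1 \<le> p" and q: "1 \<le> q" and \<beta>: "0 < \<beta>" and g: "holomorphic_in g (ball 0 1)"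
    and fin: "\<And>k. weighted_finite q \<beta> (lp_mean p (partial_deriv k g))"
  shows "weighted_finite q \<beta> (lp_mean p g)"
proof -
  note hol = partial_deriv_holomorphic[OF open_ball g]
  note hR = euler_holomorphic[OF open_ball g, of 0]
  have "weighted_finite q \<beta> (lp_mean p (euler 0 g))"
  proof (rule weighted_finite_lp_mean_sum[OF p q, of _ UNIV 1 "\<lambda>k. partial_deriv k g"])
    show "cmod (euler 0 g z) \<le> 1 * (\<Sum>k\<in>UNIV. cmod (partial_deriv k g z))" if "z \<in> ball 0 1" for z
      using sum_norm_le[of UNIV "\<lambda>k. z $ k * partial_deriv k g z"] norm_component_mult_le[OF that]
      by (simp add: euler_def)
  qed (auto intro!: holomorphic_in_continuous_on hol hR lp_mean_mono_on[OF p] fin)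
  then have finR: "weighted_finite q \<beta> (\<lambda>r. if b then lp_mean p g (1/2) else lp_mean p (euler 0 g) r)" for b
    by (cases b) (auto intro!: weighted_finite_const[OF q \<beta>])
  show ?thesis
  proof (rule weighted_finite_sum_bound[OF q _ _ _ _ finR, of "UNIV :: bool set" 4])
    show "mono_on {0..<1} (\<lambda>r. if b then lp_mean p g (1/2) else lp_mean p (euler 0 g) r)" for b
      using lp_mean_mono_on[OF p hR] by (cases b) (auto intro: mono_onI)
    fix r :: real assume r: "r \<in> {1/2<..<1}"
    have "lp_mean p g (1/2 * r) \<le> lp_mean p g (1/2)"
      using r by (intro lp_mean_mono[OF p g]) auto
    then show "0 \<le> lp_mean p g r \<and> lp_mean p g r \<le> 4 *
        (\<Sum>b\<in>UNIV. if b then lp_mean p g (1/2) else lp_mean p (euler 0 g) r)"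
      using lp_mean_along_ray[OF p g, of r "1/2" 0] r by (simp add: UNIV_bool)
  qed auto
qed

lemma weighted_finite_lower_orders:
  fixes f :: "complex ^ 'n::finite \<Rightarrow> complex"
  assumes p: "1 \<le> p" and q: "1 \<le> q" and \<beta>: "0 < \<beta>" and f: "holomorphic_in f (ball 0 1)"
    and fin: "\<And>js. length js = s \<Longrightarrow> weighted_finite q \<beta> (lp_mean p (foldr partial_deriv js f))"
    and le: "length js \<le> s"
  shows "weighted_finite q \<beta> (lp_mean p (foldr partial_deriv js f))"
  using le
proof (induction "s - length js" arbitrary: js)
  case 0
  then show ?case using fin by simp
next
  case (Suc d)
  then have "weighted_finite q \<beta> (lp_mean p (partial_deriv k (foldr partial_deriv js f)))" for k
    using Suc.hyps(1)[of "k # js"] by simp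
  then show ?case
    by (rule weighted_finite_of_partial_derivs[OF p q \<beta> iterated_partial_holomorphic[OF open_ball f]])
qed

lemma iterated_partial_euler:
  assumes "open U" "holomorphic_in u U" "z \<in> U"
  shows "foldr partial_deriv js (euler c u) z = euler (c + of_nat (length js)) (foldr partial_deriv js u) z"
  using assms(3)
proof (induction js arbitrary: z)
  case (Cons j js)
  note hol = iterated_partial_holomorphic[OF assms(1,2)]
  have "foldr partial_deriv (j # js) (euler c u) z
      = partial_deriv j (euler (c + of_nat (length js)) (foldr partial_deriv js u)) z"
    using partial_deriv_cong[OF assms(1) Cons.prems Cons.IH
        iterated_partial_holomorphic[OF assms(1) euler_holomorphic[OF assms(1,2)]]] by simp
  also have "\<dots> = euler (c + of_nat (length js) + 1) (partial_deriv j (foldr partial_deriv js u)) z"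
    by (rule partial_deriv_euler[OF assms(1) hol Cons.prems])
  finally show ?case by (simp add: add_ac)
qed simp

lemma weighted_finite_euler:
  fixes u :: "complex ^ 'n::finite \<Rightarrow> complex"
  assumes p: "1 \<le> p" and q: "1 \<le> q" and u: "holomorphic_in u (ball 0 1)"
    and fin0: "weighted_finite q \<beta> (lp_mean p u)"
    and fin1: "\<And>k. weighted_finite q \<beta> (lp_mean p (partial_deriv k u))"
  shows "weighted_finite q \<beta> (lp_mean p (euler c u))"
proof (rule weighted_finite_lp_mean_sum[OF p q, of _ "UNIV :: 'n option set" "1 + cmod c"
      "\<lambda>k. case k of None \<Rightarrow> u | Some k \<Rightarrow> partial_deriv k u"])
  note hol = partial_deriv_holomorphic[OF open_ball u]
  show "continuous_on (ball 0 1) (euler c u)"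
    by (intro holomorphic_in_continuous_on euler_holomorphic u) simp
  fix z :: "complex ^ 'n" assume z: "z \<in> ball 0 1"
  have "cmod (euler c u z) \<le> (\<Sum>k\<in>UNIV. cmod (partial_deriv k u z)) + cmod c * cmod (u z)"
    unfolding euler_def
    by (intro norm_triangle_le add_mono sum_norm_le norm_component_mult_le[OF z]) (simp add: norm_mult)
  also have "\<dots> \<le> (1 + cmod c) * (\<Sum>k\<in>UNIV. cmod (partial_deriv k u z)) + (1 + cmod c) * cmod (u z)"
    using mult_right_mono[of 1 "1 + cmod c" "\<Sum>k\<in>UNIV. cmod (partial_deriv k u z)"]
    by (intro add_mono mult_right_mono) (auto simp: sum_nonneg)
  also have "\<dots> = (1 + cmod c) * (\<Sum>k\<in>UNIV. cmod ((case k of None \<Rightarrow> u | Some k \<Rightarrow> partial_deriv k u) z))"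
    by (simp add: UNIV_option_conv sum.reindex distrib_left)
  finally show "cmod (euler c u z) \<le> (1 + cmod c) * (\<Sum>k\<in>UNIV. cmod ((case k of None \<Rightarrow> u | Some k \<Rightarrow> partial_deriv k u) z))" .
next
  note hol = partial_deriv_holomorphic[OF open_ball u]
  fix k :: "'n option"
  show "continuous_on (ball 0 1) (case k of None \<Rightarrow> u | Some k \<Rightarrow> partial_deriv k u)"
    by (cases k) (auto intro!: holomorphic_in_continuous_on u hol)
  show "mono_on {0..<1} (lp_mean p (case k of None \<Rightarrow> u | Some k \<Rightarrow> partial_deriv k u))"
    by (cases k) (auto intro!: lp_mean_mono_on[OF p] u hol)
  show "weighted_finite q \<beta> (lp_mean p (case k of None \<Rightarrow> u | Some k \<Rightarrow> partial_deriv k u))"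
    by (cases k) (auto intro!: fin0 fin1)
qed auto

text \<open>Induction via \<open>\<R>\<^sup>m\<^sup>+\<^sup>1 = \<R>\<^sup>m \<R>\<close>: derivatives of \<open>\<R> u\<close> are of the form \<open>(\<R> + c)\<close> applied to derivatives of
  \<open>u\<close>, hence combinations of derivatives whose order is at most one higher.\<close>

lemma weighted_finite_euler_pow:
  fixes u :: "complex ^ 'n::finite \<Rightarrow> complex"
  assumes p: "1 \<le> p" and q: "1 \<le> q" and u: "holomorphic_in u (ball 0 1)"
    and fin: "\<And>js. length js \<le> m \<Longrightarrow> weighted_finite q \<beta> (lp_mean p (foldr partial_deriv js u))"
  shows "weighted_finite q \<beta> (lp_mean p ((euler c ^^ m) u))"
  using u fin
proof (induction m arbitrary: u)
  case 0
  then show ?case using "0.prems"(2)[of "[]"] by simp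
next
  case (Suc m)
  note hol = iterated_partial_holomorphic[OF open_ball Suc.prems(1)]
  have "weighted_finite q \<beta> (lp_mean p (foldr partial_deriv js (euler c u)))" if js: "length js \<le> m" for js
  proof (rule weighted_finite_lp_mean_cong[OF p q euler_holomorphic[OF open_ball hol]])
    show "euler (c + of_nat (length js)) (foldr partial_deriv js u) z = foldr partial_deriv js (euler c u) z"
      if "z \<in> ball 0 1" for z
      by (rule iterated_partial_euler[OF open_ball Suc.prems(1) that, symmetric])
    show "weighted_finite q \<beta> (lp_mean p (euler (c + of_nat (length js)) (foldr partial_deriv js u)))"
    proof (rule weighted_finite_euler[OF p q hol])
      show "weighted_finite q \<beta> (lp_mean p (foldr partial_deriv js u))"
        using js by (intro Suc.prems(2)) simp
      show "weighted_finite q \<beta> (lp_mean p (partial_deriv k (foldr partial_deriv js u)))" for k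
        using Suc.prems(2)[of "k # js"] js by simp
    qed
  qed
  then have "weighted_finite q \<beta> (lp_mean p ((euler c ^^ m) (euler c u)))"
    by (rule Suc.IH[OF euler_holomorphic[OF open_ball Suc.prems(1)]])
  then show ?case by (simp add: funpow_swap1)
qed

subsection \<open>From radial derivatives to gradients\<close>

text \<open>The crucial step. With \<open>v = \<partial>\<^sub>j u\<close> and \<open>h = (\<R> + c) u\<close> one has \<open>(\<R> + c + 1) v = \<partial>\<^sub>j h\<close>, and the mean of
  \<open>\<partial>\<^sub>j h\<close> at the radius \<open>r\<close> exceeds that of \<open>h\<close> at \<open>(1 + r)/2\<close> by at most a factor of order \<open>1/(1 - r)\<close>. Integrating
  along a segment of a ray of length of order \<open>1 - r\<close> compensates for this factor.\<close>

lemma weighted_finite_partial_deriv: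
  fixes u :: "complex ^ 'n::finite \<Rightarrow> complex" and c :: nat
  assumes p: "1 \<le> p" and q: "1 \<le> q" and \<beta>: "0 < \<beta>" and u: "holomorphic_in u (ball 0 1)"
    and fin: "weighted_finite q \<beta> (lp_mean p (euler (of_nat c) u))"
  shows "weighted_finite q \<beta> (lp_mean p (partial_deriv j u))"
proof -
  \<comment> \<open>The smallest \<open>l\<close> that allows absorption.\<close>
  define l :: real where "l = 16 powr (1 / \<beta>)"
  have l: "1 < l" "16 \<le> l powr \<beta>"
    using \<beta> by (auto simp: l_def powr_powr intro: gr_one_powr)
  define K where "K = (real (CARD('n) * 4))\<^sup>2"
  let ?h = "euler (of_nat c) u" and ?v = "partial_deriv j u"
  note hh = euler_holomorphic[OF open_ball u, of "of_nat c"] and hv = partial_deriv_holomorphic[OF open_ball u, of j]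
  note hw = euler_holomorphic[OF open_ball hv, of "of_nat (Suc c)"]
  have eq: "euler (of_nat (Suc c)) ?v z = partial_deriv j ?h z" if "z \<in> ball 0 1" for z
    using partial_deriv_euler[OF open_ball u that, of j "of_nat c"] by (simp add: add.commute)
  show ?thesis
  proof (rule weighted_finite_absorb[OF q \<beta> l, of "16 * l * K" "lp_mean p ?h"])
    fix r assume r: "r \<in> {1 - 1 / (2 * l)<..<1}"
    have "l * (1 - r) < l * (1 / (2 * l))" using r l(1) by (intro mult_strict_left_mono) auto
    then have lr: "l * (1 - r) < 1/2" using l(1) by simp
    have le: "1 - r \<le> l * (1 - r)" using mult_right_mono[of 1 l "1 - r"] r l(1) by simp
    from le_less_trans[OF le lr] have r12: "1/2 < r" "r < 1" using r by auto
    \<comment> \<open>The choice of \<open>t\<close> moves from distance \<open>1 - r\<close> to distance \<open>l (1 - r)\<close> from the boundary.\<close>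
    define t where "t = (1 - l * (1 - r)) / r"
    have "1 - l * (1 - r) \<le> r" using le by (simp only: diff_le_eq add.commute)
    then have t: "0 < t" "t \<le> 1" "t * r = 1 - l * (1 - r)"
      using lr r12 by (simp_all add: t_def)
    have "(1 - t) / t = (r - t * r) / (t * r)" using r12 by (simp add: diff_divide_distrib)
    also have "\<dots> \<le> (l * (1 - r)) / (1/2)"
      using lr t(3) r12 l(1) mult_nonneg_nonneg[of l "1 - r"] by (intro frac_le) (simp_all add: algebra_simps)
    finally have t': "(1 - t) / t \<le> 2 * l * (1 - r)" by simp
    let ?A = "lp_mean p ?h ((1 + r) / 2)" and ?W = "lp_mean p (euler (of_nat (Suc c)) ?v) r"
    have "?W \<le> lp_mean p (partial_deriv j ?h) r"
      using lp_mean_sum_le[OF p holomorphic_in_continuous_on[OF hw], of r "{()}" "\<lambda>_. partial_deriv j ?h" 1]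
        holomorphic_in_continuous_on[OF partial_deriv_holomorphic[OF open_ball hh]] eq r12 by simp
    also have "\<dots> \<le> K * (?A / ((1 + r) / 2 - r))"
      unfolding K_def using r12 by (intro lp_mean_partial_deriv[OF p hh]) auto
    also have "(1 + r) / 2 - r = (1 - r) / 2" by (simp add: field_simps)
    finally have "(1 - t) / t * ?W \<le> (2 * l * (1 - r)) * (K * (?A / ((1 - r) / 2)))"
      using t t' l(1) r12 by (intro mult_mono) (auto intro!: mult_nonneg_nonneg)
    also have "\<dots> = 4 * l * K * ?A" using r12 by (simp add: field_simps)
    finally have W: "(1 - t) / t * ?W \<le> 4 * l * K * ?A" .
    have "lp_mean p ?v r \<le> 4 * (lp_mean p ?v (t * r) + (1 - t) / t * ?W)"
      by (rule lp_mean_along_ray[OF p hv]) (use r12 t in auto)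
    also have "\<dots> \<le> 4 * (lp_mean p ?v (t * r) + 4 * l * K * ?A)"
      using W by (intro mult_left_mono add_left_mono) auto
    also have "\<dots> = 4 * lp_mean p ?v (1 - l * (1 - r)) + 16 * l * K * ?A"
      unfolding t(3) by (simp add: distrib_left)
    finally show "lp_mean p ?v r \<le> 4 * lp_mean p ?v (1 - l * (1 - r)) + 16 * l * K * ?A" .
  qed (use l fin lp_mean_mono_on[OF p hh] lp_mean_mono_on[OF p hv] in \<open>auto simp: K_def\<close>)
qed

text \<open>Each step replaces one factor \<open>\<R> + c\<close> by a partial derivative, which then moves to the inside past the
  remaining factors and raises \<open>c\<close> by one.\<close>

lemma weighted_finite_iterated_partial:
  fixes u :: "complex ^ 'n::finite \<Rightarrow> complex" and c :: nat
  assumes p: "1 \<le> p" and q: "1 \<le> q" and \<beta>: "0 < \<beta>" and u: "holomorphic_in u (ball 0 1)"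
    and fin: "weighted_finite q \<beta> (lp_mean p ((euler (of_nat c) ^^ m) u))" and js: "length js = m"
  shows "weighted_finite q \<beta> (lp_mean p (foldr partial_deriv js u))"
  using u fin js
proof (induction m arbitrary: u c js)
  case (Suc m)
  obtain ks j where js: "js = ks @ [j]" "length ks = m"
    using Suc.prems(3) by (metis length_Suc_conv_rev)
  note hol = euler_pow_holomorphic[OF open_ball Suc.prems(1), where c="of_nat c" and m=m]
  have "weighted_finite q \<beta> (lp_mean p (partial_deriv j ((euler (of_nat c) ^^ m) u)))"
    using weighted_finite_partial_deriv[OF p q \<beta> hol, of c j] Suc.prems(2) by simp
  then have "weighted_finite q \<beta> (lp_mean p ((euler (of_nat (Suc c)) ^^ m) (partial_deriv j u)))"
    by (rule weighted_finite_lp_mean_cong[OF p q partial_deriv_holomorphic[OF open_ball hol], rotated])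
      (simp add: partial_deriv_euler_pow[OF open_ball Suc.prems(1)] add.commute)
  then have "weighted_finite q \<beta> (lp_mean p (foldr partial_deriv ks (partial_deriv j u)))"
    by (rule Suc.IH[OF partial_deriv_holomorphic[OF open_ball Suc.prems(1)] _ js(2)])
  then show ?case by (simp add: js(1))
qed simp

lemma least_int_above_greater: "\<alpha> < real (least_int_above \<alpha>)"
  unfolding least_int_above_def by (rule LeastI_ex) (rule reals_Archimedean2)

theorem proposition1p1:
  fixes f :: "complex ^ 'n::finite \<Rightarrow> complex" and p q :: ennreal and \<alpha> :: real and s :: nat
  assumes "1 \<le> p" and "1 \<le> q" and "0 < \<alpha>"
    and "s = least_int_above \<alpha>"
    and "holomorphic_in f (ball 0 1)"
  shows "f \<in> besov_lipschitz p q \<alpha> \<longleftrightarrow> gradient_order s f \<in> mixed_norm_space p q (real s - \<alpha>)"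
proof -
  note p = assms(1) and q = assms(2) and f = assms(5)
  define \<beta> where "\<beta> = real s - \<alpha>"
  have "\<alpha> < real s" using least_int_above_greater assms(4) by simp
  then have \<beta>: "0 < \<beta>" and s: "0 < s" using assms(3) by (auto simp: \<beta>_def)
  have in_space: "g \<in> mixed_norm_space p q \<beta> \<longleftrightarrow> weighted_finite q \<beta> (lp_mean p g)"
    if "continuous_on (ball 0 1) g" "mono_on {0..<1} (lp_mean p g)"
    for g :: "complex ^ 'n \<Rightarrow> 'b::{real_normed_vector, second_countable_topology}"
    using mixed_norm_finite_iff[OF p q \<beta> that] borel_measurable_continuous_on_restrict[OF that(1)]
    by (simp add: mixed_norm_space_def)
  let ?R = "radial_derivative (of_nat s) f" and ?E = "(euler 0 ^^ s) f"
  have hE: "holomorphic_in ?E (ball 0 1)" by (rule euler_pow_holomorphic[OF open_ball f])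
  have RE: "?E z = ?R z" if "z \<in> ball 0 1" for z
    by (rule radial_derivative_eq_euler_pow[OF f that s, symmetric])
  have hR: "holomorphic_in ?R (ball 0 1)" by (rule holomorphic_in_cong[OF open_ball RE hE])
  have "f \<in> besov_lipschitz p q \<alpha> \<longleftrightarrow> ?R \<in> mixed_norm_space p q \<beta>"
    using f by (simp add: besov_lipschitz_def assms(4) \<beta>_def)
  also have "\<dots> \<longleftrightarrow> weighted_finite q \<beta> (lp_mean p ?R)"
    by (rule in_space[OF holomorphic_in_continuous_on[OF hR] lp_mean_mono_on[OF p hR]])
  also have "\<dots> \<longleftrightarrow> weighted_finite q \<beta> (lp_mean p ?E)"
    using weighted_finite_lp_mean_cong[OF p q hE RE] weighted_finite_lp_mean_cong[OF p q hR RE[symmetric]] by blast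
  also have "\<dots> \<longleftrightarrow> (\<forall>js. length js = s \<longrightarrow> weighted_finite q \<beta> (lp_mean p (foldr partial_deriv js f)))"
  proof
    assume "weighted_finite q \<beta> (lp_mean p ?E)"
    then show "\<forall>js. length js = s \<longrightarrow> weighted_finite q \<beta> (lp_mean p (foldr partial_deriv js f))"
      using weighted_finite_iterated_partial[OF p q \<beta> f, of s 0] by (simp only: of_nat_0) blast
  next
    assume "\<forall>js. length js = s \<longrightarrow> weighted_finite q \<beta> (lp_mean p (foldr partial_deriv js f))"
    then show "weighted_finite q \<beta> (lp_mean p ?E)"
      using weighted_finite_lower_orders[OF p q \<beta> f, of s] by (intro weighted_finite_euler_pow[OF p q f]) blast
  qed
  also have "\<dots> \<longleftrightarrow> weighted_finite q \<beta> (lp_mean p (gradient_order s f))"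
    by (rule weighted_finite_gradient_iff[OF p q f, symmetric])
  also have "\<dots> \<longleftrightarrow> gradient_order s f \<in> mixed_norm_space p q \<beta>"
    by (rule in_space[OF gradient_order_continuous[OF f] lp_mean_gradient_mono_on[OF p f], symmetric])
  finally show ?thesis by (simp add: \<beta>_def)
qed

end
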